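(* Let $M$ be a compact oriented smooth $6$-manifold, and let $\mathcal{J}_+(M)$ be the space of almost complex structures on $M$ that induce the given orientation. Then for any real constants $c_1$ and $c_2$, the functional $$F_c(J)=\int_M c_1\,\Phi(J)+c_2\,\tfrac{i}{8}\,\psi(J)\wedge\overline{\psi(J)},\qquad J\in\mathcal{J}_+(M),$$ (where $\Phi(J)$ and $\psi(J)$ are the invariant forms built from the Nijenhuis tensor of $J$) is a well-defined, diffeomorphism-invariant, first-order functional on $\mathcal{J}_+(M)$, and it belongs to the class $L^6_1$.
   Context: For an almost complex structure $J$ on a $6$-manifold $M$, $\mathcal{A}^{p,q}(M)$ is the space of smooth complex-valued forms of type $(p,q)$, where $\alpha$ is of type $(1,0)$ iff $\alpha(Jv)=i\,\alpha(v)$. The exterior derivative decomposes as $d=d^{2,-1}+\partial+\bar\partial+d^{-1,2}$ with $d^{r,s}:\mathcal{A}^{p,q}\to\mathcal{A}^{p+r,q+s}$, $\partial=d^{1,0}$, $\bar\partial=d^{0,1}$. A $J$-complex local coframing on an open set $U$ is a column $\alpha=(\alpha^1,\alpha^2,\alpha^3)$ of pointwise linearly independent $(1,0)$-forms on $U$. Define $N(\alpha):U\to M_{3\times3}(\mathbb{C})$ by $$d^{-1,2}\begin{pmatrix}\alpha^1\\ \alpha^2\\ \alpha^3\end{pmatrix}=N(\alpha)\begin{pmatrix}\overline{\alpha^2\wedge\alpha^3}\\ \overline{\alpha^3\wedge\alpha^1}\\ \overline{\alpha^1\wedge\alpha^2}\end{pmatrix}.$$ Let $P$ be the symmetric trilinear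 form on $M_{3\times 3}(\mathbb{C})$ with $P(a,a,a)=\det a$. On $U$ set $$\Phi(J)=\tfrac{i}{8}|\det N(\alpha)|^2\,\alpha^1\wedge\alpha^2\wedge\alpha^3\wedge\overline{\alpha^1}\wedge\overline{\alpha^2}\wedge\overline{\alpha^3},\qquad \psi(J)=P\bigl(\overline{N(\alpha)},\overline{N(\alpha)},{}^tN(\alpha)\bigr)\,\alpha^1\wedge\alpha^2\wedge\alpha^3.$$ These are independent of the choice of $\alpha$ and so are globally defined on $M$. "First-order" means that the integrand at $x$ depends only on the $1$-jet of $J$ at $x$; "diffeomorphism-invariant" means $F_c(f^*J)=F_c(J)$ for all orientation-preserving diffeomorphisms $f$ of $M$. $L^6_1$ refers to one derivative in $L^6$: the functional being of class $L^6_1$ means that, in local coordinates, the integrand is a homogeneous polynomial of degree $6$ in the first derivatives of $J$ with coefficients depending smoothly on $J$. *)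

theory Defs
  imports "HOL-Analysis.Analysis"
begin

section \<open>Smooth functions\<close>

text \<open>Both predicates are meant for open sets \<open>S\<close>.\<close>

primrec Ck_on :: "nat \<Rightarrow> ('a::real_normed_vector \<Rightarrow> 'b::real_normed_vector) \<Rightarrow> 'a set \<Rightarrow> bool" where
  "Ck_on 0 f S \<longleftrightarrow> continuous_on S f"
| "Ck_on (Suc k) f S \<longleftrightarrow> (\<forall>x\<in>S. f differentiable (at x)) \<and>
     (\<forall>v. Ck_on k (\<lambda>x. frechet_derivative f (at x) v) S)"

definition smooth_on :: "('a::real_normed_vector \<Rightarrow> 'b::real_normed_vector) \<Rightarrow> 'a set \<Rightarrow> bool" where
  "smooth_on f S \<longleftrightarrow> (\<forall>k. Ck_on k f S)"


section \<open>Compact oriented smooth 6-manifolds\<close>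

text \<open>A chart is a pair of its domain and its coordinate map; outside the domain the coordinate
  map is irrelevant.\<close>

type_synonym 'a chart = "'a set \<times> ('a \<Rightarrow> real^6)"

definition chart_inv :: "'a chart \<Rightarrow> real^6 \<Rightarrow> 'a" where
  "chart_inv c = inv_into (fst c) (snd c)"

definition is_chart :: "'a topology \<Rightarrow> 'a chart \<Rightarrow> bool" where
  "is_chart X c \<longleftrightarrow> openin X (fst c) \<and> open (snd c ` fst c) \<and>
     homeomorphic_map (subtopology X (fst c)) (top_of_set (snd c ` fst c)) (snd c)"

definition charts_at :: "'a chart set \<Rightarrow> 'a \<Rightarrow> 'a chart set" where
  "charts_at A p = {c \<in> A. p \<in> fst c}"

text \<open>The Jacobian matrix at \<open>p\<close> of a map \<open>f\<close>, in coordinates \<open>c\<close> around \<open>p\<close> and \<open>c'\<close> around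
  \<open>f p\<close>. For \<open>f = id\<close> it is the Jacobian matrix of the change of coordinates from \<open>c\<close> to \<open>c'\<close>.\<close>

definition jac :: "('a \<Rightarrow> 'a) \<Rightarrow> 'a chart \<Rightarrow> 'a chart \<Rightarrow> 'a \<Rightarrow> real^6^6" where
  "jac f c c' p = matrix (frechet_derivative (\<lambda>x. snd c' (f (chart_inv c x))) (at (snd c p)))"

definition smooth_map :: "'a chart set \<Rightarrow> ('a \<Rightarrow> 'a) \<Rightarrow> bool" where
  "smooth_map A f \<longleftrightarrow> (\<forall>c\<in>A. \<forall>c'\<in>A.
     smooth_on (\<lambda>x. snd c' (f (chart_inv c x))) (snd c ` {p \<in> fst c. f p \<in> fst c'}))"

definition orientation_preserving :: "'a chart set \<Rightarrow> ('a \<Rightarrow> 'a) \<Rightarrow> bool" where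
  "orientation_preserving A f \<longleftrightarrow> (\<forall>c\<in>A. \<forall>c'\<in>A. \<forall>p\<in>fst c. f p \<in> fst c' \<longrightarrow> det (jac f c c' p) > 0)"

text \<open>A manifold is given by a smooth oriented atlas, not necessarily maximal. Second countability
  follows from compactness.\<close>

definition compact_oriented_manifold6 :: "'a topology \<Rightarrow> 'a chart set \<Rightarrow> bool" where
  "compact_oriented_manifold6 X A \<longleftrightarrow>
     compact_space X \<and> Hausdorff_space X \<and>
     (\<forall>c\<in>A. is_chart X c) \<and> (\<Union>c\<in>A. fst c) = topspace X \<and>
     smooth_map A id \<and> orientation_preserving A id"

definition orientation_diffeo :: "'a topology \<Rightarrow> 'a chart set \<Rightarrow> ('a \<Rightarrow> 'a) \<Rightarrow> bool" where
  "orientation_diffeo X A f \<longleftrightarrow> homeomorphic_map X X f \<and>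
     smooth_map A f \<and> smooth_map A (inv_into (topspace X) f) \<and> orientation_preserving A f"


section \<open>Almost complex structures\<close>

text \<open>The linear complex structures on \<open>\<real>\<^sup>6\<close> inducing the standard orientation: every complex basis
  \<open>v\<^sub>1, v\<^sub>2, v\<^sub>3\<close> gives a positively oriented real basis \<open>v\<^sub>1, J v\<^sub>1, v\<^sub>2, J v\<^sub>2, v\<^sub>3, J v\<^sub>3\<close>.\<close>

definition pos_complex_structures :: "(real^6^6) set" where
  "pos_complex_structures = {J. J ** J = - mat 1 \<and>
     (\<forall>v1 v2 v3. let d = det (vector [v1, J *v v1, v2, J *v v2, v3, J *v v3] :: real^6^6)
                 in d \<noteq> 0 \<longrightarrow> d > 0)}"

text \<open>An endomorphism field of the tangent bundle is given by its components: \<open>J c p\<close> is the matrix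
  of \<open>J\<close> at \<open>p\<close> in the coordinates \<open>c\<close>. Irrelevant components are fixed to be \<open>0\<close>, so that
  distinct elements of \<open>acs_pos X A\<close> are distinct tensor fields.\<close>

type_synonym 'a endo_field = "'a chart \<Rightarrow> 'a \<Rightarrow> real^6^6"

definition acs_pos :: "'a topology \<Rightarrow> 'a chart set \<Rightarrow> 'a endo_field set" where
  "acs_pos X A = {J.
     (\<forall>c\<in>A. smooth_on (\<lambda>x. J c (chart_inv c x)) (snd c ` fst c)) \<and>
     (\<forall>p\<in>topspace X. \<forall>c\<in>charts_at A p. J c p \<in> pos_complex_structures) \<and>
     (\<forall>p\<in>topspace X. \<forall>c\<in>charts_at A p. \<forall>c'\<in>charts_at A p.
        J c' p ** jac id c c' p = jac id c c' p ** J c p) \<and>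
     (\<forall>c p. c \<notin> charts_at A p \<longrightarrow> J c p = 0)}"

text \<open>\<open>f\<^sup>*J = (df)\<^sup>-\<^sup>1 \<circ> J \<circ> df\<close>\<close>

definition pullback_acs :: "'a chart set \<Rightarrow> ('a \<Rightarrow> 'a) \<Rightarrow> 'a endo_field \<Rightarrow> 'a endo_field" where
  "pullback_acs A f J c p =
     (if c \<in> charts_at A p
      then THE M. \<forall>c'\<in>charts_at A (f p). jac f c c' p ** M = J c' (f p) ** jac f c c' p
      else 0)"


section \<open>Complex-valued exterior forms on \<open>\<real>\<^sup>6\<close>\<close>

text \<open>A \<open>k\<close>-form is a function on lists of vectors that vanishes on lists of length other than
  \<open>k\<close>.\<close>

type_synonym cform = "(real^6) list \<Rightarrow> complex"

definition kform :: "nat \<Rightarrow> cform \<Rightarrow> bool" where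
  "kform k w \<longleftrightarrow>
     (\<forall>vs. length vs \<noteq> k \<longrightarrow> w vs = 0) \<and>
     (\<forall>vs. length vs = k \<longrightarrow> (\<forall>i<k. linear (\<lambda>v. w (vs[i := v])))) \<and>
     (\<forall>vs. length vs = k \<longrightarrow> (\<forall>i j. i < j \<and> j < k \<and> vs ! i = vs ! j \<longrightarrow> w vs = 0))"

definition cnj_form :: "cform \<Rightarrow> cform" where
  "cnj_form w = (\<lambda>vs. cnj (w vs))"

definition wedge :: "nat \<Rightarrow> nat \<Rightarrow> cform \<Rightarrow> cform \<Rightarrow> cform" where
  "wedge p q a b = (\<lambda>vs. if length vs = p + q then
      (\<Sum>\<sigma> | \<sigma> permutes {..<p+q}. of_int (sign \<sigma>) *
         a (map (\<lambda>i. vs ! \<sigma> i) [0..<p]) * b (map (\<lambda>i. vs ! \<sigma> i) [p..<p+q]))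
      / (fact p * fact q) else 0)"

text \<open>The iterated wedge product of 1-forms.\<close>

primrec wedge1 :: "cform list \<Rightarrow> cform" where
  "wedge1 [] = (\<lambda>vs. if vs = [] then 1 else 0)"
| "wedge1 (a # as) = wedge 1 (length as) a (wedge1 as)"

text \<open>Bidegrees with respect to a linear complex structure \<open>J\<close>.\<close>

definition form10 :: "real^6^6 \<Rightarrow> cform \<Rightarrow> bool" where
  "form10 J a \<longleftrightarrow> kform 1 a \<and> (\<forall>v. a [J *v v] = \<i> * a [v])"

definition form01 :: "real^6^6 \<Rightarrow> cform \<Rightarrow> bool" where
  "form01 J a \<longleftrightarrow> form10 J (cnj_form a)"

definition forms_pq :: "real^6^6 \<Rightarrow> nat \<Rightarrow> nat \<Rightarrow> cform set" where
  "forms_pq J p q = {w. \<exists>n k as bs.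
     (\<forall>i<n. length (as i) = p \<and> (\<forall>a\<in>set (as i). form10 J a) \<and>
            length (bs i) = q \<and> (\<forall>b\<in>set (bs i). form01 J b)) \<and>
     w = (\<lambda>vs. \<Sum>i<n::nat. k i * wedge1 (as i @ bs i) vs)}"

text \<open>The \<open>(p, q)\<close>-component of a \<open>(p + q)\<close>-form.\<close>

definition type_part :: "real^6^6 \<Rightarrow> nat \<Rightarrow> nat \<Rightarrow> cform \<Rightarrow> cform" where
  "type_part J p q w = (THE b. \<exists>g. (\<forall>r\<le>p+q. g r \<in> forms_pq J r (p + q - r)) \<and>
     w = (\<lambda>vs. \<Sum>r\<le>p+q. g r vs) \<and> b = g p)"


section \<open>Differential forms\<close>

text \<open>As for endomorphism fields, \<open>w c p\<close> represents the form \<open>w\<close> at \<open>p\<close> in the coordinates \<open>c\<close>.\<close>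

type_synonym 'a form_field = "'a chart \<Rightarrow> 'a \<Rightarrow> cform"

definition smooth_form :: "'a chart set \<Rightarrow> 'a set \<Rightarrow> nat \<Rightarrow> 'a form_field \<Rightarrow> bool" where
  "smooth_form A U k w \<longleftrightarrow>
     (\<forall>p\<in>U. \<forall>c\<in>charts_at A p. kform k (w c p)) \<and>
     (\<forall>p\<in>U. \<forall>c\<in>charts_at A p. \<forall>c'\<in>charts_at A p. \<forall>vs.
        w c p vs = w c' p (map (\<lambda>v. jac id c c' p *v v) vs)) \<and>
     (\<forall>c\<in>A. \<forall>vs. smooth_on (\<lambda>x. w c (chart_inv c x) vs) (snd c ` (fst c \<inter> U)))"

text \<open>The exterior derivative of a \<open>k\<close>-form: the usual invariant formula, evaluated on the constant
  vector fields of the coordinates \<open>c\<close>, whose brackets vanish.\<close>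

definition ext_d :: "nat \<Rightarrow> 'a form_field \<Rightarrow> 'a form_field" where
  "ext_d k w c p = (\<lambda>vs. if length vs = k + 1 then
     (\<Sum>i\<le>k. (-1) ^ i *
        frechet_derivative (\<lambda>x. w c (chart_inv c x) (take i vs @ drop (Suc i) vs)) (at (snd c p)) (vs ! i))
     else 0)"

text \<open>The component \<open>d\<^sup>r\<^sup>,\<^sup>s\<close> of the exterior derivative on forms of type \<open>(p, q)\<close>, where
  \<open>r + s = 1\<close>.\<close>

definition d_comp :: "'a endo_field \<Rightarrow> int \<Rightarrow> int \<Rightarrow> nat \<Rightarrow> nat \<Rightarrow> 'a form_field \<Rightarrow> 'a form_field" where
  "d_comp J r s p q w c x =
     (if 0 \<le> int p + r \<and> 0 \<le> int q + s
      then type_part (J c x) (nat (int p + r)) (nat (int q + s)) (ext_d (p + q) w c x)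
      else (\<lambda>vs. 0))"


section \<open>Integration of 6-forms\<close>

text \<open>The coefficient of \<open>dx\<^sup>1 \<and> \<dots> \<and> dx\<^sup>6\<close>.\<close>

definition density :: "cform \<Rightarrow> complex" where
  "density w = w [axis 1 1, axis 2 1, axis 3 1, axis 4 1, axis 5 1, axis 6 1]"

definition partition_of_unity :: "'a topology \<Rightarrow> 'a chart set \<Rightarrow> ('a chart \<Rightarrow> 'a \<Rightarrow> real) \<Rightarrow> bool" where
  "partition_of_unity X K \<rho> \<longleftrightarrow> finite K \<and>
     (\<forall>c\<in>K. continuous_map X euclideanreal (\<rho> c) \<and> (\<forall>p\<in>topspace X. 0 \<le> \<rho> c p) \<and>
            X closure_of {p \<in> topspace X. \<rho> c p \<noteq> 0} \<subseteq> fst c) \<and>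
     (\<forall>p\<in>topspace X. (\<Sum>c\<in>K. \<rho> c p) = 1)"

text \<open>Continuous weights suffice here, and smooth partitions of unity are a special case.\<close>

definition has_form_integral :: "'a topology \<Rightarrow> 'a chart set \<Rightarrow> 'a form_field \<Rightarrow> complex \<Rightarrow> bool" where
  "has_form_integral X A w I \<longleftrightarrow> (\<exists>K \<rho> L. K \<subseteq> A \<and> partition_of_unity X K \<rho> \<and>
     (\<forall>c\<in>K. ((\<lambda>x. of_real (\<rho> c (chart_inv c x)) * density (w c (chart_inv c x)))
                has_integral L c) (snd c ` fst c)) \<and>
     I = (\<Sum>c\<in>K. L c))"

definition form_integral :: "'a topology \<Rightarrow> 'a chart set \<Rightarrow> 'a form_field \<Rightarrow> complex" where
  "form_integral X A w = (THE I. has_form_integral X A w I)"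


section \<open>The trilinear form \<open>P\<close>\<close>

definition symmetric_trilinear ::
  "(complex^3^3 \<Rightarrow> complex^3^3 \<Rightarrow> complex^3^3 \<Rightarrow> complex) \<Rightarrow> bool" where
  "symmetric_trilinear P \<longleftrightarrow>
     (\<forall>a a' b c. P (a + a') b c = P a b c + P a' b c) \<and>
     (\<forall>k a b c. P (\<chi> i j. k * a $ i $ j) b c = k * P a b c) \<and>
     (\<forall>a b c. P a b c = P b a c \<and> P a b c = P a c b)"

definition polar_det :: "complex^3^3 \<Rightarrow> complex^3^3 \<Rightarrow> complex^3^3 \<Rightarrow> complex" where
  "polar_det = (THE P. symmetric_trilinear P \<and> (\<forall>a. P a a a = det a))"

definition cnj_matrix :: "complex^3^3 \<Rightarrow> complex^3^3" where
  "cnj_matrix a = (\<chi> i j. cnj (a $ i $ j))"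


section \<open>The invariant forms \<open>\<Phi>(J)\<close> and \<open>\<psi>(J)\<close>\<close>

definition coframing ::
  "'a topology \<Rightarrow> 'a chart set \<Rightarrow> 'a endo_field \<Rightarrow> 'a set \<Rightarrow> (3 \<Rightarrow> 'a form_field) \<Rightarrow> bool" where
  "coframing X A J U \<alpha> \<longleftrightarrow> openin X U \<and> (\<forall>i. smooth_form A U 1 (\<alpha> i)) \<and>
     (\<forall>p\<in>U. \<forall>c\<in>charts_at A p. (\<forall>i. form10 (J c p) (\<alpha> i c p)) \<and>
        (\<forall>k::3 \<Rightarrow> complex. (\<forall>v. (\<Sum>i\<in>UNIV. k i * \<alpha> i c p [v]) = 0) \<longrightarrow> (\<forall>i. k i = 0)))"

text \<open>Index arithmetic in the type \<open>3\<close> is modulo 3, so \<open>\<alpha> (j + 1) \<and> \<alpha> (j + 2)\<close> runs through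
  \<open>\<alpha>\<^sup>2 \<and> \<alpha>\<^sup>3\<close>, \<open>\<alpha>\<^sup>3 \<and> \<alpha>\<^sup>1\<close>, \<open>\<alpha>\<^sup>1 \<and> \<alpha>\<^sup>2\<close>.\<close>

definition nij :: "'a chart set \<Rightarrow> 'a endo_field \<Rightarrow> (3 \<Rightarrow> 'a form_field) \<Rightarrow> 'a \<Rightarrow> complex^3^3" where
  "nij A J \<alpha> p = (THE n. \<forall>c\<in>charts_at A p. \<forall>i.
     d_comp J (-1) 2 1 0 (\<alpha> i) c p =
       (\<lambda>vs. \<Sum>j\<in>UNIV. n $ i $ j * cnj_form (wedge1 [\<alpha> (j + 1) c p, \<alpha> (j + 2) c p]) vs))"

definition Phi_frame :: "'a chart set \<Rightarrow> 'a endo_field \<Rightarrow> (3 \<Rightarrow> 'a form_field) \<Rightarrow> 'a form_field" where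
  "Phi_frame A J \<alpha> c p = (\<lambda>vs. \<i> / 8 * of_real ((cmod (det (nij A J \<alpha> p)))\<^sup>2) *
     wedge1 [\<alpha> 1 c p, \<alpha> 2 c p, \<alpha> 3 c p,
             cnj_form (\<alpha> 1 c p), cnj_form (\<alpha> 2 c p), cnj_form (\<alpha> 3 c p)] vs)"

definition psi_frame :: "'a chart set \<Rightarrow> 'a endo_field \<Rightarrow> (3 \<Rightarrow> 'a form_field) \<Rightarrow> 'a form_field" where
  "psi_frame A J \<alpha> c p = (\<lambda>vs. (let n = nij A J \<alpha> p in
      polar_det (cnj_matrix n) (cnj_matrix n) (transpose n)) *
     wedge1 [\<alpha> 1 c p, \<alpha> 2 c p, \<alpha> 3 c p] vs)"

definition Phi :: "'a topology \<Rightarrow> 'a chart set \<Rightarrow> 'a endo_field \<Rightarrow> 'a form_field" where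
  "Phi X A J c p = (THE w. \<exists>U \<alpha>. coframing X A J U \<alpha> \<and> p \<in> U \<and> w = Phi_frame A J \<alpha> c p)"

definition psi :: "'a topology \<Rightarrow> 'a chart set \<Rightarrow> 'a endo_field \<Rightarrow> 'a form_field" where
  "psi X A J c p = (THE w. \<exists>U \<alpha>. coframing X A J U \<alpha> \<and> p \<in> U \<and> w = psi_frame A J \<alpha> c p)"


section \<open>The functional\<close>

definition integrand ::
  "'a topology \<Rightarrow> 'a chart set \<Rightarrow> real \<Rightarrow> real \<Rightarrow> 'a endo_field \<Rightarrow> 'a form_field" where
  "integrand X A c1 c2 J c p = (\<lambda>vs. of_real c1 * Phi X A J c p vs +
     of_real c2 * (\<i> / 8) * wedge 3 3 (psi X A J c p) (cnj_form (psi X A J c p)) vs)"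

definition functional ::
  "'a topology \<Rightarrow> 'a chart set \<Rightarrow> real \<Rightarrow> real \<Rightarrow> 'a endo_field \<Rightarrow> complex" where
  "functional X A c1 c2 J = form_integral X A (integrand X A c1 c2 J)"

definition same_1jet :: "'a chart set \<Rightarrow> 'a endo_field \<Rightarrow> 'a endo_field \<Rightarrow> 'a \<Rightarrow> bool" where
  "same_1jet A J J' p \<longleftrightarrow> (\<forall>c\<in>charts_at A p. J c p = J' c p \<and>
     frechet_derivative (\<lambda>x. J c (chart_inv c x)) (at (snd c p)) =
     frechet_derivative (\<lambda>x. J' c (chart_inv c x)) (at (snd c p)))"

definition first_order ::
  "'a topology \<Rightarrow> 'a chart set \<Rightarrow> ('a endo_field \<Rightarrow> 'a form_field) \<Rightarrow> bool" where
  "first_order X A L \<longleftrightarrow> (\<forall>J\<in>acs_pos X A. \<forall>J'\<in>acs_pos X A. \<forall>p\<in>topspace X.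
     same_1jet A J J' p \<longrightarrow> (\<forall>c\<in>charts_at A p. L J c p = L J' c p))"

text \<open>\<open>dJ c J p (k, i, j)\<close> is \<open>\<partial>J\<^sup>i\<^sub>j / \<partial>x\<^sup>k\<close> at \<open>p\<close> in the coordinates \<open>c\<close>.\<close>

definition dJ :: "'a chart \<Rightarrow> 'a endo_field \<Rightarrow> 'a \<Rightarrow> 6 \<times> 6 \<times> 6 \<Rightarrow> real" where
  "dJ c J p = (\<lambda>(k, i, j).
     frechet_derivative (\<lambda>x. J c (chart_inv c x)) (at (snd c p)) (axis k 1) $ i $ j)"

text \<open>In every chart the integrand is a homogeneous polynomial of degree 6 in the first derivatives
  of \<open>J\<close>, the monomials being indexed by lists of length 6, with coefficients that are smooth
  functions of \<open>J\<close>. Smoothness on the submanifold \<open>pos_complex_structures\<close> is expressed through an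
  extension to an open neighbourhood.\<close>

definition class_L61 ::
  "'a topology \<Rightarrow> 'a chart set \<Rightarrow> ('a endo_field \<Rightarrow> 'a form_field) \<Rightarrow> bool" where
  "class_L61 X A L \<longleftrightarrow> (\<forall>c\<in>A. \<exists>a :: (6 \<times> 6 \<times> 6) list \<Rightarrow> real^6^6 \<Rightarrow> real. \<exists>W.
     open W \<and> pos_complex_structures \<subseteq> W \<and> (\<forall>ms. smooth_on (a ms) W) \<and>
     (\<forall>J\<in>acs_pos X A. \<forall>p\<in>fst c. density (L J c p) =
        of_real (\<Sum>ms | length ms = 6. a ms (J c p) * prod_list (map (dJ c J p) ms))))"

end

theory Submission
  imports Defs
begin

text \<open>Differentiating \<open>\<alpha>(Jv) = i \<alpha>(v)\<close> shows that the \<open>(0,2)\<close>-part of \<open>d\<alpha>\<close> is \<open>\<alpha>(T(u,v))/4\<close>,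
  where \<open>T\<close> is the Nijenhuis tensor of \<open>J\<close>, linear in the first derivatives of \<open>J\<close>. Hence \<open>N(\<alpha>)\<close> at a
  point depends only on the 1-jet of \<open>J\<close> and on the coframe at that point, and under \<open>\<beta> = g \<alpha>\<close> it
  satisfies \<open>cnj (det g) N(\<beta>) = g N(\<alpha>) g\<^sup>*\<close>, which makes \<open>\<Phi>\<close> and \<open>\<psi>\<close> independent of the coframe. A coframe
  that depends polynomially on \<open>J\<close> is obtained from Cramer's rule applied to a frame
  \<open>e\<^sub>1, J e\<^sub>1, e\<^sub>2, J e\<^sub>2, e\<^sub>3, J e\<^sub>3\<close> with coordinate vectors \<open>e\<^sub>k\<close>; it shows that the integrand is a
  polynomial of degree 6 in the derivatives of \<open>J\<close>. Diffeomorphism invariance, and at the same time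
  the independence of the integral of the charts and of the partition of unity (the case of the
  identity), follows from the naturality of \<open>T\<close> and the change of variables formula.\<close>

section \<open>Calculus of smooth functions\<close>

text \<open>Coefficients smooth near every complex structure are wanted, but no single triple of
  coordinate vectors spans a complex frame for all J. There are 216 triples, and their formulas are
  averaged with weights \<open>d^8\<close>, where d is the determinant of the frame. The dual
  coframe is 1/d times the polynomial one; the coefficient is homogeneous of degree 6 in the matrix
  of T and gives \<open>d^-6\<close>, the real volume gives \<open>d^-1\<close>. The exponent 8
  clears both and is even, so the total weight is positive. The factor \<open>cnj (det g)\<close> in
  the transformation law arises because T is conjugate-linear in each slot and is therefore measured
  against conjugates of 2-forms. These change by the cofactor matrix of g, and
  \<open>cof3 g ** transpose g\<close> is \<open>det g\<close> times the identity. The arguments of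
  P are explained by the same law: the conjugate and the transpose of N are the two variants that
  change, up to scalars, by conjugate g on the left and transposed g on the right, so the polarized
  determinant is multiplicative on them together.\<close>

lemma has_derivative_cong_open:
  assumes "open S" "x \<in> S" "\<And>y. y \<in> S \<Longrightarrow> f y = g y"
  shows "(f has_derivative D) (at x) \<longleftrightarrow> (g has_derivative D) (at x)"
  using assms has_derivative_transform_within_open[of f D x UNIV S g]
    has_derivative_transform_within_open[of g D x UNIV S f] by auto

lemma frechet_derivative_cong_open:
  assumes "open S" "x \<in> S" "\<And>y. y \<in> S \<Longrightarrow> f y = g y"
  shows "frechet_derivative f (at x) = frechet_derivative g (at x)"
  unfolding frechet_derivative_def using has_derivative_cong_open[OF assms] by simp

lemma Ck_on_cong:
  assumes "open S" "\<And>x. x \<in> S \<Longrightarrow> f x = g x" "Ck_on k f S"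
  shows "Ck_on k g S"
  using assms(2,3)
proof (induction k arbitrary: f g)
  case 0
  then show ?case by (simp cong: continuous_on_cong)
next
  case (Suc k)
  have "g differentiable (at x)" if "x \<in> S" for x
  proof -
    have "(f has_derivative D) (at x) \<longleftrightarrow> (g has_derivative D) (at x)" for D
      by (rule has_derivative_cong_open[OF assms(1) that Suc.prems(1)])
    moreover obtain D where "(f has_derivative D) (at x)"
      using Suc.prems(2) \<open>x \<in> S\<close> by (auto simp: differentiable_def)
    ultimately show ?thesis by (auto simp: differentiable_def)
  qed
  moreover have "Ck_on k (\<lambda>x. frechet_derivative g (at x) v) S" for v
  proof (rule Suc.IH)
    show "Ck_on k (\<lambda>x. frechet_derivative f (at x) v) S"
      using Suc.prems by simp
    show "frechet_derivative f (at x) v = frechet_derivative g (at x) v" if "x \<in> S" for x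
      using frechet_derivative_cong_open[OF assms(1) that, of f g] Suc.prems by simp
  qed
  ultimately show ?case by simp
qed

text \<open>Lets a derivative found by differentiation rules stand in for
  \<open>frechet_derivative\<close>; the closure properties below are inductions through this
  rule.\<close>

lemma Ck_on_derivI:
  assumes "\<And>x. x \<in> S \<Longrightarrow> (f has_derivative f' x) (at x)" "open S"
    "\<And>v. Ck_on k (\<lambda>x. f' x v) S"
  shows "Ck_on (Suc k) f S"
proof -
  have "f' x = frechet_derivative f (at x)" if "x \<in> S" for x
    using assms(1)[OF that] by (rule frechet_derivative_at)
  then have "Ck_on k (\<lambda>x. frechet_derivative f (at x) v) S" for v
    by (intro Ck_on_cong[OF assms(2) _ assms(3)[of v]]) simp
  then show ?thesis
    using assms(1) by (auto simp: differentiable_def)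
qed

lemma Ck_on_subset: "Ck_on k f S \<Longrightarrow> T \<subseteq> S \<Longrightarrow> Ck_on k f T"
  by (induction k arbitrary: f) (auto intro: continuous_on_subset)

lemma Ck_on_local:
  assumes "\<And>x. x \<in> S \<Longrightarrow> \<exists>U. open U \<and> x \<in> U \<and> Ck_on k f U"
  shows "Ck_on k f S"
  using assms
proof (induction k arbitrary: f)
  case 0
  have "continuous (at x) f" if x: "x \<in> S" for x
  proof -
    obtain U where "open U" "x \<in> U" "continuous_on U f" using 0[OF x] by auto
    then show ?thesis using continuous_on_eq_continuous_at by blast
  qed
  then show ?case by (simp add: continuous_at_imp_continuous_on)
next
  case (Suc k)
  have "Ck_on k (\<lambda>x. frechet_derivative f (at x) v) S" for v
  proof (rule Suc.IH)
    fix x assume "x \<in> S"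
    from Suc.prems[OF this]
    show "\<exists>U. open U \<and> x \<in> U \<and> Ck_on k (\<lambda>x. frechet_derivative f (at x) v) U" by auto
  qed
  moreover have "f differentiable (at x)" if "x \<in> S" for x
    using Suc.prems[OF that] by auto
  ultimately show ?case by simp
qed

text \<open>Product and chain rules leave undifferentiated factors behind, so their inductions must
  be able to lower the order of smoothness.\<close>

lemma Ck_on_SucD: "Ck_on (Suc k) f S \<Longrightarrow> Ck_on k f S"
proof (induction k arbitrary: f)
  case 0
  then show ?case
    by (auto intro!: continuous_at_imp_continuous_on differentiable_imp_continuous_within)
next
  case (Suc k)
  then have "Ck_on k (\<lambda>x. frechet_derivative f (at x) v) S" for v
    by (metis Ck_on.simps(2))
  then show ?case using Suc.prems by auto
qed

lemma Ck_on_has_derivative: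
  "Ck_on (Suc k) f S \<Longrightarrow> x \<in> S \<Longrightarrow> (f has_derivative frechet_derivative f (at x)) (at x)"
  by (simp add: frechet_derivative_works)

lemma Ck_on_const: "open S \<Longrightarrow> Ck_on k (\<lambda>x. c) S"
  by (induction k arbitrary: c) simp_all

lemma Ck_on_add:
  assumes "open S" "Ck_on k f S" "Ck_on k g S"
  shows "Ck_on k (\<lambda>x. f x + g x) S"
  using assms(2,3)
proof (induction k arbitrary: f g)
  case 0
  then show ?case by (simp add: continuous_on_add)
next
  case (Suc k)
  show ?case
  proof (rule Ck_on_derivI[OF _ assms(1)])
    show "((\<lambda>x. f x + g x) has_derivative
       (\<lambda>v. frechet_derivative f (at x) v + frechet_derivative g (at x) v)) (at x)" if "x \<in> S" for x
      by (intro has_derivative_add Ck_on_has_derivative[OF Suc.prems(1) that] Ck_on_has_derivative[OF Suc.prems(2) that])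
  qed (use Suc assms in auto)
qed

lemma Ck_on_sum:
  assumes "open S" "\<And>i. i \<in> I \<Longrightarrow> Ck_on k (f i) S"
  shows "Ck_on k (\<lambda>x. \<Sum>i\<in>I. f i x) S"
  using assms(2)
  by (induction I rule: infinite_finite_induct) (simp_all add: Ck_on_const Ck_on_add assms(1))

lemma Ck_on_bounded_linear:
  assumes "open S" "bounded_linear h" "Ck_on k f S"
  shows "Ck_on k (\<lambda>x. h (f x)) S"
  using assms(3)
proof (induction k arbitrary: f)
  case 0
  then show ?case
    using linear_continuous_on[OF assms(2)] continuous_on_compose2[of UNIV h S f] by auto
next
  case (Suc k)
  show ?case
  proof (rule Ck_on_derivI[OF _ assms(1)])
    show "((\<lambda>x. h (f x)) has_derivative (\<lambda>v. h (frechet_derivative f (at x) v))) (at x)"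
      if "x \<in> S" for x
      by (intro bounded_linear.has_derivative[OF assms(2)] Ck_on_has_derivative[OF Suc.prems(1) that])
  qed (use Suc assms in auto)
qed

lemma Ck_on_bounded_bilinear:
  assumes "open S" "bounded_bilinear h" "Ck_on k f S" "Ck_on k g S"
  shows "Ck_on k (\<lambda>x. h (f x) (g x)) S"
  using assms(3,4)
proof (induction k arbitrary: f g)
  case 0
  then show ?case
    using bounded_bilinear.continuous_on[OF assms(2)] by auto
next
  case (Suc k)
  show ?case
  proof (rule Ck_on_derivI[OF _ assms(1)])
    show "((\<lambda>x. h (f x) (g x)) has_derivative
        (\<lambda>v. h (f x) (frechet_derivative g (at x) v) + h (frechet_derivative f (at x) v) (g x))) (at x)"
      if "x \<in> S" for x
      by (intro bounded_bilinear.FDERIV[OF assms(2)] Ck_on_has_derivative[OF Suc.prems(1) that] Ck_on_has_derivative[OF Suc.prems(2) that])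
    show "Ck_on k (\<lambda>x. h (f x) (frechet_derivative g (at x) v) +
        h (frechet_derivative f (at x) v) (g x)) S" for v
      using Suc Ck_on_SucD[of k f S] Ck_on_SucD[of k g S]
      by (intro Ck_on_add assms) auto
  qed
qed

lemma Ck_on_inverse:
  fixes f :: "'a::real_normed_vector \<Rightarrow> 'b::real_normed_field"
  assumes "open S" "Ck_on k f S" "\<And>x. x \<in> S \<Longrightarrow> f x \<noteq> 0"
  shows "Ck_on k (\<lambda>x. inverse (f x)) S"
  using assms(2,3)
proof (induction k)
  case 0
  then show ?case by (simp add: continuous_on_inverse)
next
  case (Suc k)
  show ?case
  proof (rule Ck_on_derivI[OF _ assms(1)])
    show "((\<lambda>x. inverse (f x)) has_derivative
        (\<lambda>v. - 1 * (inverse (f x) * frechet_derivative f (at x) v * inverse (f x)))) (at x)"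
      if "x \<in> S" for x
      using Deriv.has_derivative_inverse[OF Suc.prems(2)[OF that]
          Ck_on_has_derivative[OF Suc.prems(1) that]] by simp
    show "Ck_on k (\<lambda>x. - 1 * (inverse (f x) * frechet_derivative f (at x) v * inverse (f x))) S" for v
      using Suc Ck_on_SucD[of k f S]
      by (intro Ck_on_bounded_bilinear[OF _ bounded_bilinear_mult] Ck_on_const assms) auto
  qed
qed

text \<open>\<open>Ck_on\<close> controls derivatives only along fixed vectors, whereas in the chain
  rule the outer derivative is taken along a direction that moves with x. Expanding that direction
  in a basis repairs this, which is why g takes values in a Euclidean space.\<close>

lemma Ck_on_compose:
  fixes g :: "'a::real_normed_vector \<Rightarrow> 'b::euclidean_space"
  assumes "open S" "open T" "Ck_on k f T" "Ck_on k g S" "\<And>x. x \<in> S \<Longrightarrow> g x \<in> T"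
  shows "Ck_on k (\<lambda>x. f (g x)) S"
  using assms(3,4)
proof (induction k arbitrary: f)
  case 0
  then show ?case
    using assms(5) by (auto intro: continuous_on_compose2)
next
  case (Suc k)
  show ?case
  proof (rule Ck_on_derivI[OF _ assms(1)])
    show "((\<lambda>x. f (g x)) has_derivative (\<lambda>v. \<Sum>b\<in>Basis.
         (frechet_derivative g (at x) v \<bullet> b) *\<^sub>R frechet_derivative f (at (g x)) b)) (at x)"
      if "x \<in> S" for x
    proof -
      have f: "(f has_derivative frechet_derivative f (at (g x))) (at (g x))"
        by (rule Ck_on_has_derivative[OF Suc.prems(1) assms(5)[OF that]])
      have lin: "linear (frechet_derivative f (at (g x)))"
        by (rule has_derivative_linear[OF f])
      have "frechet_derivative f (at (g x)) (\<Sum>b\<in>Basis. (w \<bullet> b) *\<^sub>R b) =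
          (\<Sum>b\<in>Basis. (w \<bullet> b) *\<^sub>R frechet_derivative f (at (g x)) b)" for w
        by (simp add: linear_sum[OF lin] linear_scale[OF lin] del: euclidean_representation)
      then have expand: "frechet_derivative f (at (g x)) w =
          (\<Sum>b\<in>Basis. (w \<bullet> b) *\<^sub>R frechet_derivative f (at (g x)) b)" for w
        unfolding euclidean_representation .
      have "((\<lambda>x. f (g x)) has_derivative
          (\<lambda>v. frechet_derivative f (at (g x)) (frechet_derivative g (at x) v))) (at x)"
        using diff_chain_at[OF Ck_on_has_derivative[OF Suc.prems(2) that] f]
        by (simp add: o_def)
      then show ?thesis
        by (rule has_derivative_eq_rhs) (rule ext, rule expand)
    qed
    show "Ck_on k (\<lambda>x. \<Sum>b\<in>Basis.
         (frechet_derivative g (at x) v \<bullet> b) *\<^sub>R frechet_derivative f (at (g x)) b) S" for v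
    proof (intro Ck_on_sum Ck_on_bounded_bilinear[OF _ bounded_bilinear_scaleR]
          Ck_on_bounded_linear[OF _ bounded_linear_inner_left] assms(1))
      show "Ck_on k (\<lambda>x. frechet_derivative g (at x) v) S"
        using Suc.prems(2) by simp
      show "Ck_on k (\<lambda>x. frechet_derivative f (at (g x)) b) S" for b
        by (rule Suc.IH) (use Suc.prems(1) Ck_on_SucD[OF Suc.prems(2)] in auto)
    qed
  qed
qed

lemma smooth_on_cong:
  "smooth_on f S \<Longrightarrow> open S \<Longrightarrow> (\<And>x. x \<in> S \<Longrightarrow> f x = g x) \<Longrightarrow> smooth_on g S"
  unfolding smooth_on_def by (metis Ck_on_cong)

lemma smooth_on_subset: "smooth_on f S \<Longrightarrow> T \<subseteq> S \<Longrightarrow> smooth_on f T"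
  by (auto simp: smooth_on_def intro: Ck_on_subset)

lemma smooth_on_local:
  assumes "\<And>x. x \<in> S \<Longrightarrow> \<exists>U. open U \<and> x \<in> U \<and> smooth_on f U"
  shows "smooth_on f S"
  unfolding smooth_on_def
proof
  show "Ck_on k f S" for k
    by (rule Ck_on_local) (use assms in \<open>fastforce simp: smooth_on_def\<close>)
qed

lemma smooth_on_continuous_on: "smooth_on f S \<Longrightarrow> continuous_on S f"
  unfolding smooth_on_def by (metis Ck_on.simps(1))

lemma smooth_on_has_derivative:
  "smooth_on f S \<Longrightarrow> x \<in> S \<Longrightarrow> (f has_derivative frechet_derivative f (at x)) (at x)"
  unfolding smooth_on_def by (metis Ck_on_has_derivative)

lemma smooth_on_frechet_derivative:
  "smooth_on f S \<Longrightarrow> smooth_on (\<lambda>x. frechet_derivative f (at x) v) S"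
  unfolding smooth_on_def by (metis Ck_on.simps(2))

lemma smooth_on_const: "open S \<Longrightarrow> smooth_on (\<lambda>x. c) S"
  by (simp add: smooth_on_def Ck_on_const)

lemma smooth_on_bounded_linear:
  "open S \<Longrightarrow> bounded_linear h \<Longrightarrow> smooth_on f S \<Longrightarrow> smooth_on (\<lambda>x. h (f x)) S"
  by (simp add: smooth_on_def Ck_on_bounded_linear)

lemma smooth_on_bounded_bilinear:
  "open S \<Longrightarrow> bounded_bilinear h \<Longrightarrow> smooth_on f S \<Longrightarrow> smooth_on g S \<Longrightarrow>
   smooth_on (\<lambda>x. h (f x) (g x)) S"
  by (simp add: smooth_on_def Ck_on_bounded_bilinear)

lemma smooth_on_add:
  "open S \<Longrightarrow> smooth_on f S \<Longrightarrow> smooth_on g S \<Longrightarrow> smooth_on (\<lambda>x. f x + g x) S"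
  by (simp add: smooth_on_def Ck_on_add)

lemma smooth_on_mult:
  fixes f :: "'a::real_normed_vector \<Rightarrow> 'b::real_normed_algebra"
  shows "open S \<Longrightarrow> smooth_on f S \<Longrightarrow> smooth_on g S \<Longrightarrow> smooth_on (\<lambda>x. f x * g x) S"
  by (rule smooth_on_bounded_bilinear[OF _ bounded_bilinear_mult])

lemma smooth_on_scaleR:
  "open S \<Longrightarrow> smooth_on f S \<Longrightarrow> smooth_on g S \<Longrightarrow> smooth_on (\<lambda>x. f x *\<^sub>R g x) S"
  by (rule smooth_on_bounded_bilinear[OF _ bounded_bilinear_scaleR])

lemma smooth_on_inverse:
  fixes f :: "'a::real_normed_vector \<Rightarrow> 'b::real_normed_field"
  shows "open S \<Longrightarrow> smooth_on f S \<Longrightarrow> (\<And>x. x \<in> S \<Longrightarrow> f x \<noteq> 0) \<Longrightarrow> smooth_on (\<lambda>x. inverse (f x)) S"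
  by (simp add: smooth_on_def Ck_on_inverse)

lemma smooth_on_minus: "open S \<Longrightarrow> smooth_on f S \<Longrightarrow> smooth_on (\<lambda>x. - f x) S"
  by (rule smooth_on_bounded_linear[OF _ bounded_linear_minus[OF bounded_linear_ident]])

lemma smooth_on_diff:
  "open S \<Longrightarrow> smooth_on f S \<Longrightarrow> smooth_on g S \<Longrightarrow> smooth_on (\<lambda>x. f x - g x) S"
  using smooth_on_add[of S f "\<lambda>x. - g x"] smooth_on_minus[of S g] by simp

lemma smooth_on_sum:
  "open S \<Longrightarrow> (\<And>i. i \<in> I \<Longrightarrow> smooth_on (f i) S) \<Longrightarrow> smooth_on (\<lambda>x. \<Sum>i\<in>I. f i x) S"
  by (induction I rule: infinite_finite_induct) (auto intro!: smooth_on_const smooth_on_add)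

lemma smooth_on_prod:
  fixes f :: "'i \<Rightarrow> 'a::real_normed_vector \<Rightarrow> 'b::{real_normed_algebra,comm_ring_1}"
  shows "open S \<Longrightarrow> (\<And>i. i \<in> I \<Longrightarrow> smooth_on (f i) S) \<Longrightarrow> smooth_on (\<lambda>x. \<Prod>i\<in>I. f i x) S"
  by (induction I rule: infinite_finite_induct) (auto intro!: smooth_on_const smooth_on_mult)

lemma smooth_on_power:
  fixes f :: "'a::real_normed_vector \<Rightarrow> 'b::{real_normed_algebra,comm_ring_1}"
  shows "open S \<Longrightarrow> smooth_on f S \<Longrightarrow> smooth_on (\<lambda>x. f x ^ n) S"
  by (induction n) (auto intro!: smooth_on_const smooth_on_mult)

lemma smooth_on_compose:
  fixes g :: "'a::real_normed_vector \<Rightarrow> 'b::euclidean_space"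
  shows "open S \<Longrightarrow> open T \<Longrightarrow> smooth_on f T \<Longrightarrow> smooth_on g S \<Longrightarrow> (\<And>x. x \<in> S \<Longrightarrow> g x \<in> T) \<Longrightarrow>
    smooth_on (\<lambda>x. f (g x)) S"
  unfolding smooth_on_def using Ck_on_compose by blast

lemma smooth_on_vec_nth: "open S \<Longrightarrow> smooth_on f S \<Longrightarrow> smooth_on (\<lambda>x. f x $ i) S"
  by (rule smooth_on_bounded_linear[OF _ bounded_linear_vec_nth])

lemma smooth_on_cnj: "open S \<Longrightarrow> smooth_on f S \<Longrightarrow> smooth_on (\<lambda>x. cnj (f x)) S"
  by (rule smooth_on_bounded_linear[OF _ bounded_linear_cnj])

lemma smooth_on_of_real:
  "open S \<Longrightarrow> smooth_on f S \<Longrightarrow> smooth_on (\<lambda>x. of_real (f x) :: 'b::real_normed_algebra_1) S"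
  by (rule smooth_on_bounded_linear[OF _ bounded_linear_of_real])

lemma smooth_on_Re: "open S \<Longrightarrow> smooth_on f S \<Longrightarrow> smooth_on (\<lambda>x. Re (f x)) S"
  by (rule smooth_on_bounded_linear[OF _ bounded_linear_Re])

lemma smooth_on_ident: "open S \<Longrightarrow> smooth_on (\<lambda>x. x) S"
  unfolding smooth_on_def
proof
  fix k assume "open S"
  then show "Ck_on k (\<lambda>x. x) S"
    by (cases k) (auto intro!: Ck_on_const)
qed

lemma smooth_on_det:
  fixes f :: "'a::real_normed_vector \<Rightarrow> ('b::{real_normed_algebra,comm_ring_1})^'n^'n"
  assumes "open S" "\<And>i j. smooth_on (\<lambda>x. f x $ i $ j) S"
  shows "smooth_on (\<lambda>x. det (f x)) S"
  unfolding det_def by (intro smooth_on_sum smooth_on_mult smooth_on_prod smooth_on_const assms)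

lemma smooth_on_vecI:
  fixes f :: "'a::real_normed_vector \<Rightarrow> real^'n"
  assumes "open S" "\<And>i. smooth_on (\<lambda>x. f x $ i) S"
  shows "smooth_on f S"
proof -
  have "smooth_on (\<lambda>x. \<Sum>i\<in>UNIV. (f x $ i) *\<^sub>R axis i (1::real)) S"
    by (intro smooth_on_sum smooth_on_scaleR smooth_on_const assms)
  moreover have "(\<Sum>i\<in>UNIV. (f x $ i) *\<^sub>R axis i (1::real)) = f x" for x
    by (simp add: vec_eq_iff axis_def if_distrib[of "\<lambda>z. _ * z"] sum.delta cong: if_cong)
  ultimately show ?thesis by simp
qed

lemma smooth_on_matI:
  fixes f :: "'a::real_normed_vector \<Rightarrow> real^'n^'m"
  assumes "open S" "\<And>i j. smooth_on (\<lambda>x. f x $ i $ j) S"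
  shows "smooth_on f S"
proof -
  have "smooth_on (\<lambda>x. \<Sum>i\<in>UNIV. \<Sum>j\<in>UNIV. (f x $ i $ j) *\<^sub>R axis i (axis j (1::real))) S"
    by (intro smooth_on_sum smooth_on_scaleR smooth_on_const assms)
  moreover have "(\<Sum>i\<in>UNIV. \<Sum>j\<in>UNIV. (f x $ i $ j) *\<^sub>R axis i (axis j (1::real))) = f x" for x
  proof -
    have "(\<Sum>i\<in>UNIV. \<Sum>j\<in>UNIV. (f x $ i $ j) *\<^sub>R axis i (axis j (1::real))) $ a $ b
       = (\<Sum>i\<in>UNIV. if i = a then \<Sum>j\<in>UNIV. if j = b then f x $ i $ j else 0 else 0)" for a b
      unfolding sum_component
      by (intro sum.cong refl) (auto simp: axis_def if_distrib[of "\<lambda>z. _ * z"] cong: if_cong intro!: sum.cong)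
    then show ?thesis by (simp add: vec_eq_iff sum.delta)
  qed
  ultimately show ?thesis by simp
qed

lemma smooth_on_matrix_matrix_mult:
  fixes f :: "'a::real_normed_vector \<Rightarrow> real^'n^'m"
  assumes "open S" "smooth_on f S" "smooth_on g S"
  shows "smooth_on (\<lambda>x. f x ** g x) S"
  by (rule smooth_on_matI[OF assms(1)], simp add: matrix_matrix_mult_def)
     (intro smooth_on_sum smooth_on_mult smooth_on_vec_nth assms)

section \<open>Symmetry of second derivatives\<close>

lemma mean_value_line:
  fixes F :: "'a::real_normed_vector \<Rightarrow> real"
  assumes "h > 0" "\<And>s. 0 \<le> s \<Longrightarrow> s \<le> h \<Longrightarrow> (F has_derivative F' (x + s *\<^sub>R u)) (at (x + s *\<^sub>R u))"
  shows "\<exists>s. 0 < s \<and> s < h \<and> F (x + h *\<^sub>R u) - F x = h * F' (x + s *\<^sub>R u) u"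
proof -
  have "((\<lambda>s. F (x + s *\<^sub>R u)) has_real_derivative F' (x + s *\<^sub>R u) u) (at s)"
    if "0 \<le> s" "s \<le> h" for s
  proof -
    have "((\<lambda>s. x + s *\<^sub>R u) has_derivative (\<lambda>t. t *\<^sub>R u)) (at s)"
      by (auto intro!: derivative_eq_intros)
    from diff_chain_at[OF this assms(2)[OF that]]
    have "((\<lambda>s. F (x + s *\<^sub>R u)) has_derivative (\<lambda>t. F' (x + s *\<^sub>R u) (t *\<^sub>R u))) (at s)"
      by (simp add: o_def)
    moreover have "F' (x + s *\<^sub>R u) (t *\<^sub>R u) = F' (x + s *\<^sub>R u) u * t" for t
      using has_derivative_linear[OF assms(2)[OF that]] by (simp add: linear_scale)
    ultimately show ?thesis by (simp add: has_field_derivative_def)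
  qed
  from MVT2[OF assms(1), of "\<lambda>s. F (x + s *\<^sub>R u)", OF this]
  show ?thesis by auto
qed

text \<open>The mean value theorem is applied twice, first along u to the increment of f in
  direction v, then along v to the derivative of f in direction u. The second difference itself is
  symmetric in u and v.\<close>

lemma second_difference_mean_value:
  fixes f :: "'a::real_normed_vector \<Rightarrow> real"
  assumes "Ck_on 2 f (ball x e)" "h > 0" "h * (norm u + norm v) < e"
  shows "\<exists>y \<in> cball x (h * (norm u + norm v)).
    f (x + h *\<^sub>R u + h *\<^sub>R v) - f (x + h *\<^sub>R u) - (f (x + h *\<^sub>R v) - f x) =
      h * (h * frechet_derivative (\<lambda>y. frechet_derivative f (at y) u) (at y) v)"
proof -
  have d1: "(f has_derivative frechet_derivative f (at y)) (at y)" if "y \<in> ball x e" for y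
    using assms(1) that Ck_on_has_derivative by (metis numeral_2_eq_2)
  have d2: "((\<lambda>y. frechet_derivative f (at y) u) has_derivative
      frechet_derivative (\<lambda>y. frechet_derivative f (at y) u) (at y)) (at y)" if "y \<in> ball x e" for y
    by (rule Ck_on_has_derivative[where S="ball x e" and k=0])
      (use assms(1) that in \<open>simp_all add: numeral_2_eq_2\<close>)
  have near: "norm (s *\<^sub>R u + t *\<^sub>R v) \<le> h * (norm u + norm v)"
    if "0 \<le> s" "s \<le> h" "0 \<le> t" "t \<le> h" for s t
  proof -
    have "norm (s *\<^sub>R u + t *\<^sub>R v) \<le> s * norm u + t * norm v"
      using that norm_triangle_ineq[of "s *\<^sub>R u" "t *\<^sub>R v"] by simp
    also have "\<dots> \<le> h * norm u + h * norm v"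
      using that by (intro add_mono mult_right_mono) auto
    finally show ?thesis by (simp add: algebra_simps)
  qed
  have dist_shift: "dist x (x + a + b) = norm (a + b)" for a b
    by (metis add.assoc add_diff_cancel_left' dist_commute dist_norm)
  have inb: "x + s *\<^sub>R u + t *\<^sub>R v \<in> ball x e"
    if "0 \<le> s" "s \<le> h" "0 \<le> t" "t \<le> h" for s t
    using near[OF that] assms(3) dist_shift[of "s *\<^sub>R u" "t *\<^sub>R v"] by simp
  let ?F = "\<lambda>y. f (y + h *\<^sub>R v) - f y"
  have F: "(?F has_derivative
      (\<lambda>w. frechet_derivative f (at (x + s *\<^sub>R u + h *\<^sub>R v)) w - frechet_derivative f (at (x + s *\<^sub>R u)) w))
      (at (x + s *\<^sub>R u))" if "0 \<le> s" "s \<le> h" for s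
  proof (intro has_derivative_diff)
    have "((\<lambda>y. y + h *\<^sub>R v) has_derivative (\<lambda>w. w)) (at (x + s *\<^sub>R u))"
      by (auto intro!: derivative_eq_intros)
    from diff_chain_at[OF this d1] inb[OF that, of h] assms(2)
    show "((\<lambda>y. f (y + h *\<^sub>R v)) has_derivative (\<lambda>w. frechet_derivative f (at (x + s *\<^sub>R u + h *\<^sub>R v)) w))
      (at (x + s *\<^sub>R u))" by (simp add: o_def)
    show "(f has_derivative (\<lambda>w. frechet_derivative f (at (x + s *\<^sub>R u)) w)) (at (x + s *\<^sub>R u))"
      using d1[of "x + s *\<^sub>R u"] inb[OF that, of 0] assms(2) by simp
  qed
  obtain s where s: "0 < s" "s < h" and eq1: "?F (x + h *\<^sub>R u) - ?F x =
      h * (frechet_derivative f (at (x + s *\<^sub>R u + h *\<^sub>R v)) u - frechet_derivative f (at (x + s *\<^sub>R u)) u)"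
    using mean_value_line[OF assms(2), of ?F
        "\<lambda>y w. frechet_derivative f (at (y + h *\<^sub>R v)) w - frechet_derivative f (at y) w" x u] F by auto
  obtain t where t: "0 < t" "t < h" and eq2:
    "frechet_derivative f (at (x + s *\<^sub>R u + h *\<^sub>R v)) u - frechet_derivative f (at (x + s *\<^sub>R u)) u =
      h * frechet_derivative (\<lambda>y. frechet_derivative f (at y) u) (at (x + s *\<^sub>R u + t *\<^sub>R v)) v"
    using mean_value_line[OF assms(2), of "\<lambda>y. frechet_derivative f (at y) u"
        "\<lambda>z. frechet_derivative (\<lambda>y. frechet_derivative f (at y) u) (at z)" "x + s *\<^sub>R u" v]
      d2[OF inb[of s]] s by fastforce
  have "x + s *\<^sub>R u + t *\<^sub>R v \<in> cball x (h * (norm u + norm v))"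
    using near[of s t] s t dist_shift[of "s *\<^sub>R u" "t *\<^sub>R v"] by simp
  then show ?thesis using eq1 eq2 by (intro bexI) (auto simp: algebra_simps)
qed

text \<open>The same second difference equals either mixed derivative at some nearby point. By
  continuity these values are close to the two mixed derivatives at x, so the latter cannot
  differ.\<close>

theorem second_derivative_symmetric_real:
  fixes f :: "'a::real_normed_vector \<Rightarrow> real"
  assumes "open S" "x \<in> S" "Ck_on 2 f S"
  shows "frechet_derivative (\<lambda>y. frechet_derivative f (at y) u) (at x) v =
    frechet_derivative (\<lambda>y. frechet_derivative f (at y) v) (at x) u"
proof (rule ccontr)
  let ?G = "\<lambda>u v y. frechet_derivative (\<lambda>y. frechet_derivative f (at y) u) (at y) v"
  assume ne: "?G u v x \<noteq> ?G v u x"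
  define d where "d = \<bar>?G u v x - ?G v u x\<bar> / 2"
  have "d > 0" using ne by (simp add: d_def)
  have "continuous_on S (?G u v)" for u v
    using assms(3) by (simp add: numeral_2_eq_2)
  then have "isCont (?G u v) x" for u v
    using assms(1,2) continuous_on_eq_continuous_at by blast
  then have "\<exists>e>0. \<forall>y. dist y x < e \<longrightarrow> \<bar>?G u v y - ?G u v x\<bar> < d" for u v
    using \<open>d > 0\<close> unfolding continuous_at_eps_delta dist_real_def by blast
  then obtain e1 e2 where e: "e1 > 0" "\<And>y. dist y x < e1 \<Longrightarrow> \<bar>?G u v y - ?G u v x\<bar> < d"
    "e2 > 0" "\<And>y. dist y x < e2 \<Longrightarrow> \<bar>?G v u y - ?G v u x\<bar> < d"
    by meson
  obtain e3 where e3: "e3 > 0" "ball x e3 \<subseteq> S" using assms(1,2) open_contains_ball by blast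
  define e0 where "e0 = min e1 (min e2 e3)"
  have "e0 > 0" using e e3 by (simp add: e0_def)
  \<comment> \<open>The summand 1 keeps the denominator positive when u and v vanish, and the factor
    2 makes the bound by \<open>e0\<close> strict.\<close>
  define h where "h = e0 / (2 * (norm u + norm v + 1))"
  have pos: "norm u + norm v + 1 > 0" by (simp add: add_nonneg_pos)
  have h: "h > 0" using \<open>e0 > 0\<close> pos by (simp add: h_def)
  have "h * (norm u + norm v) < h * (norm u + norm v + 1) * 2"
    using h pos by (simp add: algebra_simps) (smt (verit) mult_nonneg_nonneg norm_ge_zero)
  also have "\<dots> = e0" using pos by (simp add: h_def field_simps)
  finally have he: "h * (norm u + norm v) < e0" .
  have Ck: "Ck_on 2 f (ball x e0)"
    by (rule Ck_on_subset[OF assms(3)]) (use e3 in \<open>auto simp: e0_def\<close>)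
  obtain y where y: "y \<in> cball x (h * (norm u + norm v))"
    "f (x + h *\<^sub>R u + h *\<^sub>R v) - f (x + h *\<^sub>R u) - (f (x + h *\<^sub>R v) - f x) = h * (h * ?G u v y)"
    using second_difference_mean_value[OF Ck h he] by blast
  obtain z where z: "z \<in> cball x (h * (norm v + norm u))"
    "f (x + h *\<^sub>R v + h *\<^sub>R u) - f (x + h *\<^sub>R v) - (f (x + h *\<^sub>R u) - f x) = h * (h * ?G v u z)"
    using second_difference_mean_value[OF Ck h, of v u] he by (auto simp: add.commute)
  have "h * (h * ?G u v y) = h * (h * ?G v u z)"
    unfolding y(2)[symmetric] z(2)[symmetric] by (simp add: add_ac)
  then have "?G u v y = ?G v u z" using h by simp
  moreover have "dist y x < e0" "dist z x < e0"
    using y(1) z(1) he by (auto simp: dist_commute add.commute)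
  then have "\<bar>?G u v y - ?G u v x\<bar> < d" "\<bar>?G v u z - ?G v u x\<bar> < d"
    using e by (auto simp: e0_def)
  moreover have "a \<noteq> b" if "\<bar>a - p\<bar> < \<bar>p - q\<bar> / 2" "\<bar>b - q\<bar> < \<bar>p - q\<bar> / 2" for a b p q :: real
    using that by (auto simp: abs_if field_simps split: if_splits)
  ultimately show False unfolding d_def by blast
qed

text \<open>Applied componentwise, as the mean value theorem needs real values.\<close>

lemma second_derivative_symmetric:
  fixes f :: "'a::real_normed_vector \<Rightarrow> real^'n"
  assumes "open S" "x \<in> S" "smooth_on f S"
  shows "frechet_derivative (\<lambda>y. frechet_derivative f (at y) u) (at x) v =
    frechet_derivative (\<lambda>y. frechet_derivative f (at y) v) (at x) u"
proof -
  have comp: "frechet_derivative (\<lambda>y. g y $ i) (at y) w = frechet_derivative g (at y) w $ i"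
    if "smooth_on g S" "y \<in> S" for g :: "'a \<Rightarrow> real^'n" and y w i
    using bounded_linear.has_derivative[OF bounded_linear_vec_nth smooth_on_has_derivative[OF that]]
    by (metis frechet_derivative_at)
  have two: "frechet_derivative (\<lambda>y. frechet_derivative (\<lambda>y. f y $ i) (at y) a) (at x) b =
      frechet_derivative (\<lambda>y. frechet_derivative f (at y) a) (at x) b $ i" for a b i
  proof -
    have "frechet_derivative (\<lambda>y. frechet_derivative (\<lambda>y. f y $ i) (at y) a) (at x) =
        frechet_derivative (\<lambda>y. frechet_derivative f (at y) a $ i) (at x)"
      by (rule frechet_derivative_cong_open[OF assms(1,2)]) (simp add: comp assms(3))
    then show ?thesis
      by (simp add: comp smooth_on_frechet_derivative assms)
  qed
  have "Ck_on 2 (\<lambda>y. f y $ i) S" for i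
    using smooth_on_vec_nth[OF assms(1,3)] by (simp add: smooth_on_def)
  from second_derivative_symmetric_real[OF assms(1,2) this]
  show ?thesis by (simp add: vec_eq_iff flip: two)
qed

section \<open>Alternating forms\<close>

subsection \<open>Wedge products of 1-forms as determinants\<close>

text \<open>The Leibniz expansion of the determinant of the matrix of values of the forms on the
  vectors: a closed form of \<open>wedge1\<close> free of factorials.\<close>

definition alt_sum :: "cform list \<Rightarrow> cform" where
  "alt_sum as = (\<lambda>vs. if length vs = length as then
     (\<Sum>\<sigma> | \<sigma> permutes {..<length as}. of_int (sign \<sigma>) * (\<Prod>i<length as. (as ! i) [vs ! \<sigma> i]))
   else 0)"

lemma wedge_cong:
  assumes "\<And>vs. length vs = p \<Longrightarrow> a vs = a' vs" "\<And>vs. length vs = q \<Longrightarrow> b vs = b' vs"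
  shows "wedge p q a b = wedge p q a' b'"
  unfolding wedge_def using assms by (intro ext) (simp cong: if_cong)

text \<open>The embedding of a pair of permutations as a block permutation: \<tau> acts on the first
  p positions, \<rho> on the last q.\<close>

definition block_perm :: "nat \<Rightarrow> nat \<Rightarrow> (nat \<Rightarrow> nat) \<Rightarrow> (nat \<Rightarrow> nat) \<Rightarrow> nat \<Rightarrow> nat" where
  "block_perm p q \<tau> \<rho> = \<tau> \<circ> map_permutation {..<q} ((+) p) \<rho>"

lemma block_perm:
  assumes \<tau>: "\<tau> permutes {..<p}" and \<rho>: "\<rho> permutes {..<q}"
  shows "block_perm p q \<tau> \<rho> permutes {..<p+q}" (is ?A)
    and "sign (block_perm p q \<tau> \<rho>) = sign \<tau> * sign \<rho>" (is ?B)
    and "i < p \<Longrightarrow> block_perm p q \<tau> \<rho> i = \<tau> i"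
    and "i < q \<Longrightarrow> block_perm p q \<tau> \<rho> (p + i) = p + \<rho> i"
proof -
  let ?m = "map_permutation {..<q} ((+) p) \<rho>"
  have "bij_betw ((+) p) {..<q} {p..<p+q}"
    by (rule bij_betw_byWitness[where f'="\<lambda>i. i - p"]) auto
  then have m: "?m permutes {p..<p+q}" using \<rho> by (rule map_permutation_permutes)
  have \<tau>': "\<tau> permutes {..<p+q}" by (rule permutes_subset[OF \<tau>]) auto
  have m': "?m permutes {..<p+q}" by (rule permutes_subset[OF m]) auto
  show ?A unfolding block_perm_def by (rule permutes_compose[OF m' \<tau>'])
  have "sign ?m = sign \<rho>" by (rule sign_map_permutation) (use \<rho> in auto)
  moreover have "permutation ?m" "permutation \<tau>"
    using m' \<tau>' permutation_permutes by blast+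
  ultimately show ?B unfolding block_perm_def by (simp add: sign_compose)
  show "block_perm p q \<tau> \<rho> i = \<tau> i" if "i < p"
    using permutes_not_in[OF m, of i] that by (simp add: block_perm_def)
  show "block_perm p q \<tau> \<rho> (p + i) = p + \<rho> i" if "i < q"
  proof -
    have "?m (p + i) = p + \<rho> i" by (rule map_permutation_apply) (use that in auto)
    then show ?thesis using permutes_not_in[OF \<tau>, of "p + \<rho> i"] by (simp add: block_perm_def)
  qed
qed

text \<open>Expanding both factors gives a sum over \<sigma>, \<tau> and \<rho>. For fixed \<tau>
  and \<rho>, composing \<sigma> with the block permutation is a bijection, so each of the
  \<open>fact p * fact q\<close> pairs contributes the whole determinant, and the normalisation of
  \<open>wedge\<close> cancels.\<close>

lemma wedge_alt_sum: "wedge (length as) (length bs) (alt_sum as) (alt_sum bs) = alt_sum (as @ bs)"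
proof
  fix vs
  define p q where "p = length as" and "q = length bs"
  let ?P = "\<lambda>n. {\<sigma>. \<sigma> permutes {..<n::nat}}"
  let ?t = "\<lambda>\<sigma>. \<Prod>i<p+q. ((as @ bs) ! i) [vs ! \<sigma> i]"
  show "wedge (length as) (length bs) (alt_sum as) (alt_sum bs) vs = alt_sum (as @ bs) vs"
  proof (cases "length vs = p + q")
    case True
    have A: "alt_sum as (map (\<lambda>i. vs ! \<sigma> i) [0..<p]) =
      (\<Sum>\<tau>\<in>?P p. of_int (sign \<tau>) * (\<Prod>i<p. (as ! i) [vs ! \<sigma> (\<tau> i)]))" for \<sigma>
    proof -
      have "map (\<lambda>i. vs ! \<sigma> i) [0..<p] ! \<tau> i = vs ! \<sigma> (\<tau> i)" if "\<tau> permutes {..<p}" "i < p" for \<tau> i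
        using permutes_in_image[OF that(1), of i] that(2) by simp
      then show ?thesis by (simp add: alt_sum_def p_def)
    qed
    have B: "alt_sum bs (map (\<lambda>i. vs ! \<sigma> i) [p..<p+q]) =
      (\<Sum>\<tau>\<in>?P q. of_int (sign \<tau>) * (\<Prod>i<q. (bs ! i) [vs ! \<sigma> (p + \<tau> i)]))" for \<sigma>
    proof -
      have "map (\<lambda>i. vs ! \<sigma> i) [p..<p+q] ! \<tau> i = vs ! \<sigma> (p + \<tau> i)" if "\<tau> permutes {..<q}" "i < q" for \<tau> i
        using permutes_in_image[OF that(1), of i] that(2) by simp
      then show ?thesis by (simp add: alt_sum_def q_def)
    qed
    have summand: "of_int (sign \<sigma>) * (of_int (sign \<tau>) * (\<Prod>i<p. (as ! i) [vs ! \<sigma> (\<tau> i)]))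
        * (of_int (sign \<rho>) * (\<Prod>i<q. (bs ! i) [vs ! \<sigma> (p + \<rho> i)])) =
      of_int (sign (\<sigma> \<circ> block_perm p q \<tau> \<rho>)) * ?t (\<sigma> \<circ> block_perm p q \<tau> \<rho>)"
      if \<sigma>: "\<sigma> permutes {..<p+q}" and \<tau>: "\<tau> permutes {..<p}" and \<rho>: "\<rho> permutes {..<q}" for \<sigma> \<tau> \<rho>
    proof -
      let ?b = "block_perm p q \<tau> \<rho>"
      have "permutation \<sigma>" "permutation ?b"
        using \<sigma> block_perm(1)[OF \<tau> \<rho>] permutation_permutes by blast+
      then have s: "sign (\<sigma> \<circ> ?b) = sign \<sigma> * (sign \<tau> * sign \<rho>)"
        by (simp add: sign_compose block_perm(2)[OF \<tau> \<rho>])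
      have "{..<p+q} = {..<p} \<union> (+) p ` {..<q}"
        by (auto simp: lessThan_atLeast0)
      then have "?t (\<sigma> \<circ> ?b) = (\<Prod>i<p. ((as @ bs) ! i) [vs ! \<sigma> (?b i)]) *
          (\<Prod>i\<in>(+) p ` {..<q}. ((as @ bs) ! i) [vs ! \<sigma> (?b i)])"
        by (simp only: o_apply) (rule prod.union_disjoint, auto)
      also have "(\<Prod>i\<in>(+) p ` {..<q}. ((as @ bs) ! i) [vs ! \<sigma> (?b i)]) =
          (\<Prod>i<q. (bs ! i) [vs ! \<sigma> (p + \<rho> i)])"
        by (subst prod.reindex) (auto simp: p_def nth_append block_perm(4)[OF \<tau> \<rho>, unfolded p_def] intro!: prod.cong)
      also have "(\<Prod>i<p. ((as @ bs) ! i) [vs ! \<sigma> (?b i)]) = (\<Prod>i<p. (as ! i) [vs ! \<sigma> (\<tau> i)])"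
        by (intro prod.cong) (auto simp: p_def nth_append block_perm(3)[OF \<tau> \<rho>, unfolded p_def])
      finally show ?thesis by (simp add: s)
    qed
    have distr: "s * sum F P * sum G Q = (\<Sum>\<tau>\<in>P. \<Sum>\<rho>\<in>Q. s * F \<tau> * G \<rho>)"
      for s :: complex and F G :: "(nat \<Rightarrow> nat) \<Rightarrow> complex" and P Q
      by (simp only: sum_distrib_left[of s] sum_product)
    have "wedge p q (alt_sum as) (alt_sum bs) vs * (fact p * fact q) =
      (\<Sum>\<sigma>\<in>?P (p+q). of_int (sign \<sigma>) * alt_sum as (map (\<lambda>i. vs ! \<sigma> i) [0..<p])
          * alt_sum bs (map (\<lambda>i. vs ! \<sigma> i) [p..<p+q]))"
      using True by (simp add: wedge_def)
    also have "\<dots> = (\<Sum>\<sigma>\<in>?P (p+q). \<Sum>\<tau>\<in>?P p. \<Sum>\<rho>\<in>?P q.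
        of_int (sign \<sigma>) * (of_int (sign \<tau>) * (\<Prod>i<p. (as ! i) [vs ! \<sigma> (\<tau> i)]))
        * (of_int (sign \<rho>) * (\<Prod>i<q. (bs ! i) [vs ! \<sigma> (p + \<rho> i)])))"
      unfolding A B distr ..
    also have "\<dots> = (\<Sum>\<sigma>\<in>?P (p+q). \<Sum>\<tau>\<in>?P p. \<Sum>\<rho>\<in>?P q.
        of_int (sign (\<sigma> \<circ> block_perm p q \<tau> \<rho>)) * ?t (\<sigma> \<circ> block_perm p q \<tau> \<rho>))"
      by (intro sum.cong refl summand) auto
    also have "\<dots> = (\<Sum>\<tau>\<in>?P p. \<Sum>\<rho>\<in>?P q. \<Sum>\<sigma>\<in>?P (p+q).
        of_int (sign (\<sigma> \<circ> block_perm p q \<tau> \<rho>)) * ?t (\<sigma> \<circ> block_perm p q \<tau> \<rho>))"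
      by (subst sum.swap) (intro sum.cong refl sum.swap)
    also have "\<dots> = (\<Sum>\<tau>\<in>?P p. \<Sum>\<rho>\<in>?P q. \<Sum>\<sigma>\<in>?P (p+q). of_int (sign \<sigma>) * ?t \<sigma>)"
      by (intro sum.cong refl sum_permutations_compose_right[symmetric] block_perm(1)) auto
    also have "\<dots> = alt_sum (as @ bs) vs * (fact p * fact q)"
      using True by (simp add: alt_sum_def p_def q_def card_permutations[OF refl])
    finally show ?thesis by (simp add: p_def q_def)
  next
    case False
    then show ?thesis by (simp add: wedge_def alt_sum_def p_def q_def)
  qed
qed

lemma alt_sum_single: "alt_sum [a] = (\<lambda>vs. if length vs = 1 then a [vs ! 0] else 0)"
proof -
  have "{\<sigma>. \<forall>x::nat. \<sigma> x = x} = {id}" by auto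
  then show ?thesis by (simp add: alt_sum_def lessThan_Suc permutes_sing fun_eq_iff)
qed

lemma wedge1_eq_alt_sum: "wedge1 as = alt_sum as"
proof (induction as)
  case Nil
  have "{\<sigma>. \<sigma> permutes {..<0::nat}} = {id}" by auto
  then show ?case by (auto simp: alt_sum_def fun_eq_iff simp del: permutes_empty)
next
  case (Cons a as)
  have "wedge1 (a # as) = wedge (length [a]) (length as) (alt_sum [a]) (alt_sum as)"
    unfolding wedge1.simps Cons
    by (simp, rule wedge_cong) (auto simp: alt_sum_single length_Suc_conv)
  then show ?case unfolding wedge_alt_sum by simp
qed

lemma wedge_wedge1: "length as = p \<Longrightarrow> length bs = q \<Longrightarrow>
    wedge p q (wedge1 as) (wedge1 bs) = wedge1 (as @ bs)"
  unfolding wedge1_eq_alt_sum using wedge_alt_sum by blast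

lemma wedge_scale:
  "wedge p q (\<lambda>vs. k * a vs) (\<lambda>vs. l * b vs) = (\<lambda>vs. k * l * wedge p q a b vs)"
  unfolding wedge_def by (auto simp: fun_eq_iff sum_distrib_left intro!: sum.cong)

lemma cnj_form_wedge1: "cnj_form (wedge1 as) = wedge1 (map cnj_form as)"
  by (auto simp: wedge1_eq_alt_sum alt_sum_def cnj_form_def fun_eq_iff intro!: sum.cong prod.cong)

lemma wedge1_length: "length vs \<noteq> length as \<Longrightarrow> wedge1 as vs = 0"
  by (simp add: wedge1_eq_alt_sum alt_sum_def)

lemma wedge1_map_arg:
  assumes "length vs = length as" "length as' = length as"
    "\<And>i v. i < length as \<Longrightarrow> (as' ! i) [v] = (as ! i) [h v]"
  shows "wedge1 as' vs = wedge1 as (map h vs)"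
proof -
  have "\<sigma> i < length as" if "\<sigma> permutes {..<length as}" "i < length as" for \<sigma> i
    using permutes_in_image[OF that(1), of i] that(2) by simp
  then show ?thesis using assms
    by (auto simp: wedge1_eq_alt_sum alt_sum_def intro!: sum.cong prod.cong)
qed

text \<open>Composition with the transposition of i and j keeps every product and flips its sign, so
  the sum equals its own negative.\<close>

lemma wedge1_alternating:
  assumes "length vs = length as" "i < j" "j < length as" "vs ! i = vs ! j"
  shows "wedge1 as vs = 0"
proof -
  let ?n = "length as"
  let ?P = "{\<sigma>. \<sigma> permutes {..<?n}}"
  let ?t = "\<lambda>\<sigma>. \<Prod>k<?n. (as ! k) [vs ! \<sigma> k]"
  let ?\<tau> = "Transposition.transpose i j"
  have \<tau>: "?\<tau> permutes {..<?n}" using assms by (intro permutes_swap_id) auto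
  have "of_int (sign (?\<tau> \<circ> \<sigma>)) * ?t (?\<tau> \<circ> \<sigma>) = - (of_int (sign \<sigma>) * ?t \<sigma>)"
    if "\<sigma> \<in> ?P" for \<sigma>
  proof -
    have "permutation \<sigma>" "permutation ?\<tau>" using that permutation_permutes \<tau> by blast+
    then have "sign (?\<tau> \<circ> \<sigma>) = - sign \<sigma>" using assms by (simp add: sign_compose sign_swap_id)
    moreover have "vs ! ?\<tau> m = vs ! m" for m using assms by (simp add: Transposition.transpose_def)
    ultimately show ?thesis by simp
  qed
  then have "(\<Sum>\<sigma>\<in>?P. of_int (sign \<sigma>) * ?t \<sigma>) = (\<Sum>\<sigma>\<in>?P. - (of_int (sign \<sigma>) * ?t \<sigma>))"
    by (subst setum_permutations_compose_left[OF \<tau>]) (rule sum.cong, auto)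
  then show ?thesis using assms by (simp add: wedge1_eq_alt_sum alt_sum_def sum_negf)
qed

lemma wedge1_linear:
  assumes "length vs = length as" "i < length as" "\<And>a. a \<in> set as \<Longrightarrow> linear (\<lambda>v. a [v])"
  shows "linear (\<lambda>v. wedge1 as (vs[i := v]))"
proof -
  have "linear (\<lambda>v. of_int (sign \<sigma>) * (\<Prod>k<length as. (as ! k) [vs[i := v] ! \<sigma> k]))"
    if \<sigma>: "\<sigma> permutes {..<length as}" for \<sigma>
  proof -
    \<comment> \<open>In the term of \<sigma>, the vector at position i is fed to exactly one form,
      namely the one with index m.\<close>
    define m where "m = inv \<sigma> i"
    have m: "m < length as" "\<sigma> m = i"
      using permutes_inverses[OF \<sigma>] permutes_in_image[OF permutes_inv[OF \<sigma>], of i] assms(2)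
      by (auto simp: m_def)
    have other: "\<sigma> k \<noteq> i" if "k \<noteq> m" for k using that m permutes_inj[OF \<sigma>] by (metis injD)
    have "(\<Prod>k<length as. (as ! k) [vs[i := v] ! \<sigma> k]) =
       (as ! m) [v] * (\<Prod>k\<in>{..<length as} - {m}. (as ! k) [vs ! \<sigma> k])" for v
    proof -
      have "(\<Prod>k\<in>{..<length as} - {m}. (as ! k) [vs[i := v] ! \<sigma> k]) =
          (\<Prod>k\<in>{..<length as} - {m}. (as ! k) [vs ! \<sigma> k])"
        using other by (intro prod.cong) (simp_all add: nth_list_update_neq[OF not_sym])
      then show ?thesis
        using m assms by (subst prod.remove[of _ m]) auto
    qed
    moreover have "linear (\<lambda>v. of_int (sign \<sigma>) * ((as ! m) [v] * c))" for c
      using assms(3)[of "as ! m"] m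
      by (auto simp: linear_iff algebra_simps)
    ultimately show ?thesis by simp
  qed
  then have "linear (\<lambda>v. \<Sum>\<sigma> | \<sigma> permutes {..<length as}. of_int (sign \<sigma>) * (\<Prod>k<length as. (as ! k) [vs[i := v] ! \<sigma> k]))"
    by (intro linear_compose_sum) auto
  then show ?thesis using assms(1) by (simp add: wedge1_eq_alt_sum alt_sum_def)
qed

lemma kform_wedge1:
  assumes "\<And>a. a \<in> set as \<Longrightarrow> linear (\<lambda>v. a [v])"
  shows "kform (length as) (wedge1 as)"
  unfolding kform_def
proof (intro conjI allI impI)
  show "wedge1 as vs = 0" if "length vs \<noteq> length as" for vs
    using that by (rule wedge1_length)
  show "linear (\<lambda>v. wedge1 as (vs[i := v]))" if "length vs = length as" "i < length as" for vs i
    using that assms by (rule wedge1_linear)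
  show "wedge1 as vs = 0" if "length vs = length as" "i < j \<and> j < length as \<and> vs ! i = vs ! j" for vs i j
    using that wedge1_alternating by blast
qed

lemma kform_scale: "kform k w \<Longrightarrow> kform k (\<lambda>vs. c * w vs)"
  unfolding kform_def by (auto simp: linear_iff algebra_simps)

lemma wedge1_2: "wedge1 [a, b] [u, v] = a [u] * b [v] - a [v] * b [u]"
proof -
  have *: "{..<2::nat} = insert 0 {1}" by auto
  have "wedge1 [a, b] [u, v] = (\<Sum>\<sigma> | \<sigma> permutes {..<2}. of_int (sign \<sigma>) *
     (a [[u, v] ! \<sigma> 0] * b [[u, v] ! \<sigma> 1]))"
    by (simp add: wedge1_eq_alt_sum alt_sum_def numeral_2_eq_2 lessThan_Suc mult_ac)
  also have "\<dots> = a [u] * b [v] - a [v] * b [u]"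
    unfolding *
    by (simp add: sum_over_permutations_insert permutes_sing sign_swap_id sign_compose
        permutation_swap_id Transposition.transpose_def algebra_simps)
  finally show ?thesis .
qed

lemma wedge1_3:
  "wedge1 [a, b, c] [u, v, w] =
     a [u] * (b [v] * c [w] - b [w] * c [v]) - a [v] * (b [u] * c [w] - b [w] * c [u])
     + a [w] * (b [u] * c [v] - b [v] * c [u])"
proof -
  have 1: "{..<3::nat} = insert 0 {1, 2}" by auto
  have "{\<sigma>. \<sigma> permutes {2::nat}} = {id}" by auto
  note S = sum_over_permutations_insert
  have "wedge1 [a, b, c] [u, v, w] = (\<Sum>\<sigma> | \<sigma> permutes {..<3}. of_int (sign \<sigma>) *
     (a [[u, v, w] ! \<sigma> 0] * b [[u, v, w] ! \<sigma> 1] * c [[u, v, w] ! \<sigma> 2]))"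
    by (simp add: wedge1_eq_alt_sum alt_sum_def numeral_3_eq_3 numeral_2_eq_2 lessThan_Suc mult_ac)
  also have "\<dots> = a [u] * (b [v] * c [w] - b [w] * c [v]) - a [v] * (b [u] * c [w] - b [w] * c [u])
     + a [w] * (b [u] * c [v] - b [v] * c [u])"
    unfolding 1
    by (simp add: S permutes_sing sign_swap_id sign_compose permutation_swap_id
        Transposition.transpose_def algebra_simps)
  finally show ?thesis .
qed

section \<open>Six-fold wedge products and real volume forms\<close>

lemma exhaust_6:
  fixes x :: 6
  shows "x = 1 \<or> x = 2 \<or> x = 3 \<or> x = 4 \<or> x = 5 \<or> x = 6"
proof (induct x)
  case (of_int z)
  then have "z = 0 \<or> z = 1 \<or> z = 2 \<or> z = 3 \<or> z = 4 \<or> z = 5" by fastforce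
  then show ?case by auto
qed

lemma UNIV_6: "UNIV = {1, 2, 3, 4, 5, 6::6}"
  using exhaust_6 by auto

lemma vector_6:
  "(vector [a, b, c, d, e, f] :: 'a::zero^6) $ 1 = a"
  "(vector [a, b, c, d, e, f] :: 'a::zero^6) $ 2 = b"
  "(vector [a, b, c, d, e, f] :: 'a::zero^6) $ 3 = c"
  "(vector [a, b, c, d, e, f] :: 'a::zero^6) $ 4 = d"
  "(vector [a, b, c, d, e, f] :: 'a::zero^6) $ 5 = e"
  "(vector [a, b, c, d, e, f] :: 'a::zero^6) $ 6 = f"
  unfolding vector_def by simp_all

text \<open>Matches list positions, counted from 0, with the coordinate numbers 1 to 6; in the type
  \<open>6\<close> the last one equals 0.\<close>

definition idx6 :: "nat \<Rightarrow> 6" where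
  "idx6 n = of_nat (Suc n)"

lemma idx6_simps:
  "idx6 0 = 1" "idx6 (Suc 0) = 2" "idx6 2 = 3" "idx6 3 = 4" "idx6 4 = 5" "idx6 5 = 6"
  "idx6 (Suc (Suc 0)) = 3" "idx6 (Suc (Suc (Suc 0))) = 4" "idx6 (Suc (Suc (Suc (Suc 0)))) = 5"
  "idx6 (Suc (Suc (Suc (Suc (Suc 0))))) = 6"
  by (simp_all add: idx6_def)

lemma lessThan_6: "{..<6::nat} = {0, 1, 2, 3, 4, 5}"
  by auto

lemma bij_idx6: "bij_betw idx6 {..<6} UNIV"
proof -
  have "idx6 ` {..<6} = UNIV"
    unfolding lessThan_6 UNIV_6 by (simp add: idx6_simps)
  moreover from this have "inj_on idx6 {..<6}"
    by (intro eq_card_imp_inj_on) simp_all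
  ultimately show ?thesis by (simp add: bij_betw_def)
qed

lemma vector_idx6:
  assumes "length vs = 6" "n < 6"
  shows "(vector vs :: 'a::zero^6) $ idx6 n = vs ! n"
proof -
  obtain a b c d e f where vs: "vs = [a, b, c, d, e, f]"
    using assms(1) by (auto simp: numeral_eq_Suc length_Suc_conv)
  have "n \<in> {0, 1, 2, 3, 4, 5}" using assms(2) by auto
  then show ?thesis
    by (auto simp: vs idx6_simps vector_6 numeral_eq_Suc)
qed

text \<open>\<open>wedge1\<close> sums over permutations of list positions and \<open>det\<close>
  over permutations of the type \<open>6\<close>. Conjugation by \<open>idx6\<close> is a
  sign-preserving bijection between them.\<close>

lemma wedge1_eq_det:
  fixes M :: "complex^6^6"
  assumes "length as = 6" "length vs = 6"
    "\<And>m n. m < 6 \<Longrightarrow> n < 6 \<Longrightarrow> M $ idx6 m $ idx6 n = (as ! m) [vs ! n]"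
  shows "wedge1 as vs = det M"
proof -
  let ?m = "map_permutation {..<6} idx6"
  let ?g = "inv_into {..<6} idx6"
  have inj: "inj_on idx6 {..<6}" using bij_idx6 by (simp add: bij_betw_def)
  have bij': "bij_betw ?g UNIV {..<6}" using bij_idx6 by (rule bij_betw_inv_into)
  have g: "?g (idx6 n) = n" if "n < 6" for n
    using inj that by (simp add: inv_into_f_f)
  have g': "idx6 (?g i) = i" for i
    using bij_idx6 by (simp add: bij_betw_inv_into_right)
  have "bij_betw ?m {\<sigma>. \<sigma> permutes {..<6}} {\<sigma>. \<sigma> permutes UNIV}"
  proof (rule bij_betw_byWitness[where f'="map_permutation UNIV ?g"])
    show "\<forall>\<sigma>\<in>{\<sigma>. \<sigma> permutes {..<6}}. map_permutation UNIV ?g (?m \<sigma>) = \<sigma>"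
      using map_permutation_compose_inv[OF bij_idx6, of _ ?g] g by auto
    show "\<forall>\<sigma>\<in>{\<sigma>. \<sigma> permutes UNIV}. ?m (map_permutation UNIV ?g \<sigma>) = \<sigma>"
      using map_permutation_compose_inv[OF bij', of _ idx6] g' by auto
    show "?m ` {\<sigma>. \<sigma> permutes {..<6}} \<subseteq> {\<sigma>. \<sigma> permutes UNIV}"
      using map_permutation_permutes[OF bij_idx6] by auto
    show "map_permutation UNIV ?g ` {\<sigma>. \<sigma> permutes UNIV} \<subseteq> {\<sigma>. \<sigma> permutes {..<6}}"
      using map_permutation_permutes[OF bij'] by auto
  qed
  then have "det M = (\<Sum>\<sigma> | \<sigma> permutes {..<6}. of_int (sign (?m \<sigma>)) * (\<Prod>i\<in>UNIV. M $ i $ ?m \<sigma> i))"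
    unfolding det_def by (rule sum.reindex_bij_betw[symmetric])
  also have "\<dots> = (\<Sum>\<sigma> | \<sigma> permutes {..<6}. of_int (sign \<sigma>) * (\<Prod>i<6. (as ! i) [vs ! \<sigma> i]))"
  proof (rule sum.cong[OF refl])
    fix \<sigma> assume "\<sigma> \<in> {\<sigma>. \<sigma> permutes {..<6::nat}}"
    then have \<sigma>: "\<sigma> permutes {..<6}" by simp
    have "(\<Prod>i\<in>UNIV. M $ i $ ?m \<sigma> i) = (\<Prod>n<6. M $ idx6 n $ ?m \<sigma> (idx6 n))"
      by (rule prod.reindex_bij_betw[OF bij_idx6, symmetric])
    also have "\<dots> = (\<Prod>i<6. (as ! i) [vs ! \<sigma> i])"
    proof (rule prod.cong[OF refl])
      fix n :: nat assume "n \<in> {..<6}"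
      then show "M $ idx6 n $ ?m \<sigma> (idx6 n) = (as ! n) [vs ! \<sigma> n]"
        using permutes_in_image[OF \<sigma>, of n] assms(3) map_permutation_apply[OF inj, of n \<sigma>] by simp
    qed
    finally show "of_int (sign (?m \<sigma>)) * (\<Prod>i\<in>UNIV. M $ i $ ?m \<sigma> i) =
        of_int (sign \<sigma>) * (\<Prod>i<6. (as ! i) [vs ! \<sigma> i])"
      by (simp add: sign_map_permutation[OF inj \<sigma>])
  qed
  finally show ?thesis using assms(1,2) by (simp add: wedge1_eq_alt_sum alt_sum_def)
qed

lemma det_of_real: "det (\<chi> i j. complex_of_real (A $ i $ j)) = of_real (det A)"
  for A :: "real^'n^'n"
  by (simp add: det_def)

lemma linear_axis_expansion:
  fixes f :: "real^'n \<Rightarrow> complex"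
  assumes "linear f"
  shows "f v = (\<Sum>k\<in>UNIV. of_real (v $ k) * f (axis k 1))"
proof -
  have "f v = f (\<Sum>k\<in>UNIV. (v $ k) *\<^sub>R axis k 1)"
    using basis_expansion[of v] by (simp add: scalar_mult_eq_scaleR)
  also have "\<dots> = (\<Sum>k\<in>UNIV. of_real (v $ k) * f (axis k 1))"
    unfolding linear_sum[OF assms] linear_scale[OF assms] by (simp add: scaleR_conv_of_real)
  finally show ?thesis .
qed

text \<open>The matrix of values on the vectors factors as the matrix of values on the coordinate
  vectors times the matrix of coordinates. The latter enters transposed, because
  \<open>vector vs\<close> has the given vectors as rows.\<close>

lemma wedge1_eq_density:
  assumes as: "length as = 6" "\<And>a. a \<in> set as \<Longrightarrow> linear (\<lambda>v. a [v])" and vs: "length vs = 6"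
  shows "wedge1 as vs = density (wedge1 as) * of_real (det (vector vs :: real^6^6))"
proof -
  let ?g = "inv_into {..<6} idx6"
  let ?A = "(\<chi> i j. (as ! ?g i) [axis j 1]) :: complex^6^6"
  let ?V = "(\<chi> i j. of_real ((vector vs :: real^6^6) $ i $ j)) :: complex^6^6"
  let ?ax = "[axis 1 1, axis 2 1, axis 3 1, axis 4 1, axis 5 1, axis 6 1] :: (real^6) list"
  have g: "?g (idx6 n) = n" if "n < 6" for n
    using bij_idx6 that by (simp add: bij_betw_def inv_into_f_f)
  have "wedge1 as vs = det (?A ** transpose ?V)"
  proof (rule wedge1_eq_det[OF as(1) vs])
    fix m n :: nat assume mn: "m < 6" "n < 6"
    then have "linear (\<lambda>v. (as ! m) [v])" using as by simp
    from linear_axis_expansion[OF this, of "vs ! n"]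
    show "(?A ** transpose ?V) $ idx6 m $ idx6 n = (as ! m) [vs ! n]"
      using mn by (simp add: matrix_matrix_mult_def transpose_def g vector_idx6[OF vs] mult.commute)
  qed
  also have "\<dots> = det ?A * of_real (det (vector vs :: real^6^6))"
    by (simp add: det_mul det_of_real)
  also have "det ?A = wedge1 as ?ax"
  proof (rule wedge1_eq_det[OF as(1), symmetric])
    fix m n :: nat assume mn: "m < 6" "n < 6"
    then have "n \<in> {0, 1, 2, 3, 4, 5}" by auto
    then have "?ax ! n = axis (idx6 n) 1"
      by (auto simp: idx6_simps numeral_eq_Suc)
    then show "?A $ idx6 m $ idx6 n = (as ! m) [?ax ! n]" using mn g by simp
  qed simp
  finally show ?thesis by (simp add: density_def)
qed

text \<open>Associativity isolates the adjacent pair, where the sign is visible from the explicit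
  formula for two factors.\<close>

lemma wedge1_swap: "wedge1 (xs @ [a, b] @ ys) = (\<lambda>vs. - wedge1 (xs @ [b, a] @ ys) vs)"
proof -
  have 2: "wedge1 [a, b] = (\<lambda>vs. - 1 * wedge1 [b, a] vs)"
  proof
    fix vs show "wedge1 [a, b] vs = - 1 * wedge1 [b, a] vs"
    proof (cases "length vs = 2")
      case True
      then obtain u v where "vs = [u, v]" by (auto simp: numeral_2_eq_2 length_Suc_conv)
      then show ?thesis by (simp add: wedge1_2 del: wedge1.simps)
    qed (simp add: wedge1_length del: wedge1.simps)
  qed
  have *: "wedge1 (xs @ [c, d] @ ys) =
      wedge (length xs) (2 + length ys) (wedge1 xs) (wedge 2 (length ys) (wedge1 [c, d]) (wedge1 ys))" for c d
    by (simp add: wedge_wedge1 del: wedge1.simps)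
  show ?thesis
    unfolding * 2 using wedge_scale[of 2 "length ys" "- 1" "wedge1 [b, a]" 1 "wedge1 ys"]
      wedge_scale[of "length xs" "2 + length ys" 1 "wedge1 xs" "- 1" "wedge 2 (length ys) (wedge1 [b, a]) (wedge1 ys)"]
    by simp
qed

definition Re_form :: "cform \<Rightarrow> cform" where "Re_form a = (\<lambda>vs. of_real (Re (a vs)))"

definition Im_form :: "cform \<Rightarrow> cform" where "Im_form a = (\<lambda>vs. of_real (Im (a vs)))"

lemma wedge1_cnj_pair: "wedge1 [a, cnj_form a] = (\<lambda>vs. - 2 * \<i> * wedge1 [Re_form a, Im_form a] vs)"
proof
  fix vs show "wedge1 [a, cnj_form a] vs = - 2 * \<i> * wedge1 [Re_form a, Im_form a] vs"
  proof (cases "length vs = 2")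
    case True
    then obtain u v where "vs = [u, v]" by (auto simp: numeral_2_eq_2 length_Suc_conv)
    then show ?thesis
      by (simp add: wedge1_2 cnj_form_def Re_form_def Im_form_def complex_eq_iff algebra_simps del: wedge1.simps)
  qed (simp add: wedge1_length del: wedge1.simps)
qed

text \<open>Each \<open>\<alpha> \<and> \<alpha>\<close>-bar is \<open>-2i\<close> times \<open>Re \<alpha> \<and> Im \<alpha>\<close>, and reordering the six factors into
  such pairs takes three transpositions.\<close>

lemma wedge1_real_parts:
  "wedge1 [a, b, c, cnj_form a, cnj_form b, cnj_form c] =
    (\<lambda>vs. - 8 * \<i> * wedge1 [Re_form a, Im_form a, Re_form b, Im_form b, Re_form c, Im_form c] vs)"
proof -
  let ?p = "\<lambda>a. [a, cnj_form a]"  and ?q = "\<lambda>a. [Re_form a, Im_form a]"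
  have "wedge1 [a, b, c, cnj_form a, cnj_form b, cnj_form c] = (\<lambda>vs. - wedge1 (?p a @ ?p b @ ?p c) vs)"
    using wedge1_swap[of "[a, b]" c "cnj_form a" "[cnj_form b, cnj_form c]"]
      wedge1_swap[of "[a]" b "cnj_form a" "[c, cnj_form b, cnj_form c]"]
      wedge1_swap[of "[a, cnj_form a, b]" c "cnj_form b" "[cnj_form c]"]
    by (simp del: wedge1.simps)
  also have "wedge1 (?p a @ ?p b @ ?p c) = wedge 2 4 (wedge1 (?p a)) (wedge 2 2 (wedge1 (?p b)) (wedge1 (?p c)))"
    by (simp add: wedge_wedge1 del: wedge1.simps)
  also have "\<dots> = (\<lambda>vs. (-2*\<i>) * ((-2*\<i>) * (-2*\<i>)) * wedge 2 4 (wedge1 (?q a)) (wedge 2 2 (wedge1 (?q b)) (wedge1 (?q c))) vs)"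
    unfolding wedge1_cnj_pair wedge_scale ..
  also have "wedge 2 4 (wedge1 (?q a)) (wedge 2 2 (wedge1 (?q b)) (wedge1 (?q c))) = wedge1 (?q a @ ?q b @ ?q c)"
    by (simp add: wedge_wedge1 del: wedge1.simps)
  finally show ?thesis by (simp del: wedge1.simps)
qed

lemma wedge1_dual_basis:
  assumes "length as = 6" "length vs = 6"
    "\<And>m n. m < 6 \<Longrightarrow> n < 6 \<Longrightarrow> (as ! m) [vs ! n] = (if m = n then 1 else 0)"
  shows "wedge1 as vs = 1"
proof -
  have "wedge1 as vs = det (mat 1 :: complex^6^6)"
  proof (rule wedge1_eq_det[OF assms(1,2)])
    fix m n :: nat assume "m < 6" "n < 6"
    moreover from this have "idx6 m = idx6 n \<longleftrightarrow> m = n"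
      using bij_idx6 by (auto simp: bij_betw_def inj_on_def)
    ultimately show "(mat 1 :: complex^6^6) $ idx6 m $ idx6 n = (as ! m) [vs ! n]"
      by (simp add: mat_def assms(3))
  qed
  then show ?thesis by (simp add: det_I)
qed

declare wedge1.simps [simp del]

section \<open>Types of 2-forms\<close>

lemma scaleR_complex: "r *\<^sub>R (z::complex) = of_real r * z"
  by (rule scaleR_conv_of_real)

lemma length_2E:
  assumes "length vs = 2" obtains u v where "vs = [u, v]"
  using assms by (auto simp: numeral_2_eq_2 length_Suc_conv)

lemma neg_matrix_vector_mult: "(- A) *v x = - (A *v x)" for A :: "real^'n^'m"
  by (simp add: matrix_vector_mult_def vec_eq_iff sum_negf)

lemma matrix_vector_J_J: "J ** J = - mat 1 \<Longrightarrow> J *v (J *v v) = - v" for J :: "real^'n^'n"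
  by (metis matrix_vector_mul_assoc matrix_vector_mul_lid neg_matrix_vector_mult)

lemma kform_1_linear: "kform 1 a \<Longrightarrow> linear (\<lambda>v. a [v])"
proof -
  assume "kform 1 a"
  then have "linear (\<lambda>v. a ([0][0 := v]))"
    unfolding kform_def by (metis One_nat_def length_Cons list.size(3) lessI)
  then show ?thesis by simp
qed

lemma kform_1I: "(\<And>vs. length vs \<noteq> 1 \<Longrightarrow> a vs = 0) \<Longrightarrow> linear (\<lambda>v. a [v]) \<Longrightarrow> kform 1 a"
  by (auto simp: kform_def length_Suc_conv)

lemma form10_linear: "form10 J a \<Longrightarrow> linear (\<lambda>v. a [v])"
  by (simp add: form10_def kform_1_linear)

lemma form10_J: "form10 J a \<Longrightarrow> a [J *v v] = \<i> * a [v]"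
  by (simp add: form10_def)

lemma form01_J: "form01 J a \<Longrightarrow> a [J *v v] = - \<i> * a [v]"
  unfolding form01_def form10_def cnj_form_def
  by (metis complex_cnj_cnj complex_cnj_i complex_cnj_mult)

definition hol_part :: "real^6^6 \<Rightarrow> cform \<Rightarrow> cform" where
  "hol_part J a = (\<lambda>vs. if length vs = 1 then (a vs - \<i> * a [J *v hd vs]) / 2 else 0)"

definition antihol_part :: "real^6^6 \<Rightarrow> cform \<Rightarrow> cform" where
  "antihol_part J a = (\<lambda>vs. if length vs = 1 then (a vs + \<i> * a [J *v hd vs]) / 2 else 0)"

lemma form10_hol_part:
  assumes "J ** J = - mat 1" "linear (\<lambda>v. a [v])"
  shows "form10 J (hol_part J a)"
  unfolding form10_def
proof (intro conjI allI kform_1I)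
  show "linear (\<lambda>v. hol_part J a [v])"
    by (rule linearI) (simp_all add: hol_part_def matrix_vector_right_distrib matrix_vector_mult_scaleR
        linear_add[OF assms(2)] linear_scale[OF assms(2)] scaleR_complex field_simps)
  show "hol_part J a [J *v v] = \<i> * hol_part J a [v]" for v
    using linear_neg[OF assms(2)]
    by (simp add: hol_part_def matrix_vector_J_J[OF assms(1)] algebra_simps)
qed (simp add: hol_part_def)

lemma form01_antihol_part:
  assumes "J ** J = - mat 1" "linear (\<lambda>v. a [v])"
  shows "form01 J (antihol_part J a)"
proof -
  have "linear (\<lambda>v. cnj_form a [v])"
    using assms(2) by (auto simp: cnj_form_def linear_iff)
  moreover have "cnj_form (antihol_part J a) = hol_part J (cnj_form a)"
    by (auto simp: cnj_form_def antihol_part_def hol_part_def fun_eq_iff)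
  ultimately show ?thesis unfolding form01_def using form10_hol_part[OF assms(1)] by simp
qed

text \<open>Frees \<open>forms_pq\<close> from its indexing by an initial segment of the natural
  numbers.\<close>

lemma forms_pqI:
  assumes "finite I"
    "\<And>i. i \<in> I \<Longrightarrow> length (as i) = p \<and> (\<forall>a\<in>set (as i). form10 J a) \<and>
       length (bs i) = q \<and> (\<forall>b\<in>set (bs i). form01 J b)"
  shows "(\<lambda>vs. \<Sum>i\<in>I. k i * wedge1 (as i @ bs i) vs) \<in> forms_pq J p q"
proof -
  obtain h where h: "bij_betw h {0..<card I} I"
    using ex_bij_betw_nat_finite[OF assms(1)] by blast
  then have "(\<Sum>i\<in>I. k i * wedge1 (as i @ bs i) vs) =
      (\<Sum>n<card I. k (h n) * wedge1 (as (h n) @ bs (h n)) vs)" for vs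
    by (simp add: sum.reindex_bij_betw[OF h, symmetric] lessThan_atLeast0)
  moreover have "\<forall>n<card I. length (as (h n)) = p \<and> (\<forall>a\<in>set (as (h n)). form10 J a) \<and>
       length (bs (h n)) = q \<and> (\<forall>b\<in>set (bs (h n)). form01 J b)"
  proof (intro allI impI assms(2))
    show "h n \<in> I" if "n < card I" for n using h that by (auto simp: bij_betw_def)
  qed
  ultimately show ?thesis
    unfolding forms_pq_def
    by (rule_tac CollectI, rule_tac exI[of _ "card I"], rule_tac exI[of _ "\<lambda>n. k (h n)"],
        rule_tac exI[of _ "\<lambda>n. as (h n)"], rule_tac exI[of _ "\<lambda>n. bs (h n)"]) auto
qed

lemma forms_pq_length:
  "g \<in> forms_pq J p q \<Longrightarrow> length vs \<noteq> p + q \<Longrightarrow> g vs = 0"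
  by (auto simp: forms_pq_def wedge1_length)

text \<open>The eigenvalue relations under J in this lemma and the next two are all that is used to
  tell the bidegrees apart; \<open>type_part_02\<close> combines them into a projection.\<close>

lemma forms_20:
  assumes "g \<in> forms_pq J 2 0"
  shows "g [J *v u, v] = \<i> * g [u, v]" "g [u, J *v v] = \<i> * g [u, v]"
proof -
  obtain n :: nat and k as bs where *: "\<forall>i<n. length (as i) = 2 \<and> (\<forall>a\<in>set (as i). form10 J a) \<and>
      length (bs i) = 0 \<and> (\<forall>b\<in>set (bs i). form01 J b)"
    and g: "g = (\<lambda>vs. \<Sum>i<n. k i * wedge1 (as i @ bs i) vs)"
    using assms unfolding forms_pq_def mem_Collect_eq by (elim exE conjE) (rule that)
  have "wedge1 (as i @ bs i) [J *v u, v] = \<i> * wedge1 (as i @ bs i) [u, v] \<and>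
      wedge1 (as i @ bs i) [u, J *v v] = \<i> * wedge1 (as i @ bs i) [u, v]" if i: "i < n" for i
  proof -
    have "length (as i) = Suc (Suc 0)" using * i by (metis numeral_2_eq_2)
    then obtain a b where "as i = [a, b]" by (auto simp: length_Suc_conv)
    moreover have "bs i = []" "\<forall>a\<in>set (as i). form10 J a" using * i by auto
    ultimately show ?thesis by (auto simp: wedge1_2 form10_J algebra_simps)
  qed
  then show "g [J *v u, v] = \<i> * g [u, v]" "g [u, J *v v] = \<i> * g [u, v]"
    unfolding g by (auto simp: sum_distrib_left intro!: sum.cong)
qed

lemma forms_02:
  assumes "g \<in> forms_pq J 0 2"
  shows "g [J *v u, v] = - \<i> * g [u, v]" "g [u, J *v v] = - \<i> * g [u, v]"
proof -
  obtain n :: nat and k as bs where *: "\<forall>i<n. length (as i) = 0 \<and> (\<forall>a\<in>set (as i). form10 J a) \<and>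
      length (bs i) = 2 \<and> (\<forall>b\<in>set (bs i). form01 J b)"
    and g: "g = (\<lambda>vs. \<Sum>i<n. k i * wedge1 (as i @ bs i) vs)"
    using assms unfolding forms_pq_def mem_Collect_eq by (elim exE conjE) (rule that)
  have "wedge1 (as i @ bs i) [J *v u, v] = - \<i> * wedge1 (as i @ bs i) [u, v] \<and>
      wedge1 (as i @ bs i) [u, J *v v] = - \<i> * wedge1 (as i @ bs i) [u, v]" if i: "i < n" for i
  proof -
    have "length (bs i) = Suc (Suc 0)" using * i by (metis numeral_2_eq_2)
    then obtain a b where "bs i = [a, b]" by (auto simp: length_Suc_conv)
    moreover have "as i = []" "\<forall>a\<in>set (bs i). form01 J a" using * i by auto
    ultimately show ?thesis by (auto simp: wedge1_2 form01_J algebra_simps)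
  qed
  then show "g [J *v u, v] = - \<i> * g [u, v]" "g [u, J *v v] = - \<i> * g [u, v]"
    unfolding g by (auto simp: sum_distrib_left sum_negf[symmetric] intro!: sum.cong)
qed

lemma forms_11:
  assumes "g \<in> forms_pq J 1 1"
  shows "g [J *v u, J *v v] = g [u, v]" "g [u, J *v v] = - g [J *v u, v]"
proof -
  obtain n :: nat and k as bs where *: "\<forall>i<n. length (as i) = 1 \<and> (\<forall>a\<in>set (as i). form10 J a) \<and>
      length (bs i) = 1 \<and> (\<forall>a\<in>set (bs i). form01 J a)"
    and g: "g = (\<lambda>vs. \<Sum>i<n. k i * wedge1 (as i @ bs i) vs)"
    using assms unfolding forms_pq_def mem_Collect_eq by (elim exE conjE) (rule that)
  have "wedge1 (as i @ bs i) [J *v u, J *v v] = wedge1 (as i @ bs i) [u, v] \<and>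
      wedge1 (as i @ bs i) [u, J *v v] = - wedge1 (as i @ bs i) [J *v u, v]" if i: "i < n" for i
  proof -
    have "length (as i) = Suc 0" "length (bs i) = Suc 0" using * i by auto
    then obtain a b where "as i = [a]" "bs i = [b]" by (auto simp: length_Suc_conv)
    moreover have "\<forall>a\<in>set (as i). form10 J a" "\<forall>a\<in>set (bs i). form01 J a" using * i by auto
    ultimately show ?thesis by (auto simp: wedge1_2 form10_J form01_J algebra_simps)
  qed
  then show "g [J *v u, J *v v] = g [u, v]" "g [u, J *v v] = - g [J *v u, v]"
    unfolding g by (auto simp: sum_distrib_left sum_negf[symmetric] intro!: sum.cong)
qed

lemma kform_2:
  assumes "kform 2 w"
  shows "linear (\<lambda>u. w [u, v])" "linear (\<lambda>v. w [u, v])" "w [v, u] = - w [u, v]"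
    "length vs \<noteq> 2 \<Longrightarrow> w vs = 0"
proof -
  have l: "linear (\<lambda>x. w (vs[i := x]))" if "length vs = 2" "i < 2" for vs i
    using assms that unfolding kform_def by blast
  show 1: "linear (\<lambda>u. w [u, v])" for v using l[of "[0, v]" 0] by simp
  show 2: "linear (\<lambda>v. w [u, v])" for u using l[of "[u, 0]" 1] by simp
  have alt: "w [x, x] = 0" for x
  proof -
    have "\<And>i j. i < j \<and> j < 2 \<and> [x, x] ! i = [x, x] ! j \<longrightarrow> w [x, x] = 0"
      using assms unfolding kform_def by (metis One_nat_def length_Cons list.size(3) numeral_2_eq_2)
    from this[of 0 1] show ?thesis by simp
  qed
  have "w [u + v, u + v] = w [u, u] + w [u, v] + (w [v, u] + w [v, v])"
    by (simp add: linear_add[OF 1] linear_add[OF 2])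
  then show "w [v, u] = - w [u, v]" by (simp add: alt add_eq_0_iff)
  show "length vs \<noteq> 2 \<Longrightarrow> w vs = 0" using assms by (simp add: kform_def)
qed

lemma bilinear_axis_expansion:
  fixes w :: "real^'n \<Rightarrow> real^'m \<Rightarrow> complex"
  assumes "\<And>v. linear (\<lambda>u. w u v)" "\<And>u. linear (w u)"
  shows "w u v = (\<Sum>a\<in>UNIV. \<Sum>b\<in>UNIV. w (axis a 1) (axis b 1) * (of_real (u $ a) * of_real (v $ b)))"
proof -
  have "w u v = (\<Sum>a\<in>UNIV. of_real (u $ a) * (\<Sum>b\<in>UNIV. of_real (v $ b) * w (axis a 1) (axis b 1)))"
    using linear_axis_expansion[OF assms(1), of u v]
    unfolding linear_axis_expansion[OF assms(2), of _ v] by simp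
  then show ?thesis by (simp add: sum_distrib_left mult_ac)
qed

text \<open>Each coordinate form splits into its (1,0) and (0,1) parts; substituting this into the
  expansion of w in coordinate 2-forms and sorting the products gives the components.\<close>

lemma type_decomposition_2:
  assumes J: "J ** J = - mat 1" and w: "kform 2 w"
  shows "\<exists>g. (\<forall>r\<le>2. g r \<in> forms_pq J r (2 - r)) \<and> w = (\<lambda>vs. \<Sum>r\<le>2. g r vs)"
proof -
  define dx :: "6 \<Rightarrow> cform" where "dx a = (\<lambda>vs. of_real (hd vs $ a))" for a
  define p q where "p a = hol_part J (dx a)" and "q a = antihol_part J (dx a)" for a
  define W where "W ab = w [axis (fst ab) 1, axis (snd ab) 1]" for ab :: "6 \<times> 6"
  have "linear (\<lambda>v. dx a [v])" for a by (simp add: dx_def linear_iff scaleR_complex)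
  then have p: "form10 J (p a)" and q: "form01 J (q a)" for a
    by (simp_all add: p_def q_def form10_hol_part[OF J] form01_antihol_part[OF J])
  \<comment> \<open>The sum over ordered pairs meets every product of two (1,0)-forms twice, hence
    the factor 1/2 here and in \<open>g0\<close>. In \<open>g1\<close> the two mixed products agree
    after an exchange of indices, by antisymmetry of w, so there the factor is 1.\<close>
  define g2 where "g2 = (\<lambda>vs. \<Sum>ab\<in>UNIV. W ab / 2 * wedge1 ([p (fst ab), p (snd ab)] @ []) vs)"
  define g1 where "g1 = (\<lambda>vs. \<Sum>ab\<in>UNIV. W ab * wedge1 ([p (fst ab)] @ [q (snd ab)]) vs)"
  define g0 where "g0 = (\<lambda>vs. \<Sum>ab\<in>UNIV. W ab / 2 * wedge1 ([] @ [q (fst ab), q (snd ab)]) vs)"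
  have mem: "g2 \<in> forms_pq J 2 0" "g1 \<in> forms_pq J 1 1" "g0 \<in> forms_pq J 0 2"
    unfolding g2_def g1_def g0_def by (intro forms_pqI; simp add: p q)+
  note lin = kform_2[OF w]
  have exp: "w [u, v] = (\<Sum>ab\<in>UNIV. W ab * (of_real (u $ fst ab) * of_real (v $ snd ab)))" for u v
    unfolding bilinear_axis_expansion[of "\<lambda>u v. w [u, v]", OF lin(1,2), of u v] W_def
    by (simp add: sum.cartesian_product case_prod_beta flip: UNIV_Times_UNIV)
  have pv: "p a [v] = (of_real (v $ a) - \<i> * of_real ((J *v v) $ a)) / 2"
    and qv: "q a [v] = (of_real (v $ a) + \<i> * of_real ((J *v v) $ a)) / 2" for a v
    by (simp_all add: p_def q_def hol_part_def antihol_part_def dx_def)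
  have PP: "(\<Sum>ab\<in>UNIV. W ab * (p (fst ab) [u] * p (snd ab) [v])) =
      (w [u, v] - \<i> * w [J *v u, v] - \<i> * w [u, J *v v] - w [J *v u, J *v v]) / 4" for u v
    unfolding exp sum_distrib_left sum_divide_distrib sum_subtractf[symmetric] pv
    by (rule sum.cong) (simp_all add: field_simps)
  have PQ: "(\<Sum>ab\<in>UNIV. W ab * (p (fst ab) [u] * q (snd ab) [v])) =
      (w [u, v] - \<i> * w [J *v u, v] + \<i> * w [u, J *v v] + w [J *v u, J *v v]) / 4" for u v
    unfolding exp sum_distrib_left sum_divide_distrib sum_subtractf[symmetric] sum.distrib[symmetric] pv qv
    by (rule sum.cong) (simp_all add: field_simps)
  have QQ: "(\<Sum>ab\<in>UNIV. W ab * (q (fst ab) [u] * q (snd ab) [v])) =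
      (w [u, v] + \<i> * w [J *v u, v] + \<i> * w [u, J *v v] - w [J *v u, J *v v]) / 4" for u v
    unfolding exp sum_distrib_left sum_divide_distrib sum_subtractf[symmetric] sum.distrib[symmetric] qv
    by (rule sum.cong) (simp_all add: field_simps)
  have split: "(\<Sum>ab\<in>UNIV. W ab * (x ab - y ab)) = (\<Sum>ab\<in>UNIV. W ab * x ab) - (\<Sum>ab\<in>UNIV. W ab * y ab)"
    "(\<Sum>ab\<in>UNIV. W ab / 2 * (x ab - y ab)) = ((\<Sum>ab\<in>UNIV. W ab * x ab) - (\<Sum>ab\<in>UNIV. W ab * y ab)) / 2"
    for x y :: "6 \<times> 6 \<Rightarrow> complex"
    by (simp_all add: right_diff_distrib sum_subtractf sum_divide_distrib diff_divide_distrib)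
  have total: "w vs = g2 vs + g1 vs + g0 vs" for vs
  proof (cases "length vs = 2")
    case True
    then obtain u v where vs: "vs = [u, v]" by (rule length_2E)
    show ?thesis
      unfolding vs g2_def g1_def g0_def append.simps wedge1_2 split PP PQ QQ
      using lin(3)[of u v] lin(3)[of "J *v u" v] lin(3)[of u "J *v v"] lin(3)[of "J *v u" "J *v v"]
      by (simp add: field_simps)
  next
    case False
    then show ?thesis using forms_pq_length[OF mem(1)] forms_pq_length[OF mem(2)]
        forms_pq_length[OF mem(3)] lin(4) by simp
  qed
  define g where "g r = (if r = 0 then g0 else if r = 1 then g1 else g2)" for r :: nat
  have "\<forall>r\<le>2. g r \<in> forms_pq J r (2 - r)"
    using mem by (auto simp: g_def numeral_2_eq_2 le_Suc_eq)
  moreover have "w = (\<lambda>vs. \<Sum>r\<le>2. g r vs)"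
    using total by (auto simp: g_def numeral_2_eq_2 fun_eq_iff)
  ultimately show ?thesis by blast
qed

text \<open>The four terms add up to 4 times w on (0,2)-forms, where each J contributes -i, and
  cancel on (2,0)- and (1,1)-forms.\<close>

lemma type_part_02:
  assumes J: "J ** J = - mat 1" and w: "kform 2 w"
  shows "type_part J 0 2 w = (\<lambda>vs. if length vs = 2 then
     (w vs - w (map ((*v) J) vs) + \<i> * w [J *v vs ! 0, vs ! 1] + \<i> * w [vs ! 0, J *v vs ! 1]) / 4 else 0)"
    (is "_ = ?b")
  unfolding type_part_def
proof (rule the_equality)
  have unique: "g 0 = ?b" if g: "\<forall>r\<le>0+2. g r \<in> forms_pq J r (0 + 2 - r)" and w': "w = (\<lambda>vs. \<Sum>r\<le>0+2. g r vs)" for g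
  proof
    have mem: "g 0 \<in> forms_pq J 0 2" "g (Suc 0) \<in> forms_pq J 1 1" "g 2 \<in> forms_pq J 2 0"
      using g[rule_format, of 0] g[rule_format, of "Suc 0"] g[rule_format, of 2] by (simp_all add: numeral_2_eq_2)
    have sum: "w vs = g 0 vs + g (Suc 0) vs + g 2 vs" for vs
      unfolding w' by (simp add: numeral_2_eq_2)
    fix vs show "g 0 vs = ?b vs"
    proof (cases "length vs = 2")
      case True
      then obtain u v where vs: "vs = [u, v]" by (rule length_2E)
      show ?thesis
        unfolding vs sum
        using forms_11(2)[OF mem(2), of u v]
        by (simp add: forms_02[OF mem(1)] forms_11(1)[OF mem(2)] forms_20[OF mem(3)] field_simps)
    next
      case False
      then show ?thesis using forms_pq_length[OF mem(1)] by simp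
    qed
  qed
  then show "\<And>b. \<exists>g. (\<forall>r\<le>0+2. g r \<in> forms_pq J r (0 + 2 - r)) \<and> w = (\<lambda>vs. \<Sum>r\<le>0+2. g r vs) \<and> b = g 0 \<Longrightarrow> b = ?b"
    by blast
  obtain g where g: "\<forall>r\<le>0+2. g r \<in> forms_pq J r (0 + 2 - r)" "w = (\<lambda>vs. \<Sum>r\<le>0+2. g r vs)"
    using type_decomposition_2[OF assms] unfolding add_0 by blast
  show "\<exists>g. (\<forall>r\<le>0+2. g r \<in> forms_pq J r (0 + 2 - r)) \<and> w = (\<lambda>vs. \<Sum>r\<le>0+2. g r vs) \<and> ?b = g 0"
    by (rule exI[of _ g], intro conjI g unique[OF g, symmetric])
qed


section \<open>The Nijenhuis tensor\<close>

text \<open>\<open>D u\<close> stands for the derivative of \<open>J\<close> in the direction \<open>u\<close>.\<close>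

definition nij_tensor :: "real^6^6 \<Rightarrow> (real^6 \<Rightarrow> real^6^6) \<Rightarrow> real^6 \<Rightarrow> real^6 \<Rightarrow> real^6" where
  "nij_tensor J D u v = D (J *v u) *v v - D (J *v v) *v u - J *v (D u *v v) + J *v (D v *v u)"

definition antibilinear :: "real^6^6 \<Rightarrow> (real^6 \<Rightarrow> real^6 \<Rightarrow> real^6) \<Rightarrow> bool" where
  "antibilinear J T \<longleftrightarrow> (\<forall>v. linear (\<lambda>u. T u v)) \<and> (\<forall>u v. T v u = - T u v) \<and>
     (\<forall>u v. T (J *v u) v = - (J *v T u v))"

text \<open>For constant vector fields u and v, \<open>nij_tensor\<close> is the bracket expression
  [Ju,Jv] - J[Ju,v] - J[u,Jv] - [u,v]. Its conjugate-linearity rests on D u anticommuting with J,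
  the derivative of the equation \<open>J ** J = - mat 1\<close>.\<close>

lemma antibilinear_nij_tensor:
  assumes J: "J ** J = - mat 1" and D: "linear D" "\<And>u. D u ** J = - (J ** D u)"
  shows "antibilinear J (nij_tensor J D)"
proof -
  note JJ = matrix_vector_J_J[OF J]
  have DJ: "D u *v (J *v v) = - (J *v (D u *v v))" for u v
    using D(2)[of u] by (metis matrix_vector_mul_assoc neg_matrix_vector_mult)
  have neg: "D (- u) = - D u" for u using D(1) by (rule linear_neg)
  show ?thesis
    unfolding antibilinear_def nij_tensor_def
    using linear_add[OF D(1)] linear_scale[OF D(1)]
    by (auto simp: linear_iff JJ DJ neg neg_matrix_vector_mult matrix_vector_right_distrib
        matrix_vector_mult_scaleR matrix_vector_mult_add_rdistrib algebra_simps
        linear_neg[OF matrix_vector_mul_linear] matrix_vector_mult_diff_distrib matrix_vector_mult_diff_rdistrib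
        scaleR_matrix_vector_assoc[symmetric])
qed

text \<open>Differentiating \<open>\<alpha>(Jv) = i \<alpha>(v)\<close> eliminates the derivatives of \<open>\<alpha>\<close> from the
  \<open>(0,2)\<close>-part of \<open>d\<alpha>\<close>.\<close>

lemma type_part_d_form10:
  assumes J: "J ** J = - mat 1" and a: "form10 J a"
    and lin: "\<And>v. linear (\<lambda>u. da u v)" "\<And>u. linear (da u)"
    and da: "\<And>u v. da u (J *v v) + a [D u *v v] = \<i> * da u v"
  shows "type_part J 0 2 (\<lambda>vs. if length vs = 2 then da (vs ! 0) (vs ! 1) - da (vs ! 1) (vs ! 0) else 0) =
    (\<lambda>vs. if length vs = 2 then a [nij_tensor J D (vs ! 0) (vs ! 1)] / 4 else 0)"
proof -
  let ?w = "\<lambda>vs. if length vs = 2 then da (vs ! 0) (vs ! 1) - da (vs ! 1) (vs ! 0) else 0"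
  have "kform 2 ?w"
    unfolding kform_def
  proof (intro conjI allI impI)
    fix vs :: "(real^6) list" and i :: nat assume "length vs = 2" "i < 2"
    then show "linear (\<lambda>v. ?w (vs[i := v]))"
      using lin by (auto simp: less_2_cases_iff linear_iff algebra_simps)
  next
    fix vs :: "(real^6) list" and i j :: nat
    assume "i < j \<and> j < 2 \<and> vs ! i = vs ! j"
    then have "i = 0" "j = 1" "vs ! i = vs ! j" by auto
    then show "?w vs = 0" by simp
  qed simp
  moreover have "(?w [u, v] - ?w [J *v u, J *v v] + \<i> * ?w [J *v u, v] + \<i> * ?w [u, J *v v]) / 4 =
      a [nij_tensor J D u v] / 4" for u v
  proof -
    note la = form10_linear[OF a]
    have da': "da u (J *v v) = \<i> * da u v - a [D u *v v]" for u v
      using da[of u v] by (simp add: algebra_simps)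
    have *: "a [nij_tensor J D u v] = a [D (J *v u) *v v] - a [D (J *v v) *v u]
        - \<i> * a [D u *v v] + \<i> * a [D v *v u]"
      unfolding nij_tensor_def linear_add[OF la] linear_diff[OF la] form10_J[OF a] ..
    show ?thesis unfolding * by (simp add: da' algebra_simps)
  qed
  ultimately show ?thesis
    unfolding type_part_02[OF J \<open>kform 2 ?w\<close>]
    by (auto simp: fun_eq_iff elim!: length_2E)
qed

section \<open>The polarized determinant\<close>

text \<open>The determinant of the matrix whose rows 1, 2 and 3 come from a, b and c respectively.
  It is trilinear but not symmetric; \<open>sym_det\<close> is its average over the
  orderings.\<close>

definition mixed_det :: "complex^3^3 \<Rightarrow> complex^3^3 \<Rightarrow> complex^3^3 \<Rightarrow> complex" where
  "mixed_det a b c =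
     a$1$1 * b$2$2 * c$3$3 + a$1$2 * b$2$3 * c$3$1 + a$1$3 * b$2$1 * c$3$2 -
     a$1$1 * b$2$3 * c$3$2 - a$1$2 * b$2$1 * c$3$3 - a$1$3 * b$2$2 * c$3$1"

definition sym_det :: "complex^3^3 \<Rightarrow> complex^3^3 \<Rightarrow> complex^3^3 \<Rightarrow> complex" where
  "sym_det a b c = (mixed_det a b c + mixed_det a c b + mixed_det b a c +
     mixed_det b c a + mixed_det c a b + mixed_det c b a) / 6"

lemma mixed_det_add:
  "mixed_det (a + a') b c = mixed_det a b c + mixed_det a' b c"
  "mixed_det b (a + a') c = mixed_det b a c + mixed_det b a' c"
  "mixed_det b c (a + a') = mixed_det b c a + mixed_det b c a'"
  by (simp_all add: mixed_det_def algebra_simps)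

lemma mixed_det_scale:
  "mixed_det (\<chi> i j. k * a$i$j) b c = k * mixed_det a b c"
  "mixed_det b (\<chi> i j. k * a$i$j) c = k * mixed_det b a c"
  "mixed_det b c (\<chi> i j. k * a$i$j) = k * mixed_det b c a"
  by (simp_all add: mixed_det_def algebra_simps)

lemma symmetric_trilinear_sym_det: "symmetric_trilinear sym_det"
  unfolding symmetric_trilinear_def sym_det_def
  by (auto simp: mixed_det_add mixed_det_scale add_divide_distrib distrib_left algebra_simps)

lemma sym_det_diag: "sym_det a a a = det a"
  by (simp add: sym_det_def mixed_det_def det_3)

text \<open>A symmetric trilinear form is determined by its values on the diagonal. This gives the
  uniqueness of \<open>polar_det\<close> and carries multiplicativity from \<open>det\<close> over
  to \<open>sym_det\<close>.\<close>

lemma symmetric_trilinear_polarization: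
  assumes "symmetric_trilinear P"
  shows "6 * P a b c = P (a + b + c) (a + b + c) (a + b + c) - P (a + b) (a + b) (a + b)
    - P (b + c) (b + c) (b + c) - P (a + c) (a + c) (a + c) + P a a a + P b b b + P c c c"
proof -
  have add1: "P (x + y) z w = P x z w + P y z w" for x y z w
    using assms unfolding symmetric_trilinear_def by blast
  have s: "P x y z = P y x z" "P x y z = P x z y" for x y z
    using assms unfolding symmetric_trilinear_def by blast+
  have add2: "P z (x + y) w = P z x w + P z y w" for x y z w
    using add1[of x y z w] by (simp only: s(1)[of z])
  have add3: "P z w (x + y) = P z w x + P z w y" for x y z w
    using add2[of z x y w] by (simp only: s(2)[of z w])
  have "P b a c = P a b c" "P b c a = P a b c" "P c a b = P a b c" "P c b a = P a b c" "P a c b = P a b c"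
    "P a b a = P a a b" "P b a a = P a a b" "P b a b = P a b b" "P b b a = P a b b"
    "P a c a = P a a c" "P c a a = P a a c" "P c a c = P a c c" "P c c a = P a c c"
    "P b c b = P b b c" "P c b b = P b b c" "P c b c = P b c c" "P c c b = P b c c"
    using s by metis+
  then show ?thesis by (simp add: add1 add2 add3)
qed

lemma polar_det_eq: "polar_det = sym_det"
  unfolding polar_det_def
proof (rule the_equality)
  show "symmetric_trilinear sym_det \<and> (\<forall>a. sym_det a a a = det a)"
    by (simp add: symmetric_trilinear_sym_det sym_det_diag)
  fix P assume P: "symmetric_trilinear P \<and> (\<forall>a. P a a a = det a)"
  have "6 * P a b c = 6 * sym_det a b c" for a b c
    using P symmetric_trilinear_polarization[of P a b c]
      symmetric_trilinear_polarization[OF symmetric_trilinear_sym_det, of a b c]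
    by (simp add: sym_det_diag)
  then show "P = sym_det" by (simp add: fun_eq_iff)
qed

lemma sym_det_scale:
  "sym_det (\<chi> i j. k * a$i$j) (\<chi> i j. l * b$i$j) (\<chi> i j. m * c$i$j) = k * l * m * sym_det a b c"
  by (simp add: sym_det_def mixed_det_scale algebra_simps add_divide_distrib)

lemma sym_det_mult:
  "sym_det (A ** a ** B) (A ** b ** B) (A ** c ** B) = det A * det B * sym_det a b c"
proof -
  have *: "A ** x ** B + A ** y ** B = A ** (x + y) ** B" for x y
    by (simp add: matrix_matrix_mult_def vec_eq_iff sum.distrib distrib_left distrib_right)
  have "6 * sym_det (A ** a ** B) (A ** b ** B) (A ** c ** B) = det A * det B * (6 * sym_det a b c)"
    unfolding symmetric_trilinear_polarization[OF symmetric_trilinear_sym_det] * sym_det_diag det_mul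
    by (simp add: algebra_simps)
  then show ?thesis by simp
qed


section \<open>Coframes and their dual frames\<close>

lemma add_3: "(1::3) + 1 = 2" "(1::3) + 2 = 3" "(2::3) + 1 = 3" "(2::3) + 2 = 1" "(3::3) + 1 = 1" "(3::3) + 2 = 2"
  "(4::3) = 1" "(5::3) = 2"
  by simp_all

definition coframe :: "real^6^6 \<Rightarrow> (3 \<Rightarrow> cform) \<Rightarrow> bool" where
  "coframe J a \<longleftrightarrow> (\<forall>i. form10 J (a i)) \<and>
     (\<forall>k::3 \<Rightarrow> complex. (\<forall>v. (\<Sum>i\<in>UNIV. k i * a i [v]) = 0) \<longrightarrow> (\<forall>i. k i = 0))"

text \<open>A complex number z acts on a vector v as Re z v + Im z J v. With this reading the last
  clause expands every vector in the complex basis e with the values of a as coefficients.\<close>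

definition dual_frame :: "real^6^6 \<Rightarrow> (3 \<Rightarrow> cform) \<Rightarrow> (3 \<Rightarrow> real^6) \<Rightarrow> bool" where
  "dual_frame J a e \<longleftrightarrow> (\<forall>i. form10 J (a i)) \<and> (\<forall>i k. a i [e k] = (if i = k then 1 else 0)) \<and>
     (\<forall>v. v = (\<Sum>k\<in>UNIV. Re (a k [v]) *\<^sub>R e k + Im (a k [v]) *\<^sub>R (J *v e k)))"

lemma dual_frame_form10: "dual_frame J a e \<Longrightarrow> form10 J (a i)"
  by (simp add: dual_frame_def)

lemma dual_frame_eval: "dual_frame J a e \<Longrightarrow> a i [e k] = (if i = k then 1 else 0)"
  by (simp add: dual_frame_def)

lemma dual_frame_expansion:
  assumes "dual_frame J a e" "linear f" "\<And>v. f (J *v v) = \<i> * f v"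
  shows "f v = (\<Sum>k\<in>UNIV. a k [v] * f (e k))"
proof -
  have "f v = f (\<Sum>k\<in>UNIV. Re (a k [v]) *\<^sub>R e k + Im (a k [v]) *\<^sub>R (J *v e k))"
    using assms(1) unfolding dual_frame_def by metis
  also have "\<dots> = (\<Sum>k\<in>UNIV. a k [v] * f (e k))"
    unfolding linear_sum[OF assms(2)] linear_add[OF assms(2)] linear_scale[OF assms(2)] assms(3) scaleR_complex
    by (rule sum.cong) (simp_all add: complex_eq_iff)
  finally show ?thesis .
qed

lemma dual_frame_coframe:
  assumes "dual_frame J a e"
  shows "coframe J a"
  unfolding coframe_def
proof (intro conjI allI impI)
  show "form10 J (a i)" for i using assms by (rule dual_frame_form10)
  fix k :: "3 \<Rightarrow> complex" and j assume "\<forall>v. (\<Sum>i\<in>UNIV. k i * a i [v]) = 0"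
  then have "(\<Sum>i\<in>UNIV. k i * a i [e j]) = 0" by blast
  then show "k j = 0"
    by (simp add: dual_frame_eval[OF assms] if_distrib cong: if_cong)
qed

text \<open>The entries of g are the values of b on the dual frame of a. A vector killed by the
  transpose of g would be a linear relation among the forms of b, so g is invertible.\<close>

lemma coframe_change:
  assumes a: "dual_frame J a e" and b: "coframe J b"
  obtains g :: "complex^3^3" where "det g \<noteq> 0" "\<And>i v. b i [v] = (\<Sum>k\<in>UNIV. g $ i $ k * a k [v])"
proof -
  define g :: "complex^3^3" where "g = (\<chi> i k. b i [e k])"
  have b10: "form10 J (b i)" for i using b by (simp add: coframe_def)
  have bg: "b i [v] = (\<Sum>k\<in>UNIV. g $ i $ k * a k [v])" for i v
    using dual_frame_expansion[OF a form10_linear[OF b10] form10_J[OF b10], of i v]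
    by (simp add: g_def mult.commute)
  have "x = 0" if x: "transpose g *v x = 0" for x
  proof -
    have "(\<Sum>i\<in>UNIV. x $ i * b i [v]) = 0" for v
    proof -
      have "(\<Sum>i\<in>UNIV. x $ i * b i [v]) = (\<Sum>k\<in>UNIV. (transpose g *v x) $ k * a k [v])"
        unfolding bg by (simp add: sum_distrib_left sum_distrib_right transpose_def matrix_vector_mult_def mult_ac)
          (rule sum.swap)
      then show ?thesis using x by simp
    qed
    then have "x $ i = 0" for i using b unfolding coframe_def by blast
    then show "x = 0" by (simp add: vec_eq_iff)
  qed
  then have "invertible (transpose g)"
    using matrix_left_invertible_ker[of "transpose g"] invertible_left_inverse by blast
  then have "det g \<noteq> 0" by (simp add: invertible_det_nz)
  then show ?thesis using bg by (rule that)
qed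

lemma coframe_dual_frame:
  assumes a: "dual_frame J a e" and b: "coframe J b"
  shows "\<exists>f. dual_frame J b f"
proof -
  obtain g where g: "det g \<noteq> 0" and bg: "\<And>i v. b i [v] = (\<Sum>k\<in>UNIV. g $ i $ k * a k [v])"
    using coframe_change[OF assms] by metis
  obtain h where gh: "g ** h = mat 1" and hg: "h ** g = mat 1"
    using g by (metis invertible_det_nz invertible_def)
  have b10: "form10 J (b i)" for i using b by (simp add: coframe_def)
  note a10 = dual_frame_form10[OF a]
  \<comment> \<open>The old frame transformed by the inverse matrix h of g, with complex scalars
    acting through J.\<close>
  define f where "f k = (\<Sum>m\<in>UNIV. Re (h $ m $ k) *\<^sub>R e m + Im (h $ m $ k) *\<^sub>R (J *v e m))" for k
  have comb: "c [\<Sum>m\<in>UNIV. Re (z m) *\<^sub>R x m + Im (z m) *\<^sub>R (J *v x m)] = (\<Sum>m\<in>UNIV. z m * c [x m])"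
    if "form10 J c" for c and z :: "3 \<Rightarrow> complex" and x
    unfolding linear_sum[OF form10_linear[OF that]] linear_add[OF form10_linear[OF that]]
      linear_scale[OF form10_linear[OF that]] form10_J[OF that] scaleR_complex
    by (rule sum.cong) (simp_all add: complex_eq_iff)
  have af: "a i [f k] = h $ i $ k" for i k
    unfolding f_def comb[OF a10] dual_frame_eval[OF a] by (simp add: if_distrib cong: if_cong)
  have bf: "b i [f k] = (if i = k then 1 else 0)" for i k
    using gh unfolding bg af by (simp add: vec_eq_iff matrix_matrix_mult_def mat_def)
  have ah: "a i [v] = (\<Sum>k\<in>UNIV. h $ i $ k * b k [v])" for i v
  proof -
    have "(\<Sum>k\<in>UNIV. h $ i $ k * b k [v]) = (\<Sum>m\<in>UNIV. (h ** g) $ i $ m * a m [v])"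
      unfolding bg matrix_matrix_mult_def
      by (simp add: sum_distrib_left sum_distrib_right mult_ac) (rule sum.swap)
    then show ?thesis by (simp add: hg mat_def if_distrib[of "\<lambda>x. x * _"] cong: if_cong)
  qed
  have "v = (\<Sum>k\<in>UNIV. Re (b k [v]) *\<^sub>R f k + Im (b k [v]) *\<^sub>R (J *v f k))" (is "v = ?v") for v
  proof -
    have "b i [?v] = b i [v]" for i
      unfolding comb[OF b10] bf by (simp add: if_distrib cong: if_cong)
    then have *: "a i [?v] = a i [v]" for i by (simp add: ah)
    have "v = (\<Sum>k\<in>UNIV. Re (a k [v]) *\<^sub>R e k + Im (a k [v]) *\<^sub>R (J *v e k))" for v
      using a by (simp add: dual_frame_def)
    from this[of v] this[of ?v] show ?thesis unfolding * by metis
  qed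
  then show ?thesis using b10 bf unfolding dual_frame_def by blast
qed


section \<open>The matrix of the Nijenhuis tensor\<close>

definition pair_form :: "(3 \<Rightarrow> cform) \<Rightarrow> 3 \<Rightarrow> real^6 \<Rightarrow> real^6 \<Rightarrow> complex" where
  "pair_form a j u v = a (j + 1) [u] * a (j + 2) [v] - a (j + 1) [v] * a (j + 2) [u]"

text \<open>The defining equation of N(\<alpha>) at a point, once the (0,2)-part of d\<alpha> has
  been replaced by \<alpha>(T(u,v))/4. No derivative of the coframe is left in it.\<close>

definition nij_coeffs ::
  "(real^6 \<Rightarrow> real^6 \<Rightarrow> real^6) \<Rightarrow> (3 \<Rightarrow> cform) \<Rightarrow> complex^3^3 \<Rightarrow> bool" where
  "nij_coeffs T a n \<longleftrightarrow> (\<forall>i u v. a i [T u v] / 4 = (\<Sum>j\<in>UNIV. n $ i $ j * cnj (pair_form a j u v)))"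

definition nij_matrix ::
  "(real^6 \<Rightarrow> real^6 \<Rightarrow> real^6) \<Rightarrow> (3 \<Rightarrow> cform) \<Rightarrow> (3 \<Rightarrow> real^6) \<Rightarrow> complex^3^3" where
  "nij_matrix T a e = (\<chi> i j. a i [T (e (j + 1)) (e (j + 2))] / 4)"

lemma pair_form_dual:
  assumes "dual_frame J a e"
  shows "pair_form a j (e (m + 1)) (e (m + 2)) = (if j = m then 1 else 0)"
  using exhaust_3[of j] exhaust_3[of m]
  by (auto simp: pair_form_def dual_frame_eval[OF assms] add_3)

text \<open>Evaluation on pairs of frame vectors forces n. Conversely, the conjugate of
  \<alpha>(T(u,v)) is complex linear in each argument because T is conjugate-linear, so it is
  recovered from the pairs by \<open>dual_frame_expansion\<close>.\<close>

lemma nij_coeffs_iff: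
  assumes a: "dual_frame J a e" and T: "antibilinear J T"
  shows "nij_coeffs T a n \<longleftrightarrow> n = nij_matrix T a e"
proof
  assume n: "nij_coeffs T a n"
  have "nij_matrix T a e $ i $ j = n $ i $ j" for i j
    using n unfolding nij_coeffs_def nij_matrix_def
    by (simp add: pair_form_dual[OF a] if_distrib[of cnj] if_distrib[of "\<lambda>x. _ * x"] cong: if_cong)
  then show "n = nij_matrix T a e" by (simp add: vec_eq_iff)
next
  assume n: "n = nij_matrix T a e"
  have "a i [T u v] / 4 = (\<Sum>j\<in>UNIV. n $ i $ j * cnj (pair_form a j u v))" for i u v
  proof -
    note li = form10_linear[OF dual_frame_form10[OF a], of i]
    have anti: "T v u = - T u v" and lT: "linear (\<lambda>u. T u v)" and JT: "T (J *v u) v = - (J *v T u v)" for u v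
      using T unfolding antibilinear_def by blast+
    have neg: "a i [- x] = - a i [x]" for x using linear_neg[OF li] .
    have cl: "linear (\<lambda>u. cnj (a i [T u v]))" for v
      using lT[of v] li by (auto simp: linear_iff)
    have cJ: "cnj (a i [T (J *v u) v]) = \<i> * cnj (a i [T u v])" for u v
      by (simp add: JT neg form10_J[OF dual_frame_form10[OF a]])
    have 1: "cnj (a i [T u v]) = (\<Sum>k\<in>UNIV. a k [u] * cnj (a i [T (e k) v]))" for u v
      by (rule dual_frame_expansion[OF a cl cJ])
    have sw: "cnj (a i [T u v]) = - cnj (a i [T v u])" for u v
      by (simp add: anti[of u v] neg)
    have 2: "cnj (a i [T (e k) v]) = (\<Sum>l\<in>UNIV. a l [v] * cnj (a i [T (e k) (e l)]))" for k
      unfolding sw[of "e k"] using 1[of v "e k"] by (simp add: sum_negf)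
    have diag: "cnj (a i [T x x]) = 0" for x using sw[of x x] by simp
    have "cnj (a i [T u v] / 4) = cnj (\<Sum>j\<in>UNIV. n $ i $ j * cnj (pair_form a j u v))"
      unfolding n nij_matrix_def pair_form_def
      by (simp add: 1[of u v] 2 sum_3 add_3 diag sw[of "e 2" "e 1"] sw[of "e 3" "e 2"] sw[of "e 1" "e 3"] field_simps)
    then show ?thesis by (simp only: complex_cnj_cancel_iff)
  qed
  then show "nij_coeffs T a n" by (simp add: nij_coeffs_def)
qed

text \<open>The cofactor matrix of g; the cyclic indices modulo 3 absorb the checkerboard
  signs.\<close>

definition cof3 :: "complex^3^3 \<Rightarrow> complex^3^3" where
  "cof3 g = (\<chi> j m. g $ (j + 1) $ (m + 1) * g $ (j + 2) $ (m + 2) - g $ (j + 1) $ (m + 2) * g $ (j + 2) $ (m + 1))"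

lemma cof3_mult: "cof3 g ** transpose g = (\<chi> i j. if i = j then det g else 0)"
  unfolding vec_eq_iff forall_3
  by (simp add: cof3_def matrix_matrix_mult_def transpose_def sum_3 add_3 det_3 algebra_simps)

lemma pair_form_change:
  assumes "\<And>i v. b i [v] = (\<Sum>k\<in>UNIV. g $ i $ k * a k [v])"
  shows "pair_form b j u v = (\<Sum>m\<in>UNIV. cof3 g $ j $ m * pair_form a m u v)"
  using exhaust_3[of j]
  by (auto simp: pair_form_def assms cof3_def sum_3 add_3 algebra_simps)

text \<open>Evaluating both equations on the frame dual to a gives
  \<open>n' ** cnj_matrix (cof3 g) = g ** n\<close>; multiplying by the conjugate transpose of g
  turns the cofactor matrix into a scalar.\<close>

lemma nij_coeffs_change:
  assumes a: "dual_frame J a e" and bg: "\<And>i v. b i [v] = (\<Sum>k\<in>UNIV. g $ i $ k * a k [v])"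
    and n: "nij_coeffs T a n" and n': "nij_coeffs T b n'"
  shows "(\<chi> i j. cnj (det g) * n' $ i $ j) = g ** n ** cnj_matrix (transpose g)"
proof -
  have eq: "n' ** cnj_matrix (cof3 g) = g ** n"
  proof -
    have "(n' ** cnj_matrix (cof3 g)) $ i $ m = (g ** n) $ i $ m" for i m
    proof -
      have pf: "cnj (pair_form b j (e (m + 1)) (e (m + 2))) = cnj (cof3 g $ j $ m)" for j
        unfolding pair_form_change[where b=b and a=a and g=g, OF bg] pair_form_dual[OF a] by (simp add: if_distrib cong: if_cong)
      have "(n' ** cnj_matrix (cof3 g)) $ i $ m = b i [T (e (m + 1)) (e (m + 2))] / 4"
        using n' unfolding nij_coeffs_def by (simp add: pf matrix_matrix_mult_def cnj_matrix_def)
      also have "\<dots> = (\<Sum>k\<in>UNIV. g $ i $ k * (a k [T (e (m + 1)) (e (m + 2))] / 4))"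
        unfolding bg by (simp add: sum_divide_distrib)
      also have "\<dots> = (g ** n) $ i $ m"
        using n unfolding nij_coeffs_def
        by (simp add: pair_form_dual[OF a] matrix_matrix_mult_def if_distrib[of cnj]
            if_distrib[of "\<lambda>x. _ * x"] cong: if_cong)
      finally show ?thesis .
    qed
    then show ?thesis by (simp add: vec_eq_iff)
  qed
  have "cnj_matrix (cof3 g) ** cnj_matrix (transpose g) = cnj_matrix (cof3 g ** transpose g)"
    by (simp add: cnj_matrix_def matrix_matrix_mult_def vec_eq_iff)
  also have "\<dots> = (\<chi> i j. if i = j then cnj (det g) else 0)"
    unfolding cof3_mult cnj_matrix_def by (simp add: vec_eq_iff)
  finally have c: "cnj_matrix (cof3 g) ** cnj_matrix (transpose g) = (\<chi> i j. if i = j then cnj (det g) else 0)" .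
  have "g ** n ** cnj_matrix (transpose g) = n' ** (\<chi> i j. if i = j then cnj (det g) else 0)"
    unfolding eq[symmetric] by (simp add: matrix_mul_assoc[symmetric] c)
  also have "\<dots> = (\<chi> i j. cnj (det g) * n' $ i $ j)"
    by (simp add: matrix_matrix_mult_def vec_eq_iff if_distrib[of "\<lambda>x. _ * x"] mult.commute cong: if_cong)
  finally show ?thesis ..
qed

lemma cnj_matrix_mult: "cnj_matrix (A ** B) = cnj_matrix A ** cnj_matrix B"
  by (simp add: cnj_matrix_def matrix_matrix_mult_def vec_eq_iff)

lemma cnj_matrix_cnj_matrix: "cnj_matrix (cnj_matrix A) = A"
  by (simp add: cnj_matrix_def vec_eq_iff)

lemma transpose_cnj_matrix: "transpose (cnj_matrix A) = cnj_matrix (transpose A)"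
  by (simp add: cnj_matrix_def transpose_def)

lemma det_cnj_matrix: "det (cnj_matrix A) = cnj (det A)"
  by (simp add: cnj_matrix_def det_3)

definition P_nij :: "complex^3^3 \<Rightarrow> complex" where
  "P_nij n = sym_det (cnj_matrix n) (cnj_matrix n) (transpose n)"

lemma scaled_det: "det (\<chi> i j. k * A $ i $ j) = k ^ 3 * det (A :: complex^3^3)"
  by (simp add: det_3 power3_eq_cube algebra_simps)

text \<open>Taking determinants gives three factors \<open>cnj (det g)\<close> on the left and one
  on the right, and one of them cancels.\<close>

lemma nij_coeffs_change_det:
  assumes "det g \<noteq> 0" "(\<chi> i j. cnj (det g) * n' $ i $ j) = g ** n ** cnj_matrix (transpose g)"
  shows "cnj (det g) ^ 2 * det n' = det g * det n"
proof -
  have "cnj (det g) ^ 3 * det n' = det g * det n * cnj (det g)"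
    using arg_cong[OF assms(2), of det] unfolding scaled_det det_mul det_cnj_matrix det_transpose .
  then show ?thesis using assms(1) by (simp add: power3_eq_cube power2_eq_square mult.assoc)
qed

text \<open>Conjugating and transposing the law for N gives the same outer factors
  \<open>cnj_matrix g\<close> and \<open>transpose g\<close>, so \<open>sym_det_mult\<close> applies
  to the mixed arguments. The scalars then leave a single \<open>det g\<close>.\<close>

lemma nij_coeffs_change_P:
  assumes "det g \<noteq> 0" and n': "(\<chi> i j. cnj (det g) * n' $ i $ j) = g ** n ** cnj_matrix (transpose g)"
  shows "det g * P_nij n' = P_nij n"
proof -
  let ?d = "det g"
  have c: "(\<chi> i j. ?d * cnj_matrix n' $ i $ j) = cnj_matrix g ** cnj_matrix n ** transpose g"
    using arg_cong[OF n', of cnj_matrix] unfolding cnj_matrix_mult cnj_matrix_cnj_matrix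
    by (simp add: cnj_matrix_def)
  have t: "(\<chi> i j. cnj ?d * transpose n' $ i $ j) = cnj_matrix g ** transpose n ** transpose g"
    using arg_cong[OF n', of transpose]
    unfolding matrix_transpose_mul transpose_cnj_matrix transpose_transpose
    by (simp add: transpose_def matrix_mul_assoc)
  have "?d * ?d * cnj ?d * P_nij n' = cnj ?d * ?d * P_nij n"
    unfolding P_nij_def using sym_det_scale[of ?d "cnj_matrix n'" ?d "cnj_matrix n'" "cnj ?d" "transpose n'"]
    unfolding c t sym_det_mult det_cnj_matrix det_transpose by (rule sym)
  then have "(cnj ?d * ?d) * (?d * P_nij n') = (cnj ?d * ?d) * P_nij n"
    by (simp only: mult_ac)
  moreover have "cnj ?d * ?d \<noteq> 0" using assms(1) by simp
  ultimately show ?thesis by (metis mult_left_cancel)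
qed

section \<open>The invariant forms at a point\<close>

definition hol_vol :: "(3 \<Rightarrow> cform) \<Rightarrow> cform" where
  "hol_vol a = wedge1 [a 1, a 2, a 3]"

definition real_vol :: "(3 \<Rightarrow> cform) \<Rightarrow> cform" where
  "real_vol a = wedge1 [a 1, a 2, a 3, cnj_form (a 1), cnj_form (a 2), cnj_form (a 3)]"

lemma wedge_hol_vol: "wedge 3 3 (hol_vol a) (cnj_form (hol_vol a)) = real_vol a"
  by (simp add: hol_vol_def real_vol_def cnj_form_wedge1 wedge_wedge1)

lemma hol_vol_change:
  assumes "\<And>i v. b i [v] = (\<Sum>k\<in>UNIV. g $ i $ k * a k [v])"
  shows "hol_vol b = (\<lambda>vs. det g * hol_vol a vs)"
proof
  fix vs show "hol_vol b vs = det g * hol_vol a vs"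
  proof (cases "length vs = 3")
    case True
    then obtain u v w where "vs = [u, v, w]" by (auto simp: numeral_3_eq_3 length_Suc_conv)
    then show ?thesis
      by (simp add: hol_vol_def wedge1_3 assms sum_3 det_3 algebra_simps)
  qed (simp add: hol_vol_def wedge1_length)
qed

lemma cnj_form_scale: "cnj_form (\<lambda>vs. c * w vs) = (\<lambda>vs. cnj c * cnj_form w vs)"
  by (simp add: cnj_form_def)

lemma real_vol_change:
  assumes "\<And>i v. b i [v] = (\<Sum>k\<in>UNIV. g $ i $ k * a k [v])"
  shows "real_vol b = (\<lambda>vs. of_real ((cmod (det g))\<^sup>2) * real_vol a vs)"
  unfolding wedge_hol_vol[symmetric] hol_vol_change[of b g a, OF assms] cnj_form_scale wedge_scale
  by (simp add: complex_norm_square del: of_real_power)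

definition phi_pt :: "complex^3^3 \<Rightarrow> (3 \<Rightarrow> cform) \<Rightarrow> cform" where
  "phi_pt n a = (\<lambda>vs. \<i> / 8 * of_real ((cmod (det n))\<^sup>2) * real_vol a vs)"

definition psi_pt :: "complex^3^3 \<Rightarrow> (3 \<Rightarrow> cform) \<Rightarrow> cform" where
  "psi_pt n a = (\<lambda>vs. P_nij n * hol_vol a vs)"

text \<open>The squared modulus of det N changes by \<open>|det g|^-2\<close> and P by
  \<open>(det g)^-1\<close>, inverse to the factors picked up by the real and the holomorphic volume
  form.\<close>

theorem phi_psi_pt_invariant:
  assumes a: "dual_frame J a e" and b: "coframe J b"
    and n: "nij_coeffs T a n" and n': "nij_coeffs T b n'"
  shows "phi_pt n' b = phi_pt n a" "psi_pt n' b = psi_pt n a"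
proof -
  obtain g where g: "det g \<noteq> 0" and bg: "\<And>i v. b i [v] = (\<Sum>k\<in>UNIV. g $ i $ k * a k [v])"
    using coframe_change[OF a b] by metis
  note ch = nij_coeffs_change[of J a e b g T n n', OF a bg n n']
  have "cmod (cnj (det g) ^ 2 * det n') = cmod (det g * det n)"
    using nij_coeffs_change_det[OF g ch] by simp
  then have "cmod (det g) * cmod (det n') = cmod (det n)"
    using g by (simp add: norm_mult norm_power power2_eq_square)
  then have "(cmod (det n'))\<^sup>2 * (cmod (det g))\<^sup>2 = (cmod (det n))\<^sup>2"
    by (metis mult.commute power_mult_distrib)
  then have "complex_of_real ((cmod (det n'))\<^sup>2) * of_real ((cmod (det g))\<^sup>2) = of_real ((cmod (det n))\<^sup>2)"
    by (metis of_real_mult)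
  then show "phi_pt n' b = phi_pt n a"
    unfolding phi_pt_def real_vol_change[of b g a, OF bg] by (simp add: fun_eq_iff mult.assoc[symmetric])
  show "psi_pt n' b = psi_pt n a"
    unfolding psi_pt_def hol_vol_change[of b g a, OF bg] nij_coeffs_change_P[OF g ch, symmetric]
    by (simp add: fun_eq_iff)
qed

text \<open>With \<open>n\<close> in place of \<open>N(\<alpha>)\<close>, this is the coefficient of the integrand with respect to
  \<open>i/8\<close> times the real volume form of the coframe \<open>\<alpha>\<close>.\<close>

definition kappa :: "real \<Rightarrow> real \<Rightarrow> complex^3^3 \<Rightarrow> real" where
  "kappa c1 c2 n = c1 * (cmod (det n))\<^sup>2 + c2 * (cmod (P_nij n))\<^sup>2"

text \<open>Both terms are multiples of i/8 times the same volume form, as the product of psi with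
  its conjugate contributes the squared modulus of P.\<close>

lemma integrand_pt:
  "(\<lambda>vs. of_real c1 * phi_pt n a vs + of_real c2 * (\<i> / 8) * wedge 3 3 (psi_pt n a) (cnj_form (psi_pt n a)) vs) =
   (\<lambda>vs. \<i> / 8 * of_real (kappa c1 c2 n) * real_vol a vs)"
  unfolding phi_pt_def psi_pt_def cnj_form_scale wedge_scale wedge_hol_vol kappa_def
  by (simp add: fun_eq_iff complex_norm_square[symmetric] algebra_simps)


subsection \<open>Frames and their adjugate coframes\<close>

definition frame_matrix :: "real^6^6 \<Rightarrow> (3 \<Rightarrow> real^6) \<Rightarrow> real^6^6" where
  "frame_matrix J e = vector [e 1, J *v e 1, e 2, J *v e 2, e 3, J *v e 3]"

definition re_row :: "3 \<Rightarrow> 6" where "re_row k = (if k = 1 then 1 else if k = 2 then 3 else 5)"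

definition im_row :: "3 \<Rightarrow> 6" where "im_row k = (if k = 1 then 2 else if k = 2 then 4 else 6)"

lemma frame_matrix_rows:
  "frame_matrix J e $ re_row k = e k" "frame_matrix J e $ im_row k = J *v e k"
  using exhaust_3[of k] by (auto simp: frame_matrix_def re_row_def im_row_def vector_6)

lemma re_im_row_inj:
  "re_row j = re_row k \<longleftrightarrow> j = k" "im_row j = im_row k \<longleftrightarrow> j = k"
  "re_row j \<noteq> im_row k" "im_row k \<noteq> re_row j"
  using exhaust_3[of j] exhaust_3[of k] by (auto simp: re_row_def im_row_def)

definition replace_row :: "6 \<Rightarrow> real^6^6 \<Rightarrow> real^6 \<Rightarrow> real^6^6" where
  "replace_row s F v = (\<chi> r. if r = s then v else F $ r)"

lemma linear_det_replace_row: "linear (\<lambda>v. det (replace_row s F v))"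
proof (rule linearI)
  show "det (replace_row s F (v + w)) = det (replace_row s F v) + det (replace_row s F w)" for v w
    unfolding replace_row_def by (rule det_row_add)
  show "det (replace_row s F (c *\<^sub>R v)) = c *\<^sub>R det (replace_row s F v)" for c v
    unfolding replace_row_def scalar_mult_eq_scaleR[symmetric] by (simp add: det_row_mul)
qed

lemma det_replace_row: "det (replace_row s F (F $ r)) = (if r = s then det F else 0)"
proof (cases "r = s")
  case True
  then have "replace_row s F (F $ r) = F" by (simp add: replace_row_def vec_eq_iff)
  then show ?thesis using True by simp
next
  case False
  then have "row r (replace_row s F (F $ r)) = row s (replace_row s F (F $ r))"
    by (simp add: replace_row_def row_def vec_eq_iff)
  then show ?thesis using False det_identical_rows[of r s] by auto
qed

text \<open>By Cramer's rule, these are \<open>det (frame_matrix J e)\<close> times the coframe dual to \<open>e\<close>; unlike the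
  dual coframe they depend polynomially on \<open>J\<close>.\<close>

definition adj_coframe :: "real^6^6 \<Rightarrow> (3 \<Rightarrow> real^6) \<Rightarrow> 3 \<Rightarrow> cform" where
  "adj_coframe J e k = (\<lambda>vs. if length vs = 1 then
     of_real (det (replace_row (re_row k) (frame_matrix J e) (hd vs))) +
     \<i> * of_real (det (replace_row (im_row k) (frame_matrix J e) (hd vs))) else 0)"

lemma linear_adj_coframe: "linear (\<lambda>v. adj_coframe J e k [v])"
  unfolding adj_coframe_def
  using linear_det_replace_row[of "re_row k" "frame_matrix J e"] linear_det_replace_row[of "im_row k" "frame_matrix J e"]
  by (auto simp: linear_iff scaleR_complex algebra_simps)

lemma adj_coframe_eval:
  "adj_coframe J e k [e j] = (if k = j then of_real (det (frame_matrix J e)) else 0)"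
  "adj_coframe J e k [J *v e j] = (if k = j then \<i> * of_real (det (frame_matrix J e)) else 0)"
  using det_replace_row[of _ "frame_matrix J e" "re_row j"] det_replace_row[of _ "frame_matrix J e" "im_row j"]
  by (auto simp: adj_coframe_def frame_matrix_rows re_im_row_inj)

lemma sum_6: "sum f (UNIV :: 6 set) = f 1 + f 2 + f 3 + f 4 + f 5 + f 6"
  unfolding UNIV_6 by (simp add: add.assoc)

lemma frame_expansion:
  assumes "det (frame_matrix J e) \<noteq> 0"
  obtains x y where "v = (\<Sum>k\<in>UNIV. x k *\<^sub>R e k + y k *\<^sub>R (J *v e k))"
proof -
  let ?F = "frame_matrix J e"
  obtain B where B: "B ** ?F = mat 1"
    using assms by (metis invertible_det_nz invertible_def)
  define c where "c = v v* B"
  have "v = c v* ?F" unfolding c_def vector_matrix_mul_assoc B by simp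
  also have "\<dots> = (\<Sum>r\<in>UNIV. c $ r *\<^sub>R ?F $ r)"
    by (simp add: vector_matrix_mult_def vec_eq_iff mult.commute)
  also have "\<dots> = (\<Sum>k\<in>UNIV. c $ re_row k *\<^sub>R e k + c $ im_row k *\<^sub>R (J *v e k))"
    by (simp add: sum_6 sum_3 re_row_def im_row_def frame_matrix_def vector_6)
  finally show ?thesis by (rule that)
qed

lemma form10_adj_coframe:
  assumes J: "J ** J = - mat 1" and F: "det (frame_matrix J e) \<noteq> 0"
  shows "form10 J (adj_coframe J e k)"
  unfolding form10_def
proof (intro conjI allI kform_1I linear_adj_coframe)
  show "adj_coframe J e k vs = 0" if "length vs \<noteq> 1" for vs
    using that by (simp add: adj_coframe_def)
  fix v
  obtain x y where v: "v = (\<Sum>k\<in>UNIV. x k *\<^sub>R e k + y k *\<^sub>R (J *v e k))"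
    by (rule frame_expansion[OF F])
  note l = linear_adj_coframe[of J e k]
  have Jv: "J *v v = (\<Sum>k\<in>UNIV. x k *\<^sub>R (J *v e k) - y k *\<^sub>R e k)"
    unfolding v by (simp add: linear_sum[OF matrix_vector_mul_linear] matrix_vector_right_distrib
        matrix_vector_mult_scaleR matrix_vector_J_J[OF J])
  show "adj_coframe J e k [J *v v] = \<i> * adj_coframe J e k [v]"
    unfolding Jv unfolding v linear_sum[OF l] linear_add[OF l] linear_diff[OF l] linear_scale[OF l]
      adj_coframe_eval scaleR_complex sum_distrib_left
    by (rule sum.cong) (simp_all add: algebra_simps)
qed

lemma coframe_adj_coframe:
  assumes J: "J ** J = - mat 1" and F: "det (frame_matrix J e) \<noteq> 0"
  shows "coframe J (adj_coframe J e)"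
  unfolding coframe_def
proof (intro conjI allI impI)
  show "form10 J (adj_coframe J e i)" for i using assms by (rule form10_adj_coframe)
  fix k :: "3 \<Rightarrow> complex" and j assume "\<forall>v. (\<Sum>i\<in>UNIV. k i * adj_coframe J e i [v]) = 0"
  then have "(\<Sum>i\<in>UNIV. k i * adj_coframe J e i [e j]) = 0" by blast
  then show "k j = 0"
    using F by (simp add: adj_coframe_eval if_distrib cong: if_cong)
qed

definition dual_coframe :: "real^6^6 \<Rightarrow> (3 \<Rightarrow> real^6) \<Rightarrow> 3 \<Rightarrow> cform" where
  "dual_coframe J e k = (\<lambda>vs. inverse (of_real (det (frame_matrix J e))) * adj_coframe J e k vs)"

lemma dual_frame_dual_coframe:
  assumes J: "J ** J = - mat 1" and F: "det (frame_matrix J e) \<noteq> 0"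
  shows "dual_frame J (dual_coframe J e) e"
  unfolding dual_frame_def
proof (intro conjI allI)
  note f = form10_adj_coframe[OF assms]
  show f10: "form10 J (dual_coframe J e i)" for i
    using f[of i] kform_scale by (simp add: form10_def dual_coframe_def)
  show ev: "dual_coframe J e i [e k] = (if i = k then 1 else 0)" for i k
    using F by (simp add: dual_coframe_def adj_coframe_eval)
  fix v
  obtain x y where v: "v = (\<Sum>k\<in>UNIV. x k *\<^sub>R e k + y k *\<^sub>R (J *v e k))"
    by (rule frame_expansion[OF F])
  have "dual_coframe J e i [v] = of_real (x i) + \<i> * of_real (y i)" for i
    unfolding v linear_sum[OF form10_linear[OF f10]] linear_add[OF form10_linear[OF f10]]
      linear_scale[OF form10_linear[OF f10]] form10_J[OF f10] ev scaleR_complex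
    by (simp add: if_distrib sum.distrib cong: if_cong)
  then show "v = (\<Sum>k\<in>UNIV. Re (dual_coframe J e k [v]) *\<^sub>R e k + Im (dual_coframe J e k [v]) *\<^sub>R (J *v e k))"
    by (simp add: v[symmetric])
qed

lemma linear_cnj_form: "linear (\<lambda>v. a [v]) \<Longrightarrow> linear (\<lambda>v. cnj_form a [v])"
  by (auto simp: linear_iff cnj_form_def)

lemma real_vol_linear:
  assumes "coframe J a"
  shows "x \<in> set [a 1, a 2, a 3, cnj_form (a 1), cnj_form (a 2), cnj_form (a 3)] \<Longrightarrow> linear (\<lambda>v. x [v])"
  using assms form10_linear linear_cnj_form unfolding coframe_def by auto

lemma real_vol_eq_density:
  assumes "coframe J a" "length vs = 6"
  shows "real_vol a vs = density (real_vol a) * of_real (det (vector vs :: real^6^6))"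
  unfolding real_vol_def by (rule wedge1_eq_density) (use real_vol_linear[OF assms(1)] assms(2) in auto)

text \<open>On the basis e 1, J e 1, ..., e 3, J e 3 the real and imaginary parts of the coframe are
  dual, so \<open>real_vol a\<close> takes there the constant of \<open>wedge1_real_parts\<close>.
  The determinant converts this to the standard basis.\<close>

lemma density_real_vol:
  assumes "dual_frame J a e"
  shows "density (real_vol a) * of_real (det (frame_matrix J e)) = - 8 * \<i>"
proof -
  let ?es = "[e 1, J *v e 1, e 2, J *v e 2, e 3, J *v e 3]"
  let ?as = "[Re_form (a 1), Im_form (a 1), Re_form (a 2), Im_form (a 2), Re_form (a 3), Im_form (a 3)]"
  have "wedge1 ?as ?es = 1"
  proof (rule wedge1_dual_basis)
    fix m n :: nat assume "m < 6" "n < 6"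
    then have "m \<in> {0,1,2,3,4,5}" "n \<in> {0,1,2,3,4,5}" by auto
    then show "(?as ! m) [?es ! n] = (if m = n then 1 else 0)"
      by (auto simp: Re_form_def Im_form_def form10_J[OF dual_frame_form10[OF assms]]
          dual_frame_eval[OF assms] numeral_eq_Suc)
  qed simp_all
  then have "real_vol a ?es = - 8 * \<i>"
    unfolding real_vol_def wedge1_real_parts by simp
  then show ?thesis
    using real_vol_eq_density[OF dual_frame_coframe[OF assms], of ?es] by (simp add: frame_matrix_def)
qed


subsection \<open>Rational formulas for the invariant forms\<close>

text \<open>In general this is not N of the adjugate coframe, since e is not dual to that coframe.
  It is the frame determinant times N of the dual coframe.\<close>

definition nij_numerator :: "real^6^6 \<Rightarrow> (real^6 \<Rightarrow> real^6 \<Rightarrow> real^6) \<Rightarrow> (3 \<Rightarrow> real^6) \<Rightarrow> complex^3^3" where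
  "nij_numerator J T e = nij_matrix T (adj_coframe J e) e"

lemma nij_matrix_dual_coframe:
  "nij_matrix T (dual_coframe J e) e =
     (\<chi> i j. inverse (of_real (det (frame_matrix J e))) * nij_numerator J T e $ i $ j)"
  by (simp add: nij_matrix_def nij_numerator_def dual_coframe_def)

lemma P_nij_scale: "P_nij (\<chi> i j. of_real r * n $ i $ j) = of_real r ^ 3 * P_nij n"
proof -
  have "cnj_matrix (\<chi> i j. of_real r * n $ i $ j) = (\<chi> i j. of_real r * cnj_matrix n $ i $ j)"
    "transpose (\<chi> i j. of_real r * n $ i $ j) = (\<chi> i j. of_real r * transpose n $ i $ j)"
    by (simp_all add: cnj_matrix_def transpose_def vec_eq_iff)
  then show ?thesis unfolding P_nij_def by (simp add: sym_det_scale power3_eq_cube)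
qed

lemma kappa_scale: "kappa c1 c2 (\<chi> i j. of_real r * n $ i $ j) = r ^ 6 * kappa c1 c2 n"
proof -
  have "(cmod (of_real r ^ 3 * z))\<^sup>2 = r ^ 6 * (cmod z)\<^sup>2" for z
    by (simp add: norm_mult norm_power power_mult_distrib power_mult[symmetric])
  then show ?thesis
    unfolding kappa_def P_nij_scale scaled_det by (simp add: algebra_simps)
qed

text \<open>Rescaling to the dual coframe costs the determinant to the power -6 in
  \<open>kappa\<close> and -1 in the volume, so the eighth power leaves one factor. If the
  determinant is 0, both sides vanish, and the identity can be summed over all frames.\<close>

lemma det_integrand_pt:
  assumes J: "J ** J = - mat 1" and T: "antibilinear J T" and b: "coframe J b" and n: "nij_coeffs T b n"
  shows "of_real (det (frame_matrix J e)) ^ 8 * density (\<lambda>vs. \<i> / 8 * of_real (kappa c1 c2 n) * real_vol b vs) =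
    of_real (det (frame_matrix J e) * kappa c1 c2 (nij_numerator J T e))"
proof (cases "det (frame_matrix J e) = 0")
  case False
  define d where "d = det (frame_matrix J e)"
  have d: "d \<noteq> 0" using False by (simp add: d_def)
  let ?a = "dual_coframe J e" and ?m = "nij_matrix T (dual_coframe J e) e"
  note a = dual_frame_dual_coframe[OF J False]
  have m: "nij_coeffs T ?a ?m" using nij_coeffs_iff[OF a T] by simp
  have "(\<lambda>vs. \<i> / 8 * of_real (kappa c1 c2 n) * real_vol b vs) =
      (\<lambda>vs. \<i> / 8 * of_real (kappa c1 c2 ?m) * real_vol ?a vs)"
    unfolding integrand_pt[symmetric] phi_psi_pt_invariant[OF a b m n] ..
  moreover have "kappa c1 c2 ?m = inverse d ^ 6 * kappa c1 c2 (nij_numerator J T e)"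
    unfolding nij_matrix_dual_coframe d_def[symmetric]
    using kappa_scale[of c1 c2 "inverse d" "nij_numerator J T e"] by simp
  moreover have "density (real_vol ?a) = - 8 * \<i> / of_real d"
    using density_real_vol[OF a] d by (simp add: d_def field_simps)
  ultimately show ?thesis
    using d unfolding d_def[symmetric] by (simp add: density_def field_simps power_numeral_reduce)
qed simp

text \<open>Here P and the holomorphic volume each contribute the determinant to the power -3, so
  two factors remain.\<close>

lemma det_psi_pt:
  assumes J: "J ** J = - mat 1" and T: "antibilinear J T" and b: "coframe J b" and n: "nij_coeffs T b n"
  shows "of_real (det (frame_matrix J e)) ^ 8 * psi_pt n b vs =
    of_real (det (frame_matrix J e)) ^ 2 * psi_pt (nij_numerator J T e) (adj_coframe J e) vs"
proof (cases "det (frame_matrix J e) = 0")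
  case False
  define d where "d = det (frame_matrix J e)"
  have d: "d \<noteq> 0" using False by (simp add: d_def)
  let ?a = "dual_coframe J e" and ?m = "nij_matrix T (dual_coframe J e) e"
  note a = dual_frame_dual_coframe[OF J False]
  have m: "nij_coeffs T ?a ?m" using nij_coeffs_iff[OF a T] by simp
  have "P_nij ?m = of_real (inverse d) ^ 3 * P_nij (nij_numerator J T e)"
    unfolding nij_matrix_dual_coframe d_def[symmetric]
    using P_nij_scale[of "inverse d" "nij_numerator J T e"] by simp
  moreover have "hol_vol ?a = (\<lambda>vs. det (mat (inverse (of_real d)) :: complex^3^3) * hol_vol (adj_coframe J e) vs)"
    by (rule hol_vol_change)
      (simp add: dual_coframe_def d_def mat_def if_distrib[of "\<lambda>x. x * _"] cong: if_cong)
  then have "hol_vol ?a vs = of_real (inverse d) ^ 3 * hol_vol (adj_coframe J e) vs"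
    by (simp add: det_3 mat_def power3_eq_cube)
  ultimately have "psi_pt n b vs = of_real (inverse d) ^ 6 * psi_pt (nij_numerator J T e) (adj_coframe J e) vs"
    unfolding phi_psi_pt_invariant(2)[OF a b m n] unfolding psi_pt_def by (simp add: power_numeral_reduce)
  then show ?thesis
    using d unfolding d_def[symmetric] by (simp add: field_simps power_numeral_reduce)
qed simp

text \<open>Indexing by all functions from \<open>3\<close> to \<open>6\<close> gives a finite
  family independent of J, over which formulas can be summed.\<close>

definition axis_frame :: "(3 \<Rightarrow> 6) \<Rightarrow> 3 \<Rightarrow> real^6" where
  "axis_frame I k = axis (I k) 1"

text \<open>Multiplying xe + yJe by the conjugate scalar x - iy gives (x*x + y*y)e, which would lie
  in V.\<close>

lemma complex_independent:
  fixes V :: "(real^6) set"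
  assumes J: "J ** J = - mat 1" and V: "subspace V" "\<And>v. v \<in> V \<Longrightarrow> J *v v \<in> V"
    and e: "e \<notin> V" and s: "s + x *\<^sub>R e + y *\<^sub>R (J *v e) = 0" "s \<in> V"
  shows "x = 0 \<and> y = 0"
proof -
  define w where "w = x *\<^sub>R e + y *\<^sub>R (J *v e)"
  have "w = - s"
    using s(1) unfolding w_def add.assoc by (simp add: eq_neg_iff_add_eq_0 add.commute)
  then have w: "w \<in> V"
    using subspace_neg[OF V(1) s(2)] by simp
  have "x *\<^sub>R w - y *\<^sub>R (J *v w) = (x * x + y * y) *\<^sub>R e"
    by (simp add: w_def matrix_vector_right_distrib matrix_vector_mult_scaleR matrix_vector_J_J[OF J] algebra_simps)
  moreover have "x *\<^sub>R w - y *\<^sub>R (J *v w) \<in> V"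
    using w V by (intro subspace_diff subspace_scale) auto
  ultimately have "(x * x + y * y) *\<^sub>R e \<in> V" by simp
  moreover have "e \<in> V" if "r *\<^sub>R e \<in> V" "r \<noteq> 0" for r
    using subspace_scale[OF V(1) that(1), of "inverse r"] that(2) by simp
  ultimately have "x * x + y * y = 0" using e by blast
  then show ?thesis by (simp add: sum_squares_eq_zero_iff)
qed

lemma exists_axis_notin:
  fixes V :: "(real^6) set"
  assumes "subspace V" "dim V < 6"
  shows "\<exists>i. axis i 1 \<notin> V"
proof (rule ccontr)
  assume "\<not> ?thesis"
  then have "v \<in> V" for v
    using basis_expansion[of v] assms(1)
    by (metis (no_types, lifting) scalar_mult_eq_scaleR subspace_scale subspace_sum)
  then have "V = UNIV" by auto
  then show False using assms(2) by simp
qed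

text \<open>Greedy choice: the complex span of at most two vectors has real dimension at most 4, so
  it misses some coordinate vector.\<close>

lemma exists_axis_frame:
  assumes J: "J ** J = - mat 1"
  shows "\<exists>I. det (frame_matrix J (axis_frame I)) \<noteq> 0"
proof -
  define V where "V S = span (S \<union> (*v) J ` S)" for S :: "(real^6) set"
  have V: "subspace (V S)" for S by (simp add: V_def)
  have JV: "J *v v \<in> V S" if "v \<in> V S" for S v
    using that unfolding V_def
  proof (induction rule: span_induct_alt)
    case base
    then show ?case by (simp add: span_zero)
  next
    case (step c x y)
    have "J *v x \<in> span (S \<union> (*v) J ` S)"
    proof (cases "x \<in> S")
      case True
      then show ?thesis by (intro span_base) auto
    next
      case False
      then obtain z where "z \<in> S" "x = J *v z" using step(1) by auto
      then have "z \<in> span (S \<union> (*v) J ` S)" by (intro span_base) auto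
      then show ?thesis unfolding \<open>x = J *v z\<close> matrix_vector_J_J[OF J] by (rule span_neg)
    qed
    then show ?case
      using step(2) by (simp add: matrix_vector_right_distrib matrix_vector_mult_scaleR span_add span_scale)
  qed
  have dimV: "dim (V S) < 6" if "finite S" "card S \<le> 2" for S
  proof -
    have "dim (V S) \<le> card (S \<union> (*v) J ` S)"
      unfolding V_def dim_span using that by (intro dim_le_card') auto
    also have "\<dots> \<le> card S + card ((*v) J ` S)" by (rule card_Un_le)
    also have "\<dots> \<le> 4" using that card_image_le[OF that(1), of "(*v) J"] by simp
    finally show ?thesis by simp
  qed
  have inV: "x *\<^sub>R e + y *\<^sub>R (J *v e) \<in> V S" if "e \<in> S" for e x y S
    unfolding V_def using that by (intro span_add span_scale span_base) auto
  obtain i1 where i1: "axis i1 1 \<notin> V {}" using exists_axis_notin[OF V dimV, of "{}"] by auto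
  obtain i2 where i2: "axis i2 1 \<notin> V {axis i1 1}"
    using exists_axis_notin[OF V dimV, of "{axis i1 1}"] by auto
  obtain i3 where i3: "axis i3 1 \<notin> V {axis i1 1, axis i2 1}"
    using exists_axis_notin[OF V dimV, of "{axis i1 1, axis i2 1}"]
      card_insert_le_m1[of 2 "{axis i2 (1::real)}" "axis i1 1"] by auto
  define I :: "3 \<Rightarrow> 6" where "I k = (if k = 1 then i1 else if k = 2 then i2 else i3)" for k
  let ?e = "axis_frame I" let ?F = "frame_matrix J ?e"
  have e: "?e 1 = axis i1 1" "?e 2 = axis i2 1" "?e 3 = axis i3 1" by (simp_all add: axis_frame_def I_def)
  have "c = 0" if c: "transpose ?F *v c = 0" for c
  proof -
    let ?t = "\<lambda>k. c $ re_row k *\<^sub>R ?e k + c $ im_row k *\<^sub>R (J *v ?e k)"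
    have "(\<Sum>r\<in>UNIV. c $ r *\<^sub>R ?F $ r) = 0"
      using c by (simp add: vector_matrix_mult_def vec_eq_iff mult.commute)
    then have sum: "?t 1 + ?t 2 + ?t 3 = 0"
      by (simp add: sum_6 re_row_def im_row_def frame_matrix_def vector_6 add.assoc)
    have "?t 1 + ?t 2 \<in> V {axis i1 1, axis i2 1}"
      unfolding e by (intro subspace_add V inV) auto
    from complex_independent[OF J V JV i3 _ this] sum
    have 3: "c $ re_row 3 = 0 \<and> c $ im_row 3 = 0" by (simp add: e add.assoc)
    have "?t 1 \<in> V {axis i1 1}" unfolding e by (intro inV) auto
    from complex_independent[OF J V JV i2 _ this] sum 3
    have 2: "c $ re_row 2 = 0 \<and> c $ im_row 2 = 0" by (simp add: e add.assoc)
    have "0 \<in> V {}" using V by (rule subspace_0)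
    from complex_independent[OF J V JV i1 _ this] sum 2 3
    have 1: "c $ re_row 1 = 0 \<and> c $ im_row 1 = 0" by (simp add: e)
    have "c $ r = 0" for r
      using 1 2 3 exhaust_6[of r] by (auto simp: re_row_def im_row_def)
    then show "c = 0" by (simp add: vec_eq_iff)
  qed
  then have "invertible (transpose ?F)"
    using matrix_left_invertible_ker[of "transpose ?F"] invertible_left_inverse by blast
  then have "det ?F \<noteq> 0" by (simp add: invertible_det_nz)
  then show ?thesis by blast
qed

text \<open>The eighth powers of the determinants act as weights that glue the formulas for the
  individual frames, each valid only where its determinant does not vanish, into one formula with
  coefficients smooth near all complex structures.\<close>

definition frame_weight :: "real^6^6 \<Rightarrow> real" where
  "frame_weight J = (\<Sum>I\<in>UNIV. det (frame_matrix J (axis_frame I)) ^ 8)"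

lemma frame_weight_pos: "J ** J = - mat 1 \<Longrightarrow> frame_weight J > 0"
proof -
  assume "J ** J = - mat 1"
  then obtain I where "det (frame_matrix J (axis_frame I)) \<noteq> 0" using exists_axis_frame by blast
  then have "0 < det (frame_matrix J (axis_frame I)) ^ 8" by (simp add: zero_less_power_eq)
  then show ?thesis unfolding frame_weight_def by (intro sum_pos2[of _ I]) auto
qed

theorem density_integrand_pt:
  assumes J: "J ** J = - mat 1" and T: "antibilinear J T" and b: "coframe J b" and n: "nij_coeffs T b n"
  shows "density (\<lambda>vs. \<i> / 8 * of_real (kappa c1 c2 n) * real_vol b vs) =
    of_real ((\<Sum>I\<in>UNIV. det (frame_matrix J (axis_frame I)) * kappa c1 c2 (nij_numerator J T (axis_frame I)))
      / frame_weight J)"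
proof -
  let ?w = "density (\<lambda>vs. \<i> / 8 * of_real (kappa c1 c2 n) * real_vol b vs)"
  have "of_real (frame_weight J) * ?w =
      (\<Sum>I\<in>UNIV. of_real (det (frame_matrix J (axis_frame I))) ^ 8 * ?w)"
    by (simp add: frame_weight_def sum_distrib_right)
  also have "\<dots> = of_real (\<Sum>I\<in>UNIV. det (frame_matrix J (axis_frame I)) * kappa c1 c2 (nij_numerator J T (axis_frame I)))"
    unfolding det_integrand_pt[OF assms] by simp
  finally show ?thesis using frame_weight_pos[OF J] by (simp add: field_simps)
qed

theorem psi_pt_formula:
  assumes J: "J ** J = - mat 1" and T: "antibilinear J T" and b: "coframe J b" and n: "nij_coeffs T b n"
  shows "psi_pt n b vs = (\<Sum>I\<in>UNIV. of_real (det (frame_matrix J (axis_frame I))) ^ 2 *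
      psi_pt (nij_numerator J T (axis_frame I)) (adj_coframe J (axis_frame I)) vs) * of_real (inverse (frame_weight J))"
proof -
  have "of_real (frame_weight J) * psi_pt n b vs =
      (\<Sum>I\<in>UNIV. of_real (det (frame_matrix J (axis_frame I))) ^ 8 * psi_pt n b vs)"
    by (simp add: frame_weight_def sum_distrib_right)
  then show ?thesis
    unfolding det_psi_pt[OF assms] using frame_weight_pos[OF J] by (simp add: field_simps)
qed

lemma exists_coframe: "J ** J = - mat 1 \<Longrightarrow> \<exists>a e. dual_frame J a e"
  using exists_axis_frame dual_frame_dual_coframe by blast

lemma nij_coeffs_unique:
  assumes J: "J ** J = - mat 1" and T: "antibilinear J T" and b: "coframe J b"
  shows "\<exists>!n. nij_coeffs T b n"
proof -
  obtain a e where "dual_frame J a e" using exists_coframe[OF J] by blast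
  then obtain f where f: "dual_frame J b f" using coframe_dual_frame b by blast
  show ?thesis unfolding nij_coeffs_iff[OF f T] by simp
qed

theorem phi_psi_pt_unique:
  assumes J: "J ** J = - mat 1" and T: "antibilinear J T" and a: "coframe J a" and b: "coframe J b"
    and n: "nij_coeffs T a n" and m: "nij_coeffs T b m"
  shows "phi_pt m b = phi_pt n a" "psi_pt m b = psi_pt n a"
proof -
  obtain e where e: "dual_frame J a e" using exists_coframe[OF J] coframe_dual_frame a by blast
  show "phi_pt m b = phi_pt n a" "psi_pt m b = psi_pt n a"
    using phi_psi_pt_invariant[OF e b n m] by blast+
qed

section \<open>Naturality\<close>

definition pull_coframe :: "real^6^6 \<Rightarrow> (3 \<Rightarrow> cform) \<Rightarrow> 3 \<Rightarrow> cform" where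
  "pull_coframe M a i = (\<lambda>vs. a i (map ((*v) M) vs))"

lemma coframe_pull_coframe:
  assumes M: "invertible M" "M ** J1 = J2 ** M" and a: "coframe J2 a"
  shows "coframe J1 (pull_coframe M a)"
  unfolding coframe_def form10_def
proof (intro conjI allI impI kform_1I)
  fix i
  have f: "form10 J2 (a i)" using a by (simp add: coframe_def)
  then show "pull_coframe M a i vs = 0" if "length vs \<noteq> 1" for vs
    using that by (simp add: pull_coframe_def form10_def kform_def)
  show "linear (\<lambda>v. pull_coframe M a i [v])"
    using linear_compose[OF matrix_vector_mul_linear form10_linear[OF f], of M]
    by (simp add: pull_coframe_def o_def)
  show "pull_coframe M a i [J1 *v v] = \<i> * pull_coframe M a i [v]" for v
    using form10_J[OF f, of "M *v v"] M(2)
    by (simp add: pull_coframe_def matrix_vector_mul_assoc)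
next
  fix k :: "3 \<Rightarrow> complex" and i assume k: "\<forall>v. (\<Sum>i\<in>UNIV. k i * pull_coframe M a i [v]) = 0"
  obtain B where B: "M ** B = mat 1" using M(1) by (auto simp: invertible_def)
  have "(\<Sum>i\<in>UNIV. k i * a i [w]) = 0" for w
    using k[rule_format, of "B *v w"] by (simp add: pull_coframe_def matrix_vector_mul_assoc B)
  then show "k i = 0" using a unfolding coframe_def by blast
qed

text \<open>The same matrix n serves both sides: N does not feel coordinates when the coframe is
  pulled back along with T.\<close>

lemma nij_coeffs_pull_coframe:
  assumes "\<And>u v. T2 (M *v u) (M *v v) = M *v T1 u v" "nij_coeffs T2 a n"
  shows "nij_coeffs T1 (pull_coframe M a) n"
  unfolding nij_coeffs_def
proof (intro allI)
  fix i u v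
  have "a i [T2 (M *v u) (M *v v)] / 4 = (\<Sum>j\<in>UNIV. n $ i $ j * cnj (pair_form a j (M *v u) (M *v v)))"
    using assms(2) unfolding nij_coeffs_def by blast
  then show "pull_coframe M a i [T1 u v] / 4 =
      (\<Sum>j\<in>UNIV. n $ i $ j * cnj (pair_form (pull_coframe M a) j u v))"
    by (simp add: assms(1) pull_coframe_def pair_form_def)
qed

lemma hol_vol_pull_coframe: "hol_vol (pull_coframe M a) vs = hol_vol a (map ((*v) M) vs)"
proof (cases "length vs = 3")
  case True
  have "([pull_coframe M a 1, pull_coframe M a 2, pull_coframe M a 3] ! i) [v] = ([a 1, a 2, a 3] ! i) [M *v v]"
    if "i < 3" for i v
    using that by (auto simp: pull_coframe_def less_Suc_eq numeral_3_eq_3)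
  then show ?thesis unfolding hol_vol_def using True by (intro wedge1_map_arg) auto
qed (simp add: hol_vol_def wedge1_length)

lemma real_vol_pull_coframe: "real_vol (pull_coframe M a) vs = real_vol a (map ((*v) M) vs)"
proof (cases "length vs = 6")
  case True
  have "([pull_coframe M a 1, pull_coframe M a 2, pull_coframe M a 3,
      cnj_form (pull_coframe M a 1), cnj_form (pull_coframe M a 2), cnj_form (pull_coframe M a 3)] ! i) [v] =
     ([a 1, a 2, a 3, cnj_form (a 1), cnj_form (a 2), cnj_form (a 3)] ! i) [M *v v]"
    if "i < 6" for i v
  proof -
    have "i \<in> {0, 1, 2, 3, 4, 5}" using that by auto
    then show ?thesis by (auto simp: pull_coframe_def cnj_form_def numeral_eq_Suc)
  qed
  then show ?thesis unfolding real_vol_def using True by (intro wedge1_map_arg) auto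
qed (simp add: real_vol_def wedge1_length)

lemma bounded_bilinear_matrix_vector_mult: "bounded_bilinear ((*v) :: real^'n^'m \<Rightarrow> real^'n \<Rightarrow> real^'m)"
proof -
  have "bilinear ((*v) :: real^'n^'m \<Rightarrow> real^'n \<Rightarrow> real^'m)"
    unfolding bilinear_def
    by (auto intro!: linearI simp: matrix_vector_mult_add_rdistrib matrix_vector_right_distrib
        matrix_vector_mult_scaleR scaleR_matrix_vector_assoc)
  then show ?thesis by (simp add: bilinear_conv_bounded_bilinear)
qed

lemma linear_axis_sum:
  fixes f :: "real^'n \<Rightarrow> 'b::real_vector"
  assumes "linear f"
  shows "f v = (\<Sum>k\<in>UNIV. (v $ k) *\<^sub>R f (axis k 1))"
proof -
  have "f v = f (\<Sum>k\<in>UNIV. (v $ k) *\<^sub>R axis k 1)"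
    using basis_expansion[of v] by (simp add: scalar_mult_eq_scaleR)
  then show ?thesis unfolding linear_sum[OF assms] linear_scale[OF assms] .
qed

text \<open>In the transformation law the second derivatives of the change of coordinates cancel
  because they are symmetric.\<close>

theorem nij_tensor_natural:
  fixes f :: "real^6 \<Rightarrow> real^6" and J1 J2 :: "real^6 \<Rightarrow> real^6^6"
  defines "F y \<equiv> frechet_derivative f (at y)"
  assumes S: "open S" "x \<in> S" "smooth_on f S"
    and J1: "(J1 has_derivative D1) (at x)" and J2: "(J2 has_derivative D2) (at (f x))"
    and eq: "\<And>y w. y \<in> S \<Longrightarrow> J2 (f y) *v F y w = F y (J1 y *v w)"
  shows "nij_tensor (J2 (f x)) D2 (F x u) (F x v) = F x (nij_tensor (J1 x) D1 u v)"
proof -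
  define H where "H w u = frechet_derivative (\<lambda>y. F y w) (at x) u" for w u
  have H: "((\<lambda>y. F y w) has_derivative H w) (at x)" for w
    using smooth_on_has_derivative[OF smooth_on_frechet_derivative[OF S(3), of w] S(2)]
    unfolding H_def[abs_def] F_def .
  have sym: "H w u = H u w" for w u
    unfolding H_def F_def by (rule second_derivative_symmetric[OF S])
  have linF: "linear (F y)" if "y \<in> S" for y
    unfolding F_def using smooth_on_has_derivative[OF S(3) that] by (rule has_derivative_linear)
  have linH: "linear (\<lambda>w. H w u)" for u
    unfolding sym[of _ u] using has_derivative_linear[OF H] by simp
  have key: "D2 (F x u) *v F x w + J2 (f x) *v H w u = F x (D1 u *v w) + H (J1 x *v w) u" for u w
  proof -
    have "((\<lambda>y. J2 (f y) *v F y w) has_derivative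
        (\<lambda>u. J2 (f x) *v H w u + D2 (F x u) *v F x w)) (at x)"
      using bounded_bilinear.FDERIV[OF bounded_bilinear_matrix_vector_mult
          diff_chain_at[OF smooth_on_has_derivative[OF S(3,2)] J2] H]
      by (simp add: o_def F_def)
    then have 1: "((\<lambda>y. F y (J1 y *v w)) has_derivative
        (\<lambda>u. J2 (f x) *v H w u + D2 (F x u) *v F x w)) (at x)"
      by (rule has_derivative_transform_within_open[OF _ S(1,2)]) (rule eq)
    have J1w: "((\<lambda>y. (J1 y *v w) $ k) has_derivative (\<lambda>u. (D1 u *v w) $ k)) (at x)" for k
      using bounded_linear.has_derivative[OF bounded_linear_vec_nth
          bounded_linear.has_derivative[OF bounded_bilinear.bounded_linear_left[OF bounded_bilinear_matrix_vector_mult] J1]] .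
    have "((\<lambda>y. \<Sum>k\<in>UNIV. (J1 y *v w) $ k *\<^sub>R F y (axis k 1)) has_derivative
        (\<lambda>u. \<Sum>k\<in>UNIV. (J1 x *v w) $ k *\<^sub>R H (axis k 1) u + (D1 u *v w) $ k *\<^sub>R F x (axis k 1))) (at x)"
      by (intro has_derivative_sum bounded_bilinear.FDERIV[OF bounded_bilinear_scaleR] J1w H)
    then have "((\<lambda>y. F y (J1 y *v w)) has_derivative
        (\<lambda>u. \<Sum>k\<in>UNIV. (J1 x *v w) $ k *\<^sub>R H (axis k 1) u + (D1 u *v w) $ k *\<^sub>R F x (axis k 1))) (at x)"
      by (rule has_derivative_transform_within_open[OF _ S(1,2)]) (rule linear_axis_sum[OF linF, symmetric])
    then have "((\<lambda>y. F y (J1 y *v w)) has_derivative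
        (\<lambda>u. H (J1 x *v w) u + F x (D1 u *v w))) (at x)"
      unfolding sum.distrib linear_axis_sum[OF linF[OF S(2)], symmetric]
        linear_axis_sum[OF linH, symmetric] .
    from has_derivative_unique[OF 1 this] show ?thesis
      by (auto simp: fun_eq_iff add.commute)
  qed
  have key': "D2 (F x u) *v F x w = F x (D1 u *v w) + H (J1 x *v w) u - J2 (f x) *v H w u" for u w
    using key[of u w] by (simp add: algebra_simps)
  note l = linF[OF S(2)]
  have e: "J2 (f x) *v F x w = F x (J1 x *v w)" for w using eq S(2) by blast
  show ?thesis
    unfolding nij_tensor_def
    by (simp add: e key' linear_add[OF l] linear_diff[OF l] matrix_vector_right_distrib
        matrix_vector_mult_diff_distrib sym[of v] sym[of _ "J1 x *v u"] sym[of "J1 x *v v" u])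
qed


section \<open>Homogeneous polynomials in the first derivatives\<close>

text \<open>The complex counterpart of the polynomials in \<open>class_L61\<close>. The array t is a
  free variable independent of J, and monomials are words rather than multisets, so coefficients are
  not unique.\<close>

definition hpoly :: "nat \<Rightarrow> (real^6^6) set \<Rightarrow> (real^6^6 \<Rightarrow> (6 \<times> 6 \<times> 6 \<Rightarrow> real) \<Rightarrow> complex) \<Rightarrow> bool" where
  "hpoly n W F \<longleftrightarrow> (\<exists>a. (\<forall>ms. smooth_on (a ms) W) \<and>
     (\<forall>J\<in>W. \<forall>t. F J t = (\<Sum>ms | length ms = n. a ms J * of_real (prod_list (map t ms)))))"

lemma finite_length_eq: "finite {ms :: 'a::finite list. length ms = n}"
  using finite_lists_length_eq[of "UNIV :: 'a set" n] by simp

lemma hpoly_const: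
  assumes "smooth_on f W"
  shows "hpoly 0 W (\<lambda>J t. f J)"
  unfolding hpoly_def by (rule exI[of _ "\<lambda>ms. f"]) (simp add: assms)

lemma hpoly_add:
  assumes "open W" "hpoly n W F" "hpoly n W G"
  shows "hpoly n W (\<lambda>J t. F J t + G J t)"
proof -
  obtain a b where "\<forall>ms. smooth_on (a ms) W" "\<forall>ms. smooth_on (b ms) W"
    "\<forall>J\<in>W. \<forall>t. F J t = (\<Sum>ms | length ms = n. a ms J * of_real (prod_list (map t ms)))"
    "\<forall>J\<in>W. \<forall>t. G J t = (\<Sum>ms | length ms = n. b ms J * of_real (prod_list (map t ms)))"
    using assms(2,3) unfolding hpoly_def by blast
  then show ?thesis unfolding hpoly_def
    by (intro exI[of _ "\<lambda>ms J. a ms J + b ms J"])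
      (simp add: smooth_on_add assms(1) distrib_right sum.distrib)
qed

lemma hpoly_zero: "open W \<Longrightarrow> hpoly n W (\<lambda>J t. 0)"
  unfolding hpoly_def by (rule exI[of _ "\<lambda>ms J. 0"]) (simp add: smooth_on_const)

lemma hpoly_sum:
  assumes "open W" "\<And>i. i \<in> I \<Longrightarrow> hpoly n W (F i)"
  shows "hpoly n W (\<lambda>J t. \<Sum>i\<in>I. F i J t)"
  using assms(2)
  by (induction I rule: infinite_finite_induct) (simp_all add: hpoly_zero hpoly_add assms(1))

text \<open>A word of length n + m splits uniquely after n letters, so products require no
  collecting of equal monomials.\<close>

lemma hpoly_mult:
  assumes "open W" "hpoly n W F" "hpoly m W G"
  shows "hpoly (n + m) W (\<lambda>J t. F J t * G J t)"
proof -
  obtain a b where ab: "\<forall>ms. smooth_on (a ms) W" "\<forall>ms. smooth_on (b ms) W"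
    and F: "\<forall>J\<in>W. \<forall>t. F J t = (\<Sum>ms | length ms = n. a ms J * of_real (prod_list (map t ms)))"
    and G: "\<forall>J\<in>W. \<forall>t. G J t = (\<Sum>ms | length ms = m. b ms J * of_real (prod_list (map t ms)))"
    using assms(2,3) unfolding hpoly_def by blast
  let ?c = "\<lambda>ms J. a (take n ms) J * b (drop n ms) J"
  have "F J t * G J t = (\<Sum>ms | length ms = n + m. ?c ms J * of_real (prod_list (map t ms)))"
    if "J \<in> W" for J t
  proof -
    have "F J t * G J t = (\<Sum>(xs, ys)\<in>{xs. length xs = n} \<times> {ys. length ys = m}.
        (a xs J * of_real (prod_list (map t xs))) * (b ys J * of_real (prod_list (map t ys))))"
      using F G that by (simp add: sum_product sum.cartesian_product)
    also have "\<dots> = (\<Sum>ms | length ms = n + m. ?c ms J * of_real (prod_list (map t ms)))"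
      by (rule sum.reindex_bij_witness[of _ "\<lambda>ms. (take n ms, drop n ms)" "\<lambda>(xs, ys). xs @ ys"])
        auto
    finally show ?thesis .
  qed
  moreover have "smooth_on (?c ms) W" for ms
    using ab by (intro smooth_on_mult assms(1)) auto
  ultimately show ?thesis unfolding hpoly_def by (intro exI[of _ ?c]) blast
qed

lemma hpoly_smooth_mult:
  assumes "open W" "smooth_on f W" "hpoly n W G"
  shows "hpoly n W (\<lambda>J t. f J * G J t)"
  using hpoly_mult[OF assms(1) hpoly_const[OF assms(2)] assms(3)] by simp

lemma hpoly_const_mult: "open W \<Longrightarrow> hpoly n W G \<Longrightarrow> hpoly n W (\<lambda>J t. c * G J t)"
  by (rule hpoly_smooth_mult[OF _ smooth_on_const])

lemma hpoly_diff:
  assumes "open W" "hpoly n W F" "hpoly n W G"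
  shows "hpoly n W (\<lambda>J t. F J t - G J t)"
  using hpoly_add[OF assms(1,2) hpoly_const_mult[OF assms(1,3), of "- 1"]] by simp

lemma hpoly_cnj:
  assumes "open W" "hpoly n W F"
  shows "hpoly n W (\<lambda>J t. cnj (F J t))"
proof -
  obtain a where "\<forall>ms. smooth_on (a ms) W"
    "\<forall>J\<in>W. \<forall>t. F J t = (\<Sum>ms | length ms = n. a ms J * of_real (prod_list (map t ms)))"
    using assms(2) unfolding hpoly_def by blast
  then show ?thesis unfolding hpoly_def
    by (intro exI[of _ "\<lambda>ms J. cnj (a ms J)"]) (simp add: smooth_on_cnj assms(1))
qed

lemma hpoly_var:
  assumes "open W"
  shows "hpoly 1 W (\<lambda>J t. of_real (t m))"
proof -
  let ?a = "\<lambda>ms J. if ms = [m] then 1 else 0 :: complex"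
  have "(\<Sum>ms | length ms = 1. ?a ms J * of_real (prod_list (map t ms))) =
      (\<Sum>ms\<in>{[m]}. ?a ms J * of_real (prod_list (map t ms)))" for J :: "real^6^6" and t
    by (intro sum.mono_neutral_right finite_length_eq) auto
  then show ?thesis unfolding hpoly_def
    by (intro exI[of _ ?a]) (auto simp: smooth_on_const assms)
qed

lemma smooth_on_hpoly:
  fixes J :: "real^6 \<Rightarrow> real^6^6"
  assumes "open S" "open W" "hpoly n W F" "smooth_on J S" "\<And>x. x \<in> S \<Longrightarrow> J x \<in> W"
    "\<And>m. smooth_on (\<lambda>x. t x m) S"
  shows "smooth_on (\<lambda>x. F (J x) (t x)) S"
proof -
  obtain a where a: "\<forall>ms. smooth_on (a ms) W"
    "\<forall>J\<in>W. \<forall>t. F J t = (\<Sum>ms | length ms = n. a ms J * of_real (prod_list (map t ms)))"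
    using assms(3) unfolding hpoly_def by blast
  have "smooth_on (\<lambda>x. prod_list (map (t x) ms)) S" for ms
    by (induction ms) (auto intro!: smooth_on_const smooth_on_mult assms)
  then have "smooth_on (\<lambda>x. \<Sum>ms | length ms = n. a ms (J x) * of_real (prod_list (map (t x) ms))) S"
    using a(1) by (intro smooth_on_sum smooth_on_mult smooth_on_of_real
        smooth_on_compose[OF assms(1,2) _ assms(4)] assms) auto
  then show ?thesis
    by (rule smooth_on_cong[OF _ assms(1)]) (use a(2) assms(5) in auto)
qed

section \<open>The Nijenhuis matrix, the integrand and psi as polynomials\<close>

definition deriv_mat :: "(6 \<times> 6 \<times> 6 \<Rightarrow> real) \<Rightarrow> real^6 \<Rightarrow> real^6^6" where
  "deriv_mat t u = (\<chi> i j. \<Sum>k\<in>UNIV. u $ k * t (k, i, j))"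

lemma smooth_on_matrix_entry: "open W \<Longrightarrow> smooth_on (\<lambda>J :: real^6^6. complex_of_real (J $ i $ j)) W"
  by (intro smooth_on_of_real smooth_on_vec_nth smooth_on_ident)

lemma hpoly_deriv_mat_mult:
  assumes W: "open W" and f: "\<And>k. smooth_on (\<lambda>J. complex_of_real (f J $ k)) W"
  shows "hpoly 1 W (\<lambda>J t. of_real ((deriv_mat t (f J) *v v) $ i))"
proof -
  have eq: "complex_of_real ((deriv_mat t (f J) *v v) $ i) =
      (\<Sum>j\<in>UNIV. \<Sum>k\<in>UNIV. (of_real (v $ j) * of_real (f J $ k)) * of_real (t (k, i, j)))" for J t
    by (simp add: deriv_mat_def matrix_vector_mult_def sum_distrib_left sum_distrib_right mult_ac)
  show ?thesis unfolding eq
    by (intro hpoly_sum hpoly_smooth_mult hpoly_var smooth_on_mult smooth_on_const W f)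
qed

lemma hpoly_nij_tensor:
  assumes W: "open W"
  shows "hpoly 1 W (\<lambda>J t. of_real (nij_tensor J (deriv_mat t) u v $ i))"
proof -
  have Ju: "smooth_on (\<lambda>J. complex_of_real ((J *v u) $ k)) W" for u k
    unfolding matrix_vector_mult_def by (simp, intro smooth_on_sum smooth_on_mult smooth_on_const
        smooth_on_matrix_entry W)
  have cu: "smooth_on (\<lambda>J. complex_of_real (u $ k)) W" for u :: "real^6" and k
    by (intro smooth_on_const W)
  have JD: "hpoly 1 W (\<lambda>J t. of_real ((J *v (deriv_mat t u *v v)) $ i))" for u v
  proof -
    have eq: "complex_of_real ((J *v w) $ i) = (\<Sum>k\<in>UNIV. of_real (J $ i $ k) * of_real (w $ k))"
      for J :: "real^6^6" and w by (simp add: matrix_vector_mult_def)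
    show ?thesis unfolding eq
      by (intro hpoly_sum hpoly_smooth_mult hpoly_deriv_mat_mult[where f="\<lambda>J. u"] smooth_on_matrix_entry W cu)
  qed
  show ?thesis
    unfolding nij_tensor_def vector_add_component vector_minus_component of_real_add of_real_diff
    by (intro hpoly_add hpoly_diff JD hpoly_deriv_mat_mult Ju W)
qed

lemma smooth_on_frame_matrix:
  assumes "open W"
  shows "smooth_on (\<lambda>J. frame_matrix J e $ r $ s) W"
proof -
  have "smooth_on (\<lambda>J :: real^6^6. (J *v w) $ s) W" for w
    unfolding matrix_vector_mult_def
    by (simp, intro smooth_on_sum smooth_on_mult smooth_on_const smooth_on_vec_nth smooth_on_ident assms)
  then show ?thesis
    using exhaust_6[of r] by (auto simp: frame_matrix_def vector_6 smooth_on_const assms)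
qed

lemma smooth_on_det_frame_matrix: "open W \<Longrightarrow> smooth_on (\<lambda>J. det (frame_matrix J e)) W"
  by (intro smooth_on_det smooth_on_frame_matrix)

lemma smooth_on_adj_coframe:
  assumes "open W"
  shows "smooth_on (\<lambda>J. adj_coframe J e k [v]) W"
proof -
  have "smooth_on (\<lambda>J. replace_row s (frame_matrix J e) v $ i $ j) W" for s i j
    by (cases "i = s") (simp_all add: replace_row_def smooth_on_const smooth_on_frame_matrix assms)
  then show ?thesis unfolding adj_coframe_def
    by (simp, intro smooth_on_add smooth_on_mult smooth_on_const smooth_on_of_real smooth_on_det assms)
qed

lemma hpoly_nij_numerator:
  assumes W: "open W"
  shows "hpoly 1 W (\<lambda>J t. nij_numerator J (nij_tensor J (deriv_mat t)) e $ i $ j)"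
proof -
  have eq: "nij_numerator J T e $ i $ j =
      (\<Sum>k\<in>UNIV. (adj_coframe J e i [axis k 1] * (1/4)) * of_real (T (e (j + 1)) (e (j + 2)) $ k))" for J T
    unfolding nij_numerator_def nij_matrix_def
    using linear_axis_expansion[OF linear_adj_coframe[of J e i], of "T (e (j + 1)) (e (j + 2))"]
    by (simp add: sum_divide_distrib mult_ac)
  show ?thesis unfolding eq
    by (intro hpoly_sum hpoly_smooth_mult hpoly_nij_tensor smooth_on_mult smooth_on_adj_coframe
        smooth_on_const W)
qed

lemma hpoly_mult3:
  assumes "open W" "hpoly 1 W F" "hpoly 1 W G" "hpoly 1 W H"
  shows "hpoly 3 W (\<lambda>J t. F J t * G J t * H J t)"
  using hpoly_mult[OF assms(1) hpoly_mult[OF assms(1-3)] assms(4)] by (simp add: numeral_3_eq_3)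

lemma hpoly_det:
  assumes W: "open W" and N: "\<And>i j. hpoly 1 W (\<lambda>J t. N J t $ i $ j)"
  shows "hpoly 3 W (\<lambda>J t. det (N J t :: complex^3^3))"
  unfolding det_3 by (intro hpoly_add hpoly_diff hpoly_mult3 W N)

lemma hpoly_P_nij:
  assumes W: "open W" and N: "\<And>i j. hpoly 1 W (\<lambda>J t. N J t $ i $ j)"
  shows "hpoly 3 W (\<lambda>J t. P_nij (N J t))"
proof -
  have c: "hpoly 1 W (\<lambda>J t. cnj_matrix (N J t) $ i $ j)" for i j
    using hpoly_cnj[OF W N] by (simp add: cnj_matrix_def)
  have t: "hpoly 1 W (\<lambda>J t. transpose (N J t) $ i $ j)" for i j
    using N by (simp add: transpose_def)
  have eq: "P_nij n = (1/6) * (mixed_det (cnj_matrix n) (cnj_matrix n) (transpose n) +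
     mixed_det (cnj_matrix n) (transpose n) (cnj_matrix n) + mixed_det (cnj_matrix n) (cnj_matrix n) (transpose n) +
     mixed_det (cnj_matrix n) (transpose n) (cnj_matrix n) + mixed_det (transpose n) (cnj_matrix n) (cnj_matrix n) +
     mixed_det (transpose n) (cnj_matrix n) (cnj_matrix n))" for n
    by (simp add: P_nij_def sym_det_def)
  show ?thesis unfolding eq mixed_det_def
    by (intro hpoly_const_mult hpoly_add hpoly_diff hpoly_mult3 W c t)
qed

lemma hpoly_norm_square:
  assumes "open W" "hpoly 3 W F"
  shows "hpoly 6 W (\<lambda>J t. of_real ((cmod (F J t))\<^sup>2))"
  using hpoly_mult[OF assms hpoly_cnj[OF assms]] unfolding complex_norm_square by simp

text \<open>The open neighbourhood of all complex structures on which the glued formulas have a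
  nonzero denominator; it serves as W in \<open>class_L61\<close>.\<close>

definition weight_domain :: "(real^6^6) set" where
  "weight_domain = {J. frame_weight J \<noteq> 0}"

lemma smooth_on_frame_weight: "open W \<Longrightarrow> smooth_on frame_weight W"
  unfolding frame_weight_def
  by (intro smooth_on_sum smooth_on_power smooth_on_det_frame_matrix)

lemma open_weight_domain: "open weight_domain"
  unfolding weight_domain_def
  using smooth_on_continuous_on[OF smooth_on_frame_weight[OF open_UNIV]]
  by (intro open_Collect_neq continuous_on_const)

lemma complex_structure_weight_domain: "J ** J = - mat 1 \<Longrightarrow> J \<in> weight_domain"
  using frame_weight_pos[of J] by (simp add: weight_domain_def)

definition integrand_density :: "real \<Rightarrow> real \<Rightarrow> real^6^6 \<Rightarrow> (6 \<times> 6 \<times> 6 \<Rightarrow> real) \<Rightarrow> real" where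
  "integrand_density c1 c2 J t = (\<Sum>I\<in>UNIV. det (frame_matrix J (axis_frame I)) *
     kappa c1 c2 (nij_numerator J (nij_tensor J (deriv_mat t)) (axis_frame I))) / frame_weight J"

lemma hpoly_integrand_density: "hpoly 6 weight_domain (\<lambda>J t. of_real (integrand_density c1 c2 J t))"
proof -
  note W = open_weight_domain
  have eq: "of_real (integrand_density c1 c2 J t) = of_real (inverse (frame_weight J)) *
    (\<Sum>I\<in>UNIV. of_real (det (frame_matrix J (axis_frame I))) *
      (of_real c1 * of_real ((cmod (det (nij_numerator J (nij_tensor J (deriv_mat t)) (axis_frame I))))\<^sup>2) +
       of_real c2 * of_real ((cmod (P_nij (nij_numerator J (nij_tensor J (deriv_mat t)) (axis_frame I))))\<^sup>2)))" for J t
    by (simp add: integrand_density_def kappa_def divide_inverse mult.commute del: of_real_power)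
  have w: "smooth_on (\<lambda>J. complex_of_real (inverse (frame_weight J))) weight_domain"
    by (intro smooth_on_of_real smooth_on_inverse smooth_on_frame_weight W) (simp add: weight_domain_def)
  show ?thesis unfolding eq
    by (intro hpoly_smooth_mult[OF _ w] hpoly_smooth_mult hpoly_sum hpoly_add hpoly_const_mult hpoly_norm_square hpoly_det
        hpoly_P_nij hpoly_nij_numerator smooth_on_of_real smooth_on_det_frame_matrix W)
qed

text \<open>The right-hand side of \<open>psi_pt_formula\<close> as a function of J and its partial
  derivatives, from which the smoothness of psi is read off.\<close>

definition psi_value :: "real^6^6 \<Rightarrow> (6 \<times> 6 \<times> 6 \<Rightarrow> real) \<Rightarrow> (real^6) list \<Rightarrow> complex" where
  "psi_value J t vs = (\<Sum>I\<in>UNIV. of_real (det (frame_matrix J (axis_frame I))) ^ 2 *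
      psi_pt (nij_numerator J (nij_tensor J (deriv_mat t)) (axis_frame I)) (adj_coframe J (axis_frame I)) vs)
    * of_real (inverse (frame_weight J))"

lemma smooth_on_hol_vol_adj_coframe:
  assumes "open W"
  shows "smooth_on (\<lambda>J. hol_vol (adj_coframe J e) vs) W"
proof (cases "length vs = 3")
  case True
  then obtain u v w where "vs = [u, v, w]" by (auto simp: numeral_3_eq_3 length_Suc_conv)
  then show ?thesis
    unfolding hol_vol_def by (simp add: wedge1_3)
      (intro smooth_on_add smooth_on_diff smooth_on_mult smooth_on_adj_coframe assms)
qed (simp add: hol_vol_def wedge1_length smooth_on_const assms)

lemma hpoly_psi_value: "hpoly 3 weight_domain (\<lambda>J t. psi_value J t vs)"
proof -
  note W = open_weight_domain
  have eq: "psi_value J t vs = of_real (inverse (frame_weight J)) *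
    (\<Sum>I\<in>UNIV. (of_real (det (frame_matrix J (axis_frame I))) ^ 2 * hol_vol (adj_coframe J (axis_frame I)) vs) *
      P_nij (nij_numerator J (nij_tensor J (deriv_mat t)) (axis_frame I)))" for J t
    by (simp add: psi_value_def psi_pt_def mult_ac)
  have w: "smooth_on (\<lambda>J. complex_of_real (inverse (frame_weight J))) weight_domain"
    by (intro smooth_on_of_real smooth_on_inverse smooth_on_frame_weight W) (simp add: weight_domain_def)
  show ?thesis unfolding eq
    by (intro hpoly_smooth_mult[OF _ w] hpoly_smooth_mult hpoly_sum
        hpoly_P_nij hpoly_nij_numerator smooth_on_mult smooth_on_power smooth_on_hol_vol_adj_coframe
        smooth_on_of_real smooth_on_det_frame_matrix W)
qed

section \<open>Charts\<close>

locale oriented_manifold6 =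
  fixes X :: "'a topology" and A :: "'a chart set"
  assumes manifold: "compact_oriented_manifold6 X A"
begin

lemma chart_props:
  assumes "c \<in> A"
  shows "openin X (fst c)" "open (snd c ` fst c)" "fst c \<subseteq> topspace X" "inj_on (snd c) (fst c)"
    "homeomorphic_map (subtopology X (fst c)) (top_of_set (snd c ` fst c)) (snd c)"
proof -
  have c: "is_chart X c" using manifold assms by (simp add: compact_oriented_manifold6_def)
  then show 1: "openin X (fst c)" "open (snd c ` fst c)"
    and h: "homeomorphic_map (subtopology X (fst c)) (top_of_set (snd c ` fst c)) (snd c)"
    by (auto simp: is_chart_def)
  show 2: "fst c \<subseteq> topspace X" using 1 by (simp add: openin_subset)
  show "inj_on (snd c) (fst c)"
    using homeomorphic_imp_injective_map[OF h] 2 by (simp add: Int_absorb1)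
qed

lemma charts_at_iff: "c \<in> charts_at A p \<longleftrightarrow> c \<in> A \<and> p \<in> fst c"
  by (simp add: charts_at_def)

lemma chart_inv_simps:
  assumes "c \<in> A"
  shows "p \<in> fst c \<Longrightarrow> chart_inv c (snd c p) = p"
    "x \<in> snd c ` fst c \<Longrightarrow> snd c (chart_inv c x) = x"
    "x \<in> snd c ` fst c \<Longrightarrow> chart_inv c x \<in> fst c"
  using chart_props(4)[OF assms] unfolding chart_inv_def
  by (simp_all add: inv_into_f_f f_inv_into_f inv_into_into)

lemma charts_at_exists: "p \<in> topspace X \<Longrightarrow> \<exists>c. c \<in> charts_at A p"
  using manifold unfolding compact_oriented_manifold6_def charts_at_def by blast

lemma charts_at_topspace: "c \<in> charts_at A p \<Longrightarrow> p \<in> topspace X"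
  using chart_props(3)[of c] by (auto simp: charts_at_def)

lemma open_chart_image:
  assumes "c \<in> A" "openin X U"
  shows "open (snd c ` (fst c \<inter> U))"
proof -
  have "openin (subtopology X (fst c)) (fst c \<inter> U)"
    using assms(2) by (auto simp: openin_subtopology Int_commute)
  then have "openin (top_of_set (snd c ` fst c)) (snd c ` (fst c \<inter> U))"
    using homeomorphic_imp_open_map[OF chart_props(5)[OF assms(1)]] by (simp add: open_map_def)
  then show ?thesis using chart_props(2)[OF assms(1)] by (rule openin_open_trans)
qed

lemma openin_chart_preimage:
  assumes "c \<in> A" "open V"
  shows "openin X {p \<in> fst c. snd c p \<in> V}"
proof -
  have "continuous_map (subtopology X (fst c)) (top_of_set (snd c ` fst c)) (snd c)"
    using chart_props(5)[OF assms(1)] homeomorphic_imp_continuous_map by blast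
  then have "openin (subtopology X (fst c)) {p \<in> topspace (subtopology X (fst c)). snd c p \<in> snd c ` fst c \<inter> V}"
    by (rule openin_continuous_map_preimage) (use assms(2) in \<open>simp add: openin_open_Int\<close>)
  moreover have "{p \<in> topspace (subtopology X (fst c)). snd c p \<in> snd c ` fst c \<inter> V} = {p \<in> fst c. snd c p \<in> V}"
    using chart_props(3)[OF assms(1)] by auto
  ultimately show ?thesis
    using openin_trans_full chart_props(1)[OF assms(1)] by metis
qed


subsection \<open>Coordinate expressions of maps\<close>

definition coord_map :: "('a \<Rightarrow> 'a) \<Rightarrow> 'a chart \<Rightarrow> 'a chart \<Rightarrow> real^6 \<Rightarrow> real^6" where
  "coord_map f c c' = (\<lambda>x. snd c' (f (chart_inv c x)))"

definition coord_dom :: "('a \<Rightarrow> 'a) \<Rightarrow> 'a chart \<Rightarrow> 'a chart \<Rightarrow> (real^6) set" where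
  "coord_dom f c c' = snd c ` {p \<in> fst c. f p \<in> fst c'}"

lemma jac_def': "jac f c c' p = matrix (frechet_derivative (coord_map f c c') (at (snd c p)))"
  by (simp add: jac_def coord_map_def)

lemma open_coord_dom:
  assumes "c \<in> A" "c' \<in> A" "continuous_map X X f"
  shows "open (coord_dom f c c')"
proof -
  have "openin X {p \<in> topspace X. f p \<in> fst c'}"
    using assms(3) chart_props(1)[OF assms(2)] by (rule openin_continuous_map_preimage)
  from open_chart_image[OF assms(1) this]
  have "open (snd c ` (fst c \<inter> {p \<in> topspace X. f p \<in> fst c'}))" .
  moreover have "coord_dom f c c' = snd c ` (fst c \<inter> {p \<in> topspace X. f p \<in> fst c'})"
    using chart_props(3)[OF assms(1)] by (auto simp: coord_dom_def)
  ultimately show ?thesis by simp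
qed

lemma smooth_on_coord_map:
  "smooth_map A f \<Longrightarrow> c \<in> A \<Longrightarrow> c' \<in> A \<Longrightarrow> smooth_on (coord_map f c c') (coord_dom f c c')"
  by (simp add: smooth_map_def coord_map_def coord_dom_def)

lemma coord_map_in:
  "c \<in> A \<Longrightarrow> x \<in> coord_dom f c c' \<Longrightarrow> coord_map f c c' x \<in> snd c' ` fst c'"
  by (auto simp: coord_dom_def coord_map_def chart_inv_simps)

lemma coord_map_has_derivative:
  assumes "smooth_map A f" "c \<in> A" "c' \<in> A" "p \<in> fst c" "f p \<in> fst c'"
  shows "(coord_map f c c' has_derivative (*v) (jac f c c' p)) (at (snd c p))"
proof -
  have "snd c p \<in> coord_dom f c c'" using assms by (auto simp: coord_dom_def)
  from smooth_on_has_derivative[OF smooth_on_coord_map[OF assms(1-3)] this]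
  show ?thesis
    unfolding jac_def' by (simp add: has_derivative_linear matrix_works fun_eq_iff)
qed

lemma frechet_derivative_coord_map:
  assumes "smooth_map A f" "c \<in> A" "c' \<in> A" "p \<in> fst c" "f p \<in> fst c'"
  shows "frechet_derivative (coord_map f c c') (at (snd c p)) = (*v) (jac f c c' p)"
  using coord_map_has_derivative[OF assms] by (rule frechet_derivative_at[symmetric])

text \<open>The map h has to agree with the composite only on the space. This covers compositions
  with the identity, that is, changes of chart on either side of f.\<close>

lemma jac_chain:
  assumes f: "smooth_map A f" "continuous_map X X f" and g: "smooth_map A g"
    and c: "c \<in> A" "c' \<in> A" "c'' \<in> A" and p: "p \<in> fst c" "f p \<in> fst c'" "g (f p) \<in> fst c''"
    and h: "\<And>q. q \<in> topspace X \<Longrightarrow> h q = g (f q)"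
  shows "jac h c c'' p = jac g c' c'' (f p) ** jac f c c' p"
proof -
  have x: "snd c p \<in> coord_dom f c c'" using p by (auto simp: coord_dom_def)
  have fx: "coord_map f c c' (snd c p) = snd c' (f p)"
    using c p by (simp add: coord_map_def chart_inv_simps)
  have "(coord_map g c' c'' \<circ> coord_map f c c' has_derivative
      (*v) (jac g c' c'' (f p)) \<circ> (*v) (jac f c c' p)) (at (snd c p))"
    by (rule diff_chain_at[OF coord_map_has_derivative[OF f(1) c(1,2) p(1,2)]])
      (unfold fx, rule coord_map_has_derivative[OF g c(2,3) p(2,3)])
  moreover have "(coord_map g c' c'' \<circ> coord_map f c c') y = coord_map h c c'' y"
    if "y \<in> coord_dom f c c'" for y
    using that c chart_props(3)[OF c(1)] h
    by (auto simp: coord_dom_def coord_map_def chart_inv_simps)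
  ultimately have "(coord_map h c c'' has_derivative
      (*v) (jac g c' c'' (f p)) \<circ> (*v) (jac f c c' p)) (at (snd c p))"
    using has_derivative_transform_within_open[OF _ open_coord_dom[OF c(1,2) f(2)] x] by blast
  then have "(coord_map h c c'' has_derivative (*v) (jac g c' c'' (f p) ** jac f c c' p)) (at (snd c p))"
    by (simp add: o_def matrix_vector_mul_assoc)
  then show ?thesis
    unfolding jac_def'[of h] by (simp flip: frechet_derivative_at)
qed

lemma smooth_id: "smooth_map A id" and orientation_id: "orientation_preserving A id"
  using manifold by (auto simp: compact_oriented_manifold6_def)

lemma jac_id_chain:
  assumes "c \<in> charts_at A p" "c' \<in> charts_at A p" "c'' \<in> charts_at A p"
  shows "jac id c c'' p = jac id c' c'' p ** jac id c c' p"
  using jac_chain[OF smooth_id _ smooth_id, of c c' c'' p id] assms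
  by (simp add: charts_at_iff)

lemma det_jac_pos:
  assumes "orientation_preserving A f" "c \<in> charts_at A p" "c' \<in> charts_at A (f p)"
  shows "det (jac f c c' p) > 0"
  using assms unfolding orientation_preserving_def charts_at_iff by blast

lemma invertible_jac:
  assumes "orientation_preserving A f" "c \<in> charts_at A p" "c' \<in> charts_at A (f p)"
  shows "invertible (jac f c c' p)"
  using det_jac_pos[OF assms] by (simp add: invertible_det_nz)

lemma smooth_on_jac:
  assumes "smooth_map A f" "c \<in> A" "c' \<in> A" "continuous_map X X f"
  shows "smooth_on (\<lambda>x. jac f c c' (chart_inv c x) *v v) (coord_dom f c c')"
proof -
  have "smooth_on (\<lambda>x. frechet_derivative (coord_map f c c') (at x) v) (coord_dom f c c')"
    by (intro smooth_on_frechet_derivative smooth_on_coord_map assms)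
  then show ?thesis
  proof (rule smooth_on_cong[OF _ open_coord_dom[OF assms(2-4)]])
    fix x assume "x \<in> coord_dom f c c'"
    then obtain p where "p \<in> fst c" "f p \<in> fst c'" "x = snd c p" by (auto simp: coord_dom_def)
    then show "frechet_derivative (coord_map f c c') (at x) v = jac f c c' (chart_inv c x) *v v"
      using frechet_derivative_coord_map[OF assms(1-3)] assms(2) by (simp add: chart_inv_simps)
  qed
qed


section \<open>Almost complex structures in charts\<close>

definition nij_at :: "'a endo_field \<Rightarrow> 'a chart \<Rightarrow> 'a \<Rightarrow> real^6 \<Rightarrow> real^6 \<Rightarrow> real^6" where
  "nij_at J c p = nij_tensor (J c p) (frechet_derivative (\<lambda>x. J c (chart_inv c x)) (at (snd c p)))"

lemma acs_props:
  assumes "J \<in> acs_pos X A"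
  shows "c \<in> A \<Longrightarrow> smooth_on (\<lambda>x. J c (chart_inv c x)) (snd c ` fst c)"
    "c \<in> charts_at A p \<Longrightarrow> J c p \<in> pos_complex_structures"
    "c \<in> charts_at A p \<Longrightarrow> J c p ** J c p = - mat 1"
    "c \<in> charts_at A p \<Longrightarrow> c' \<in> charts_at A p \<Longrightarrow> J c' p ** jac id c c' p = jac id c c' p ** J c p"
proof -
  show "c \<in> A \<Longrightarrow> smooth_on (\<lambda>x. J c (chart_inv c x)) (snd c ` fst c)"
    using assms by (simp add: acs_pos_def)
  show 1: "c \<in> charts_at A p \<Longrightarrow> J c p \<in> pos_complex_structures"
    using assms charts_at_topspace unfolding acs_pos_def by blast
  then show "c \<in> charts_at A p \<Longrightarrow> J c p ** J c p = - mat 1"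
    by (simp add: pos_complex_structures_def)
  show "c \<in> charts_at A p \<Longrightarrow> c' \<in> charts_at A p \<Longrightarrow> J c' p ** jac id c c' p = jac id c c' p ** J c p"
    using assms charts_at_topspace unfolding acs_pos_def by blast
qed

lemma acs_has_derivative:
  assumes "J \<in> acs_pos X A" "c \<in> charts_at A p"
  shows "((\<lambda>x. J c (chart_inv c x)) has_derivative
    frechet_derivative (\<lambda>x. J c (chart_inv c x)) (at (snd c p))) (at (snd c p))"
  using smooth_on_has_derivative[OF acs_props(1)[OF assms(1)]] assms(2) by (auto simp: charts_at_iff)

lemma bounded_bilinear_matrix_matrix_mult: "bounded_bilinear ((**) :: real^6^6 \<Rightarrow> real^6^6 \<Rightarrow> real^6^6)"
proof -
  have "bilinear ((**) :: real^6^6 \<Rightarrow> real^6^6 \<Rightarrow> real^6^6)"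
    unfolding bilinear_def
    by (auto intro!: linearI simp: matrix_matrix_mult_def vec_eq_iff sum.distrib distrib_left distrib_right
        sum_distrib_left mult_ac)
  then show ?thesis by (simp add: bilinear_conv_bounded_bilinear)
qed

text \<open>The anticommutation with J is the derivative of \<open>J ** J = - mat 1\<close> along
  the chart.\<close>

lemma antibilinear_nij_at:
  assumes "J \<in> acs_pos X A" "c \<in> charts_at A p"
  shows "antibilinear (J c p) (nij_at J c p)"
  unfolding nij_at_def
proof (rule antibilinear_nij_tensor)
  let ?D = "frechet_derivative (\<lambda>x. J c (chart_inv c x)) (at (snd c p))"
  note D = acs_has_derivative[OF assms]
  have c: "c \<in> A" "p \<in> fst c" using assms(2) by (auto simp: charts_at_iff)
  show "J c p ** J c p = - mat 1" using acs_props(3)[OF assms] .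
  show "linear ?D" using D by (rule has_derivative_linear)
  have "((\<lambda>x. J c (chart_inv c x) ** J c (chart_inv c x)) has_derivative
      (\<lambda>u. J c p ** ?D u + ?D u ** J c p)) (at (snd c p))"
    using bounded_bilinear.FDERIV[OF bounded_bilinear_matrix_matrix_mult D D] c by (simp add: chart_inv_simps)
  moreover have "J c (chart_inv c x) ** J c (chart_inv c x) = - mat 1" if "x \<in> snd c ` fst c" for x
    using acs_props(3)[OF assms(1), of c "chart_inv c x"] c that by (simp add: charts_at_iff chart_inv_simps)
  ultimately have "((\<lambda>x. - mat 1) has_derivative (\<lambda>u. J c p ** ?D u + ?D u ** J c p)) (at (snd c p))"
    using has_derivative_transform_within_open[OF _ chart_props(2)[OF c(1)], of _ _ "snd c p" UNIV "\<lambda>x. - mat 1"] c by auto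
  from has_derivative_unique[OF this has_derivative_const]
  have "J c p ** ?D u + ?D u ** J c p = 0" for u by (simp add: fun_eq_iff)
  then show "?D u ** J c p = - (J c p ** ?D u)" for u
    by (simp add: eq_neg_iff_add_eq_0 add.commute)
qed

lemma deriv_mat_dJ:
  assumes "J \<in> acs_pos X A" "c \<in> charts_at A p"
  shows "deriv_mat (dJ c J p) = frechet_derivative (\<lambda>x. J c (chart_inv c x)) (at (snd c p))"
proof
  let ?D = "frechet_derivative (\<lambda>x. J c (chart_inv c x)) (at (snd c p))"
  fix u
  have "?D u = (\<Sum>k\<in>UNIV. u $ k *\<^sub>R ?D (axis k 1))"
    using has_derivative_linear[OF acs_has_derivative[OF assms]] by (rule linear_axis_sum)
  then show "deriv_mat (dJ c J p) u = ?D u"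
    by (simp add: deriv_mat_def dJ_def vec_eq_iff)
qed

lemma nij_at_eq:
  assumes "J \<in> acs_pos X A" "c \<in> charts_at A p"
  shows "nij_at J c p = nij_tensor (J c p) (deriv_mat (dJ c J p))"
  unfolding nij_at_def deriv_mat_dJ[OF assms] ..

text \<open>The intertwining relation is assumed on the whole overlap and not just at p, because it
  is differentiated.\<close>

lemma nij_at_natural:
  assumes J: "J1 \<in> acs_pos X A" "J2 \<in> acs_pos X A"
    and f: "smooth_map A f" "continuous_map X X f"
    and c: "c \<in> charts_at A p" "c' \<in> charts_at A (f p)"
    and eq: "\<And>q. q \<in> fst c \<Longrightarrow> f q \<in> fst c' \<Longrightarrow> J2 c' (f q) ** jac f c c' q = jac f c c' q ** J1 c q"
  shows "nij_at J2 c' (f p) (jac f c c' p *v u) (jac f c c' p *v v) = jac f c c' p *v nij_at J1 c p u v"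
proof -
  have cA: "c \<in> A" "c' \<in> A" "p \<in> fst c" "f p \<in> fst c'" using c by (auto simp: charts_at_iff)
  let ?S = "coord_dom f c c'" and ?x = "snd c p"
  have x: "?x \<in> ?S" using cA by (auto simp: coord_dom_def)
  have fx: "coord_map f c c' ?x = snd c' (f p)" using cA by (simp add: coord_map_def chart_inv_simps)
  note F = frechet_derivative_coord_map[OF f(1) cA(1,2)]
  have "J2 c' (chart_inv c' (coord_map f c c' y)) *v frechet_derivative (coord_map f c c') (at y) w =
      frechet_derivative (coord_map f c c') (at y) (J1 c (chart_inv c y) *v w)"
    if y: "y \<in> ?S" for y w
  proof -
    obtain q where q: "q \<in> fst c" "f q \<in> fst c'" "y = snd c q" using y by (auto simp: coord_dom_def)
    have "coord_map f c c' y = snd c' (f q)"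
      using q cA by (simp add: coord_map_def chart_inv_simps)
    then show ?thesis using eq[OF q(1,2)] cA q
      by (simp add: F chart_inv_simps matrix_vector_mul_assoc)
  qed
  from nij_tensor_natural[of ?S ?x "coord_map f c c'" "\<lambda>x. J1 c (chart_inv c x)" _ "\<lambda>x. J2 c' (chart_inv c' x)",
      OF open_coord_dom[OF cA(1,2) f(2)] x smooth_on_coord_map[OF f(1) cA(1,2)]
      acs_has_derivative[OF J(1) c(1)] _ this, unfolded fx, OF acs_has_derivative[OF J(2) c(2)]]
  show ?thesis
    using cA unfolding nij_at_def by (simp add: F chart_inv_simps)
qed


subsection \<open>Local coframings\<close>

lemma coframing_props:
  assumes "coframing X A J U \<alpha>" "p \<in> U" "c \<in> charts_at A p"
  shows "openin X U" "smooth_form A U 1 (\<alpha> i)" "coframe (J c p) (\<lambda>i. \<alpha> i c p)"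
  using assms unfolding coframing_def coframe_def by blast+

lemma coframing_pull:
  assumes "coframing X A J U \<alpha>" "p \<in> U" "c \<in> charts_at A p" "c' \<in> charts_at A p"
  shows "(\<lambda>i. \<alpha> i c p) = pull_coframe (jac id c c' p) (\<lambda>i. \<alpha> i c' p)"
proof
  fix i show "\<alpha> i c p = pull_coframe (jac id c c' p) (\<lambda>i. \<alpha> i c' p) i"
    using coframing_props(2)[OF assms(1-3), of i] assms(2-4)
    unfolding smooth_form_def pull_coframe_def by (intro ext) blast
qed

lemma d_comp_coframing:
  assumes J: "J \<in> acs_pos X A" and \<alpha>: "coframing X A J U \<alpha>" and p: "p \<in> U" and c: "c \<in> charts_at A p"
  shows "d_comp J (-1) 2 1 0 (\<alpha> i) c p =
    (\<lambda>vs. if length vs = 2 then \<alpha> i c p [nij_at J c p (vs ! 0) (vs ! 1)] / 4 else 0)"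
proof -
  have cA: "c \<in> A" "p \<in> fst c" using c by (auto simp: charts_at_iff)
  define a where "a x v = \<alpha> i c (chart_inv c x) [v]" for x v
  define da where "da u v = frechet_derivative (\<lambda>x. a x v) (at (snd c p)) u" for u v
  let ?S = "snd c ` (fst c \<inter> U)" and ?Jx = "\<lambda>x. J c (chart_inv c x)"
  let ?D = "frechet_derivative ?Jx (at (snd c p))"
  have S: "open ?S" using open_chart_image[OF cA(1)] coframing_props(1)[OF \<alpha> p c] .
  have x: "snd c p \<in> ?S" using cA p by auto
  have near: "chart_inv c y \<in> U \<and> c \<in> charts_at A (chart_inv c y)" if "y \<in> ?S" for y
    using that cA by (auto simp: charts_at_iff chart_inv_simps)
  have f10: "form10 (?Jx y) (\<alpha> i c (chart_inv c y))" if "y \<in> ?S" for y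
    using coframing_props(3)[OF \<alpha>] near[OF that] unfolding coframe_def by blast
  have lin: "linear (a y)" if "y \<in> ?S" for y
    using form10_linear[OF f10[OF that]] by (simp add: a_def[abs_def])
  have aJ: "a y (?Jx y *v v) = \<i> * a y v" if "y \<in> ?S" for y v
    using form10_J[OF f10[OF that]] by (simp add: a_def)
  have "smooth_on (\<lambda>x. a x v) ?S" for v
    using coframing_props(2)[OF \<alpha> p c, of i] cA unfolding smooth_form_def a_def by blast
  then have da: "((\<lambda>x. a x v) has_derivative (\<lambda>u. da u v)) (at (snd c p))" for v
    using smooth_on_has_derivative[OF _ x, of "\<lambda>x. a x v"] by (simp add: da_def)
  have da_unique: "da u v = D u" if "((\<lambda>x. a x v) has_derivative D) (at (snd c p))" for u v D
    using has_derivative_unique[OF da that] by metis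
  have l1: "linear (\<lambda>u. da u v)" for v using da by (rule has_derivative_linear)
  \<comment> \<open>Linearity of \<open>da\<close> in its second argument is not part of being a
    derivative. It follows from uniqueness of derivatives, applied to linear combinations of the
    coefficient functions.\<close>
  have comb: "((\<lambda>x. a x (r *\<^sub>R v + s *\<^sub>R w)) has_derivative (\<lambda>u. r *\<^sub>R da u v + s *\<^sub>R da u w)) (at (snd c p))" for r s v w
  proof (rule has_derivative_transform_within_open[OF _ S x])
    show "((\<lambda>x. r *\<^sub>R a x v + s *\<^sub>R a x w) has_derivative (\<lambda>u. r *\<^sub>R da u v + s *\<^sub>R da u w)) (at (snd c p))"
      by (intro has_derivative_add has_derivative_scaleR_right da)
    show "r *\<^sub>R a y v + s *\<^sub>R a y w = a y (r *\<^sub>R v + s *\<^sub>R w)" if "y \<in> ?S" for y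
      using lin[OF that] by (simp add: linear_add linear_scale)
  qed
  have l2: "linear (da u)" for u
  proof (rule linearI)
    show "da u (v + w) = da u v + da u w" for v w
      using da_unique[OF comb[of 1 v 1 w, simplified]] by simp
    show "da u (r *\<^sub>R v) = r *\<^sub>R da u v" for r v
      using da_unique[OF comb[of r v 0 0, simplified]] by simp
  qed
  have Jp: "?Jx (snd c p) = J c p" "a (snd c p) = (\<lambda>v. \<alpha> i c p [v])"
    using cA by (simp_all add: a_def[abs_def] chart_inv_simps)
  \<comment> \<open>The product rule for a(Jv): the argument moves with the base point, so it is
    expanded in coordinate vectors before differentiating.\<close>
  have daJ: "da u (J c p *v v) + \<alpha> i c p [?D u *v v] = \<i> * da u v" for u v
  proof -
    have comp: "((\<lambda>y. (?Jx y *v v) $ k) has_derivative (\<lambda>u. (?D u *v v) $ k)) (at (snd c p))" for k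
      by (rule bounded_linear.has_derivative[OF bounded_linear_vec_nth
          bounded_linear.has_derivative[OF bounded_bilinear.bounded_linear_left[OF bounded_bilinear_matrix_vector_mult]
            acs_has_derivative[OF J c]]])
    have "((\<lambda>y. \<Sum>k\<in>UNIV. (?Jx y *v v) $ k *\<^sub>R a y (axis k 1)) has_derivative
        (\<lambda>u. \<Sum>k\<in>UNIV. (?Jx (snd c p) *v v) $ k *\<^sub>R da u (axis k 1) + (?D u *v v) $ k *\<^sub>R a (snd c p) (axis k 1))) (at (snd c p))"
      by (intro has_derivative_sum bounded_bilinear.FDERIV[OF bounded_bilinear_scaleR] comp da)
    then have "((\<lambda>y. \<i> * a y v) has_derivative
        (\<lambda>u. \<Sum>k\<in>UNIV. (?Jx (snd c p) *v v) $ k *\<^sub>R da u (axis k 1) + (?D u *v v) $ k *\<^sub>R a (snd c p) (axis k 1))) (at (snd c p))"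
      by (rule has_derivative_transform_within_open[OF _ S x])
        (simp only: linear_axis_sum[OF lin, symmetric] aJ)
    moreover have "((\<lambda>y. \<i> * a y v) has_derivative (\<lambda>u. \<i> * da u v)) (at (snd c p))"
      by (intro has_derivative_mult_right da)
    ultimately have "(\<lambda>u. \<Sum>k\<in>UNIV. (?Jx (snd c p) *v v) $ k *\<^sub>R da u (axis k 1) + (?D u *v v) $ k *\<^sub>R a (snd c p) (axis k 1))
       = (\<lambda>u. \<i> * da u v)"
      by (rule has_derivative_unique)
    then have "da u (?Jx (snd c p) *v v) + a (snd c p) (?D u *v v) = \<i> * da u v"
      unfolding sum.distrib linear_axis_sum[OF l2, symmetric] linear_axis_sum[OF lin[OF x], symmetric]
      by (rule fun_cong)
    then show ?thesis unfolding Jp .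
  qed
  have "ext_d 1 (\<alpha> i) c p = (\<lambda>vs. if length vs = 2 then da (vs ! 0) (vs ! 1) - da (vs ! 1) (vs ! 0) else 0)"
  proof
    fix vs :: "(real^6) list"
    show "ext_d 1 (\<alpha> i) c p vs = (if length vs = 2 then da (vs ! 0) (vs ! 1) - da (vs ! 1) (vs ! 0) else 0)"
    proof (cases "length vs = 2")
      case True
      then obtain u v where "vs = [u, v]" by (rule length_2E)
      then show ?thesis by (simp add: ext_d_def da_def a_def)
    qed (simp add: ext_d_def)
  qed
  moreover have "d_comp J (-1) 2 1 0 (\<alpha> i) c p = type_part (J c p) 0 2 (ext_d 1 (\<alpha> i) c p)"
    by (simp add: d_comp_def)
  ultimately show ?thesis
    using type_part_d_form10[OF acs_props(3)[OF J c] _ l1 l2 daJ] f10[OF x] cA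
    unfolding nij_at_def by (simp add: chart_inv_simps)
qed

text \<open>Passes from an equation of forms to one of values: on lists whose length is not 2 both
  sides vanish.\<close>

lemma nij_equation_iff:
  assumes J: "J \<in> acs_pos X A" and \<alpha>: "coframing X A J U \<alpha>" and p: "p \<in> U" and c: "c \<in> charts_at A p"
  shows "(\<forall>i. d_comp J (-1) 2 1 0 (\<alpha> i) c p =
       (\<lambda>vs. \<Sum>j\<in>UNIV. n $ i $ j * cnj_form (wedge1 [\<alpha> (j + 1) c p, \<alpha> (j + 2) c p]) vs)) \<longleftrightarrow>
     nij_coeffs (nij_at J c p) (\<lambda>i. \<alpha> i c p) n" (is "?l = ?r")
proof
  have *: "cnj_form (wedge1 [\<alpha> (j + 1) c p, \<alpha> (j + 2) c p]) [u, v] = cnj (pair_form (\<lambda>i. \<alpha> i c p) j u v)" for j u v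
    by (simp add: cnj_form_def wedge1_2 pair_form_def)
  {
    assume l: ?l
    show ?r unfolding nij_coeffs_def
    proof (intro allI)
      fix i u v
      from l have "d_comp J (-1) 2 1 0 (\<alpha> i) c p [u, v] =
        (\<Sum>j\<in>UNIV. n $ i $ j * cnj_form (wedge1 [\<alpha> (j + 1) c p, \<alpha> (j + 2) c p]) [u, v])"
        by simp
      then show "\<alpha> i c p [nij_at J c p u v] / 4 = (\<Sum>j\<in>UNIV. n $ i $ j * cnj (pair_form (\<lambda>i. \<alpha> i c p) j u v))"
        unfolding d_comp_coframing[OF assms] * by simp
    qed
  next
    assume r: ?r
    show ?l
    proof (intro allI ext)
      fix i vs
      show "d_comp J (-1) 2 1 0 (\<alpha> i) c p vs =
        (\<Sum>j\<in>UNIV. n $ i $ j * cnj_form (wedge1 [\<alpha> (j + 1) c p, \<alpha> (j + 2) c p]) vs)"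
      proof (cases "length vs = 2")
        case True
        then obtain u v where vs: "vs = [u, v]" by (rule length_2E)
        then show ?thesis using r unfolding d_comp_coframing[OF assms] nij_coeffs_def vs * by simp
      next
        case False
        then show ?thesis unfolding d_comp_coframing[OF assms] by (simp add: cnj_form_def wedge1_length)
      qed
    qed
  }
qed

text \<open>\<open>nij\<close> asks for one matrix valid in all charts around p at once. The
  solution in one chart works in the others by naturality of T under changes of chart.\<close>

lemma nij_coeffs_nij:
  assumes J: "J \<in> acs_pos X A" and \<alpha>: "coframing X A J U \<alpha>" and p: "p \<in> U" and c: "c \<in> charts_at A p"
  shows "nij_coeffs (nij_at J c p) (\<lambda>i. \<alpha> i c p) (nij A J \<alpha> p)"
proof -
  obtain n where n: "nij_coeffs (nij_at J c p) (\<lambda>i. \<alpha> i c p) n"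
    and unique: "\<And>m. nij_coeffs (nij_at J c p) (\<lambda>i. \<alpha> i c p) m \<Longrightarrow> m = n"
    using nij_coeffs_unique[OF acs_props(3)[OF J c] antibilinear_nij_at[OF J c] coframing_props(3)[OF \<alpha> p c]]
    by blast
  have all: "nij_coeffs (nij_at J c' p) (\<lambda>i. \<alpha> i c' p) n" if c': "c' \<in> charts_at A p" for c'
    unfolding coframing_pull[OF \<alpha> p c' c]
  proof (rule nij_coeffs_pull_coframe[OF _ n])
    show "nij_at J c p (jac id c' c p *v u) (jac id c' c p *v v) = jac id c' c p *v nij_at J c' p u v" for u v
      using nij_at_natural[OF J J smooth_id, of c' p c] c c' acs_props(4)[OF J]
      by (auto simp: charts_at_iff)
  qed
  have "nij A J \<alpha> p = n"
    unfolding nij_def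
  proof (rule the_equality)
    show "\<forall>c\<in>charts_at A p. \<forall>i. d_comp J (-1) 2 1 0 (\<alpha> i) c p =
       (\<lambda>vs. \<Sum>j\<in>UNIV. n $ i $ j * cnj_form (wedge1 [\<alpha> (j + 1) c p, \<alpha> (j + 2) c p]) vs)"
      using all nij_equation_iff[OF J \<alpha> p] by blast
    show "m = n" if "\<forall>c\<in>charts_at A p. \<forall>i. d_comp J (-1) 2 1 0 (\<alpha> i) c p =
       (\<lambda>vs. \<Sum>j\<in>UNIV. m $ i $ j * cnj_form (wedge1 [\<alpha> (j + 1) c p, \<alpha> (j + 2) c p]) vs)" for m
      using that c nij_equation_iff[OF J \<alpha> p c] unique by blast
  qed
  then show ?thesis using n by simp
qed

lemma adj_coframe_axis_expansion:
  "adj_coframe J e i [v] = (\<Sum>k\<in>UNIV. of_real (v $ k) * adj_coframe J e i [axis k 1])"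
  by (rule linear_axis_expansion[OF linear_adj_coframe])

text \<open>A triple of coordinate vectors that is a complex frame at p remains one nearby, where
  the determinant stays nonzero. The adjugate coframe is smooth there because it is polynomial in
  J.\<close>

theorem coframing_exists:
  assumes J: "J \<in> acs_pos X A" and p: "p \<in> topspace X"
  shows "\<exists>U \<alpha>. coframing X A J U \<alpha> \<and> p \<in> U"
proof -
  obtain b where b: "b \<in> charts_at A p" using charts_at_exists[OF p] by blast
  then have bA: "b \<in> A" "p \<in> fst b" by (auto simp: charts_at_iff)
  obtain I where I: "det (frame_matrix (J b p) (axis_frame I)) \<noteq> 0"
    using exists_axis_frame[OF acs_props(3)[OF J b]] by blast
  define e where "e = axis_frame I"
  let ?Jb = "\<lambda>x. J b (chart_inv b x)"
  define V where "V = {x \<in> snd b ` fst b. det (frame_matrix (?Jb x) e) \<noteq> 0}"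
  define U where "U = {q \<in> fst b. snd b q \<in> V}"
  note Jb = acs_props(1)[OF J bA(1)] and Sb = chart_props(2)[OF bA(1)]
  have "smooth_on (\<lambda>x. det (frame_matrix (?Jb x) e)) (snd b ` fst b)"
    by (rule smooth_on_compose[OF Sb open_UNIV smooth_on_det_frame_matrix[OF open_UNIV] Jb]) simp
  from continuous_open_preimage[OF smooth_on_continuous_on[OF this] Sb, of "- {0}"]
  have V: "open V"
    by (simp add: V_def vimage_def Int_def open_Compl)
  have U: "openin X U"
    unfolding U_def using openin_chart_preimage[OF bA(1) V] .
  have U_iff: "q \<in> U \<longleftrightarrow> q \<in> fst b \<and> det (frame_matrix (J b q) e) \<noteq> 0" for q
    by (cases "q \<in> fst b") (simp_all add: U_def V_def chart_inv_simps[OF bA(1)])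
  have pU: "p \<in> U" using I bA by (simp add: U_iff e_def)
  \<comment> \<open>Constructed in the chart b and pulled back by the Jacobian to every other chart,
    so that compatibility is the chain rule.\<close>
  define \<alpha> :: "3 \<Rightarrow> 'a form_field" where
    "\<alpha> i c q = pull_coframe (jac id c b q) (adj_coframe (J b q) e) i" for i c q
  have bq: "b \<in> charts_at A q" if "q \<in> U" for q using that bA by (simp add: U_iff charts_at_iff)
  have co: "coframe (J c q) (\<lambda>i. \<alpha> i c q)" if q: "q \<in> U" "c \<in> charts_at A q" for q c
    unfolding \<alpha>_def
  proof (rule coframe_pull_coframe)
    show "invertible (jac id c b q)"
      using invertible_jac[OF orientation_id] q bq by simp
    show "jac id c b q ** J c q = J b q ** jac id c b q"
      using acs_props(4)[OF J q(2) bq[OF q(1)]] by simp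
    show "coframe (J b q) (adj_coframe (J b q) e)"
      using coframe_adj_coframe[OF acs_props(3)[OF J bq[OF q(1)]]] q(1) by (simp add: U_iff)
  qed
  have "smooth_form A U 1 (\<alpha> i)" for i
    unfolding smooth_form_def
  proof (intro conjI ballI allI)
    show "kform 1 (\<alpha> i c q)" if "q \<in> U" "c \<in> charts_at A q" for q c
      using co[OF that] unfolding coframe_def form10_def by blast
    show "\<alpha> i c q vs = \<alpha> i c' q (map ((*v) (jac id c c' q)) vs)"
      if "q \<in> U" "c \<in> charts_at A q" "c' \<in> charts_at A q" for q c c' vs
      unfolding \<alpha>_def pull_coframe_def jac_id_chain[OF that(2,3) bq[OF that(1)]]
      by (simp add: matrix_vector_mul_assoc o_def)
    show "smooth_on (\<lambda>x. \<alpha> i c (chart_inv c x) vs) (snd c ` (fst c \<inter> U))" if c: "c \<in> A" for c vs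
    proof -
      let ?S = "snd c ` (fst c \<inter> U)"
      have S: "open ?S" by (rule open_chart_image[OF c U])
      have Sdom: "?S \<subseteq> coord_dom id c b" by (auto simp: coord_dom_def U_iff)
      show ?thesis
      proof (cases "length vs = 1")
        case True
        then obtain v where vs: "vs = [v]" by (auto simp: length_Suc_conv)
        have 1: "smooth_on (\<lambda>x. jac id c b (chart_inv c x) *v v) ?S"
          using smooth_on_subset[OF smooth_on_jac[OF smooth_id c bA(1)] Sdom] by simp
        have cm: "smooth_on (coord_map id c b) ?S"
          using smooth_on_subset[OF smooth_on_coord_map[OF smooth_id c bA(1)] Sdom] .
        have "smooth_on (\<lambda>x. ?Jb (coord_map id c b x)) ?S"
          by (rule smooth_on_compose[OF S Sb Jb cm]) (rule coord_map_in[OF c], use Sdom in blast)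
        then have Jc: "smooth_on (\<lambda>x. J b (chart_inv c x)) ?S"
          by (rule smooth_on_cong[OF _ S]) (use bA c in \<open>auto simp: coord_map_def chart_inv_simps U_iff\<close>)
        have 2: "smooth_on (\<lambda>x. adj_coframe (J b (chart_inv c x)) e i [w]) ?S" for w
          by (rule smooth_on_compose[OF S open_UNIV smooth_on_adj_coframe[OF open_UNIV] Jc]) simp
        have "\<alpha> i c q vs = (\<Sum>k\<in>UNIV. of_real ((jac id c b q *v v) $ k) * adj_coframe (J b q) e i [axis k 1])" for q
          unfolding \<alpha>_def pull_coframe_def vs list.map by (rule adj_coframe_axis_expansion)
        then show ?thesis
          by (simp, intro smooth_on_sum smooth_on_mult smooth_on_of_real smooth_on_vec_nth 1 2 S)
      next
        case False
        then have "\<alpha> i c q vs = 0" for q by (simp add: \<alpha>_def pull_coframe_def adj_coframe_def)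
        then show ?thesis by (simp add: smooth_on_const S)
      qed
    qed
  qed
  then have "coframing X A J U \<alpha>"
    using U co unfolding coframing_def coframe_def by blast
  then show ?thesis using pU by blast
qed


section \<open>The invariant forms on the manifold\<close>

lemma Phi_frame_eq: "Phi_frame A J \<alpha> c p = phi_pt (nij A J \<alpha> p) (\<lambda>i. \<alpha> i c p)"
  by (simp add: Phi_frame_def phi_pt_def real_vol_def)

lemma psi_frame_eq: "psi_frame A J \<alpha> c p = psi_pt (nij A J \<alpha> p) (\<lambda>i. \<alpha> i c p)"
  by (simp add: psi_frame_def psi_pt_def hol_vol_def P_nij_def polar_det_eq Let_def)

theorem Phi_psi_eq_frame:
  assumes J: "J \<in> acs_pos X A" and \<alpha>: "coframing X A J U \<alpha>" and p: "p \<in> U" and c: "c \<in> charts_at A p"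
  shows "Phi X A J c p = Phi_frame A J \<alpha> c p" "psi X A J c p = psi_frame A J \<alpha> c p"
proof -
  have *: "Phi_frame A J \<beta> c p = Phi_frame A J \<alpha> c p" "psi_frame A J \<beta> c p = psi_frame A J \<alpha> c p"
    if \<beta>: "coframing X A J V \<beta>" "p \<in> V" for V \<beta>
    unfolding Phi_frame_eq psi_frame_eq
    by (rule phi_psi_pt_unique[OF acs_props(3)[OF J c] antibilinear_nij_at[OF J c] coframing_props(3)[OF \<alpha> p c]
        coframing_props(3)[OF \<beta> c] nij_coeffs_nij[OF J \<alpha> p c] nij_coeffs_nij[OF J \<beta> c]])+
  show "Phi X A J c p = Phi_frame A J \<alpha> c p"
    unfolding Phi_def by (rule the_equality) (use * \<alpha> p in blast)+
  show "psi X A J c p = psi_frame A J \<alpha> c p"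
    unfolding psi_def by (rule the_equality) (use * \<alpha> p in blast)+
qed

text \<open>From here on coframings enter only through their values at a single point.\<close>

lemma Phi_psi_pointwise:
  assumes J: "J \<in> acs_pos X A" and c: "c \<in> charts_at A p"
  obtains n a where "coframe (J c p) a" "nij_coeffs (nij_at J c p) a n"
    "Phi X A J c p = phi_pt n a" "psi X A J c p = psi_pt n a"
proof -
  obtain U \<alpha> where \<alpha>: "coframing X A J U \<alpha>" "p \<in> U"
    using coframing_exists[OF J charts_at_topspace[OF c]] by blast
  show ?thesis
    using that[OF coframing_props(3)[OF \<alpha> c] nij_coeffs_nij[OF J \<alpha> c]]
      Phi_psi_eq_frame[OF J \<alpha> c] by (simp add: Phi_frame_eq psi_frame_eq)
qed

text \<open>Taking the identity for f gives the behaviour under changes of chart.\<close>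

lemma Phi_psi_transfer:
  assumes J: "J1 \<in> acs_pos X A" "J2 \<in> acs_pos X A"
    and f: "smooth_map A f" "continuous_map X X f" "orientation_preserving A f"
    and c: "c \<in> charts_at A p" "c' \<in> charts_at A (f p)"
    and eq: "\<And>q. q \<in> fst c \<Longrightarrow> f q \<in> fst c' \<Longrightarrow> J2 c' (f q) ** jac f c c' q = jac f c c' q ** J1 c q"
  shows "Phi X A J1 c p vs = Phi X A J2 c' (f p) (map ((*v) (jac f c c' p)) vs)"
    "psi X A J1 c p vs = psi X A J2 c' (f p) (map ((*v) (jac f c c' p)) vs)"
proof -
  let ?M = "jac f c c' p"
  obtain n a where a: "coframe (J2 c' (f p)) a" and n: "nij_coeffs (nij_at J2 c' (f p)) a n"
    and 2: "Phi X A J2 c' (f p) = phi_pt n a" "psi X A J2 c' (f p) = psi_pt n a"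
    using Phi_psi_pointwise[OF J(2) c(2)] by metis
  obtain m b where b: "coframe (J1 c p) b" and m: "nij_coeffs (nij_at J1 c p) b m"
    and 1: "Phi X A J1 c p = phi_pt m b" "psi X A J1 c p = psi_pt m b"
    using Phi_psi_pointwise[OF J(1) c(1)] by metis
  have "?M ** J1 c p = J2 c' (f p) ** ?M"
    using eq[of p] c by (simp add: charts_at_iff)
  then have a': "coframe (J1 c p) (pull_coframe ?M a)"
    using coframe_pull_coframe[OF invertible_jac[OF f(3) c] _ a] by simp
  have n': "nij_coeffs (nij_at J1 c p) (pull_coframe ?M a) n"
    by (rule nij_coeffs_pull_coframe[OF nij_at_natural[OF J f(1,2) c eq] n])
  note u = phi_psi_pt_unique[OF acs_props(3)[OF J(1) c(1)] antibilinear_nij_at[OF J(1) c(1)] a' b n' m]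
  show "Phi X A J1 c p vs = Phi X A J2 c' (f p) (map ((*v) ?M) vs)"
    unfolding 1 2 u by (simp add: phi_pt_def real_vol_pull_coframe)
  show "psi X A J1 c p vs = psi X A J2 c' (f p) (map ((*v) ?M) vs)"
    unfolding 1 2 u by (simp add: psi_pt_def hol_vol_pull_coframe)
qed

lemma Phi_psi_chart_change:
  assumes J: "J \<in> acs_pos X A" and c: "c \<in> charts_at A p" "c' \<in> charts_at A p"
  shows "Phi X A J c p vs = Phi X A J c' p (map ((*v) (jac id c c' p)) vs)"
    "psi X A J c p vs = psi X A J c' p (map ((*v) (jac id c c' p)) vs)"
proof -
  have "J c' (id q) ** jac id c c' q = jac id c c' q ** J c q" if "q \<in> fst c" "id q \<in> fst c'" for q
    using acs_props(4)[OF J, of c q c'] that c by (simp add: charts_at_iff)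
  from Phi_psi_transfer[OF J J smooth_id _ orientation_id, of c p c', OF _ c(1) _ this] c
  show "Phi X A J c p vs = Phi X A J c' p (map ((*v) (jac id c c' p)) vs)"
    "psi X A J c p vs = psi X A J c' p (map ((*v) (jac id c c' p)) vs)"
    by simp_all
qed

lemma integrand_pointwise:
  assumes "Phi X A J c p = phi_pt n a" "psi X A J c p = psi_pt n a"
  shows "integrand X A c1 c2 J c p = (\<lambda>vs. \<i> / 8 * of_real (kappa c1 c2 n) * real_vol a vs)"
  unfolding integrand_def assms integrand_pt ..

lemma density_integrand:
  assumes J: "J \<in> acs_pos X A" and c: "c \<in> charts_at A p"
  shows "density (integrand X A c1 c2 J c p) = of_real (integrand_density c1 c2 (J c p) (dJ c J p))"
proof -
  obtain n a where a: "coframe (J c p) a" and n: "nij_coeffs (nij_at J c p) a n"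
    and 1: "Phi X A J c p = phi_pt n a" "psi X A J c p = psi_pt n a"
    using Phi_psi_pointwise[OF J c] by metis
  show ?thesis
    unfolding integrand_pointwise[OF 1]
      density_integrand_pt[OF acs_props(3)[OF J c] antibilinear_nij_at[OF J c] a n]
      integrand_density_def nij_at_eq[OF J c] ..
qed

lemma integrand_eq_density:
  assumes J: "J \<in> acs_pos X A" and c: "c \<in> charts_at A p" and vs: "length vs = 6"
  shows "integrand X A c1 c2 J c p vs = density (integrand X A c1 c2 J c p) * of_real (det (vector vs :: real^6^6))"
proof -
  obtain n a where a: "coframe (J c p) a" and 1: "Phi X A J c p = phi_pt n a" "psi X A J c p = psi_pt n a"
    using Phi_psi_pointwise[OF J c] by metis
  show ?thesis
    unfolding integrand_pointwise[OF 1] using real_vol_eq_density[OF a vs] by (simp add: density_def)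
qed

text \<open>Makes the smoothness of Phi a special case of the smoothness of the integrand.\<close>

lemma integrand_Phi: "integrand X A 1 0 J c p = Phi X A J c p"
  by (simp add: integrand_def)

lemma psi_eq_value:
  assumes J: "J \<in> acs_pos X A" and c: "c \<in> charts_at A p"
  shows "psi X A J c p vs = psi_value (J c p) (dJ c J p) vs"
proof -
  obtain n a where a: "coframe (J c p) a" and n: "nij_coeffs (nij_at J c p) a n"
    and 1: "psi X A J c p = psi_pt n a"
    using Phi_psi_pointwise[OF J c] by metis
  show ?thesis
    unfolding 1 psi_pt_formula[OF acs_props(3)[OF J c] antibilinear_nij_at[OF J c] a n]
      psi_value_def nij_at_eq[OF J c] ..
qed

lemma smooth_on_dJ:
  assumes J: "J \<in> acs_pos X A" and c: "c \<in> A"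
  shows "smooth_on (\<lambda>x. dJ c J (chart_inv c x) m) (snd c ` fst c)"
proof -
  obtain k i j where m: "m = (k, i, j)" by (cases m) auto
  have "smooth_on (\<lambda>x. frechet_derivative (\<lambda>x. J c (chart_inv c x)) (at x) (axis k 1) $ i $ j) (snd c ` fst c)"
    by (intro smooth_on_vec_nth smooth_on_frechet_derivative acs_props(1) chart_props(2) J c)
  then show ?thesis
    by (rule smooth_on_cong[OF _ chart_props(2)[OF c]]) (use c in \<open>auto simp: m dJ_def chart_inv_simps\<close>)
qed

lemma smooth_on_hpoly_acs:
  assumes J: "J \<in> acs_pos X A" and c: "c \<in> A" and F: "hpoly n weight_domain F"
  shows "smooth_on (\<lambda>x. F (J c (chart_inv c x)) (dJ c J (chart_inv c x))) (snd c ` fst c)"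
proof (rule smooth_on_hpoly[OF chart_props(2)[OF c] open_weight_domain F acs_props(1)[OF J c]])
  show "J c (chart_inv c x) \<in> weight_domain" if "x \<in> snd c ` fst c" for x
    using complex_structure_weight_domain acs_props(3)[OF J, of c "chart_inv c x"] that c
    by (simp add: charts_at_iff chart_inv_simps)
qed (rule smooth_on_dJ[OF J c])

lemma smooth_on_density_integrand:
  assumes J: "J \<in> acs_pos X A" and c: "c \<in> A"
  shows "smooth_on (\<lambda>x. density (integrand X A c1 c2 J c (chart_inv c x))) (snd c ` fst c)"
  by (rule smooth_on_cong[OF smooth_on_hpoly_acs[OF J c hpoly_integrand_density[of c1 c2]] chart_props(2)[OF c]])
    (use density_integrand[OF J] c in \<open>auto simp: charts_at_iff chart_inv_simps\<close>)

lemma fst_Int_topspace: "c \<in> A \<Longrightarrow> fst c \<inter> topspace X = fst c"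
  using chart_props(3) by blast

theorem smooth_form_Phi:
  assumes J: "J \<in> acs_pos X A"
  shows "smooth_form A (topspace X) 6 (Phi X A J)"
  unfolding smooth_form_def
proof (intro conjI ballI allI)
  show kf: "kform 6 (Phi X A J c p)" if c: "c \<in> charts_at A p" for p c
  proof -
    obtain n a where a: "coframe (J c p) a" and 1: "Phi X A J c p = phi_pt n a"
      using Phi_psi_pointwise[OF J c] by metis
    have "kform (length [a 1, a 2, a 3, cnj_form (a 1), cnj_form (a 2), cnj_form (a 3)]) (real_vol a)"
      unfolding real_vol_def by (rule kform_wedge1) (rule real_vol_linear[OF a])
    then show ?thesis unfolding 1 phi_pt_def by (intro kform_scale) (simp add: numeral_eq_Suc)
  qed
  show "Phi X A J c p vs = Phi X A J c' p (map ((*v) (jac id c c' p)) vs)"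
    if "c \<in> charts_at A p" "c' \<in> charts_at A p" for p c c' vs
    using Phi_psi_chart_change(1)[OF J that] .
  show "smooth_on (\<lambda>x. Phi X A J c (chart_inv c x) vs) (snd c ` (fst c \<inter> topspace X))" if c: "c \<in> A" for c vs
    unfolding fst_Int_topspace[OF c]
  proof (cases "length vs = 6")
    case True
    have "smooth_on (\<lambda>x. density (integrand X A 1 0 J c (chart_inv c x)) * of_real (det (vector vs :: real^6^6))) (snd c ` fst c)"
      by (intro smooth_on_mult smooth_on_const smooth_on_density_integrand chart_props J c)
    then show "smooth_on (\<lambda>x. Phi X A J c (chart_inv c x) vs) (snd c ` fst c)"
      by (rule smooth_on_cong[OF _ chart_props(2)[OF c]])
        (use integrand_eq_density[OF J _ True, of c _ 1 0] c in \<open>auto simp: integrand_Phi charts_at_iff chart_inv_simps\<close>)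
  next
    case False
    have "0 = Phi X A J c (chart_inv c x) vs" if "x \<in> snd c ` fst c" for x
    proof -
      have "chart_inv c x \<in> fst c" using that c by (simp add: chart_inv_simps)
      then have "kform 6 (Phi X A J c (chart_inv c x))"
        using c chart_props(3)[OF c] by (intro kf) (auto simp: charts_at_iff)
      then show ?thesis using False by (simp add: kform_def)
    qed
    then show "smooth_on (\<lambda>x. Phi X A J c (chart_inv c x) vs) (snd c ` fst c)"
      by (rule smooth_on_cong[OF smooth_on_const[OF chart_props(2)[OF c]] chart_props(2)[OF c]])
  qed
qed

theorem smooth_form_psi:
  assumes J: "J \<in> acs_pos X A"
  shows "smooth_form A (topspace X) 3 (psi X A J)"
  unfolding smooth_form_def
proof (intro conjI ballI allI)
  show "kform 3 (psi X A J c p)" if c: "c \<in> charts_at A p" for p c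
  proof -
    obtain n a where a: "coframe (J c p) a" and 1: "psi X A J c p = psi_pt n a"
      using Phi_psi_pointwise[OF J c] by metis
    have "kform (length [a 1, a 2, a 3]) (hol_vol a)"
      unfolding hol_vol_def by (rule kform_wedge1) (use a form10_linear in \<open>auto simp: coframe_def\<close>)
    then show ?thesis unfolding 1 psi_pt_def by (intro kform_scale) (simp add: numeral_eq_Suc)
  qed
  show "psi X A J c p vs = psi X A J c' p (map ((*v) (jac id c c' p)) vs)"
    if "c \<in> charts_at A p" "c' \<in> charts_at A p" for p c c' vs
    using Phi_psi_chart_change(2)[OF J that] .
  show "smooth_on (\<lambda>x. psi X A J c (chart_inv c x) vs) (snd c ` (fst c \<inter> topspace X))" if c: "c \<in> A" for c vs
    unfolding fst_Int_topspace[OF c]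
    by (rule smooth_on_cong[OF smooth_on_hpoly_acs[OF J c hpoly_psi_value[of vs]] chart_props(2)[OF c]])
      (use psi_eq_value[OF J] c in \<open>auto simp: charts_at_iff chart_inv_simps\<close>)
qed

theorem first_order_integrand: "first_order X A (integrand X A c1 c2)"
  unfolding first_order_def
proof (intro ballI impI)
  fix J1 J2 p c
  assume J: "J1 \<in> acs_pos X A" "J2 \<in> acs_pos X A" and jet: "same_1jet A J1 J2 p" and c: "c \<in> charts_at A p"
  have eq: "J1 c p = J2 c p" "nij_at J1 c p = nij_at J2 c p"
    using jet c unfolding same_1jet_def nij_at_def by metis+
  obtain n a where a: "coframe (J1 c p) a" "nij_coeffs (nij_at J1 c p) a n"
    and 1: "Phi X A J1 c p = phi_pt n a" "psi X A J1 c p = psi_pt n a"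
    using Phi_psi_pointwise[OF J(1) c] by metis
  obtain m b where b: "coframe (J2 c p) b" "nij_coeffs (nij_at J2 c p) b m"
    and 2: "Phi X A J2 c p = phi_pt m b" "psi X A J2 c p = psi_pt m b"
    using Phi_psi_pointwise[OF J(2) c] by metis
  note u = phi_psi_pt_unique[OF acs_props(3)[OF J(1) c] antibilinear_nij_at[OF J(1) c] a(1)
      b(1)[folded eq] a(2) b(2)[folded eq]]
  show "integrand X A c1 c2 J1 c p = integrand X A c1 c2 J2 c p"
    unfolding integrand_def 1 2 u ..
qed

theorem class_L61_integrand: "class_L61 X A (integrand X A c1 c2)"
  unfolding class_L61_def
proof
  fix c assume c: "c \<in> A"
  obtain a where a: "\<forall>ms. smooth_on (a ms) weight_domain"
    and eq: "\<forall>J\<in>weight_domain. \<forall>t. complex_of_real (integrand_density c1 c2 J t) =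
       (\<Sum>ms | length ms = 6. a ms J * of_real (prod_list (map t ms)))"
    using hpoly_integrand_density[of c1 c2] unfolding hpoly_def by blast
  have sub: "pos_complex_structures \<subseteq> weight_domain"
    using complex_structure_weight_domain by (auto simp: pos_complex_structures_def)
  \<comment> \<open>The polynomial was obtained with complex coefficients. Its values are real, so
    passing to the real parts of the coefficients does not change them.\<close>
  have "density (integrand X A c1 c2 J c p) =
      of_real (\<Sum>ms | length ms = 6. Re (a ms (J c p)) * prod_list (map (dJ c J p) ms))"
    if J: "J \<in> acs_pos X A" and p: "p \<in> fst c" for J p
  proof -
    have cp: "c \<in> charts_at A p" using c p by (simp add: charts_at_iff)
    have "J c p \<in> weight_domain" using sub acs_props(2)[OF J cp] by blast
    then have "complex_of_real (integrand_density c1 c2 (J c p) (dJ c J p)) =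
        (\<Sum>ms | length ms = 6. a ms (J c p) * of_real (prod_list (map (dJ c J p) ms)))"
      using eq by blast
    from arg_cong[OF this, of Re]
    have "integrand_density c1 c2 (J c p) (dJ c J p) =
        (\<Sum>ms | length ms = 6. Re (a ms (J c p)) * prod_list (map (dJ c J p) ms))"
      by simp
    then show ?thesis unfolding density_integrand[OF J cp] by simp
  qed
  moreover have "smooth_on (\<lambda>J. Re (a ms J)) weight_domain" for ms
    using a by (intro smooth_on_Re open_weight_domain) auto
  ultimately show "\<exists>a W. open W \<and> pos_complex_structures \<subseteq> W \<and> (\<forall>ms. smooth_on (a ms) W) \<and>
     (\<forall>J\<in>acs_pos X A. \<forall>p\<in>fst c. density (integrand X A c1 c2 J c p) =
        of_real (\<Sum>ms | length ms = 6. a ms (J c p) * prod_list (map (dJ c J p) ms)))"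
    using open_weight_domain sub
    by (intro exI[of _ "\<lambda>ms J. Re (a ms J)"] exI[of _ weight_domain]) blast
qed

text \<open>A top-degree form evaluated on the images of the coordinate vectors acquires the
  determinant of the Jacobian; these images are its columns, that is, the rows of its
  transpose.\<close>

lemma density_integrand_transfer:
  assumes J: "J1 \<in> acs_pos X A" "J2 \<in> acs_pos X A"
    and f: "smooth_map A f" "continuous_map X X f" "orientation_preserving A f"
    and c: "c \<in> charts_at A p" "c' \<in> charts_at A (f p)"
    and eq: "\<And>q. q \<in> fst c \<Longrightarrow> f q \<in> fst c' \<Longrightarrow> J2 c' (f q) ** jac f c c' q = jac f c c' q ** J1 c q"
  shows "density (integrand X A c1 c2 J1 c p) = of_real (det (jac f c c' p)) * density (integrand X A c1 c2 J2 c' (f p))"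
proof -
  let ?M = "jac f c c' p"
  let ?ax = "[axis 1 1, axis 2 1, axis 3 1, axis 4 1, axis 5 1, axis 6 1] :: (real^6) list"
  obtain n a where a: "coframe (J2 c' (f p)) a" and n: "nij_coeffs (nij_at J2 c' (f p)) a n"
    and 2: "Phi X A J2 c' (f p) = phi_pt n a" "psi X A J2 c' (f p) = psi_pt n a"
    using Phi_psi_pointwise[OF J(2) c(2)] by metis
  have 1: "Phi X A J1 c p = phi_pt n (pull_coframe ?M a)" "psi X A J1 c p = psi_pt n (pull_coframe ?M a)"
    using Phi_psi_transfer[OF J f c eq]
    by (simp_all add: fun_eq_iff 2 phi_pt_def psi_pt_def real_vol_pull_coframe hol_vol_pull_coframe)
  have ax: "?M *v axis i 1 = transpose ?M $ i" for i
    by (simp add: matrix_vector_mult_basis column_def transpose_def vec_eq_iff)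
  have "(vector (map ((*v) ?M) ?ax) :: real^6^6) $ i = transpose ?M $ i" for i
    unfolding list.map ax using exhaust_6[of i] by (elim disjE) (simp_all only: vector_6)
  then have v: "vector (map ((*v) ?M) ?ax) = transpose ?M" unfolding vec_eq_iff by blast
  have "length (map ((*v) ?M) ?ax) = 6" by simp
  from real_vol_eq_density[OF a this]
  have "real_vol a (map ((*v) ?M) ?ax) = density (real_vol a) * of_real (det ?M)"
    unfolding v det_transpose .
  then show ?thesis
    unfolding integrand_pointwise[OF 1] integrand_pointwise[OF 2]
    by (simp add: density_def real_vol_pull_coframe)
qed


section \<open>Pullback by diffeomorphisms\<close>

lemma orientation_diffeo_props:
  assumes "orientation_diffeo X A f"
  shows "smooth_map A f" "continuous_map X X f" "orientation_preserving A f" "homeomorphic_map X X f"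
    "p \<in> topspace X \<Longrightarrow> f p \<in> topspace X"
  using assms homeomorphic_imp_continuous_map[of X X f]
    homeomorphic_imp_surjective_map[of X X f]
  unfolding orientation_diffeo_def by auto

text \<open>The description of the pullback quantifies over all charts at f p. By the chain rule and
  the compatibility of J, the matrix solving the equation in one chart solves it in each, and
  invertibility of the Jacobian makes it unique.\<close>

lemma pullback_acs_eq:
  assumes f: "orientation_diffeo X A f" and J: "J \<in> acs_pos X A"
    and c: "c \<in> charts_at A p" "c' \<in> charts_at A (f p)"
  shows "jac f c c' p ** pullback_acs A f J c p = J c' (f p) ** jac f c c' p"
proof -
  note F = orientation_diffeo_props[OF f]
  have "\<exists>M. jac f c d p ** M = J d (f p) ** jac f c d p" if d: "d \<in> charts_at A (f p)" for d
  proof -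
    obtain B where "jac f c d p ** B = mat 1"
      using invertible_jac[OF F(3) c(1) d] by (auto simp: invertible_def)
    then have "jac f c d p ** (B ** (J d (f p) ** jac f c d p)) = J d (f p) ** jac f c d p"
      by (simp add: matrix_mul_assoc)
    then show ?thesis by blast
  qed
  then obtain M where M: "jac f c c' p ** M = J c' (f p) ** jac f c c' p" using c(2) by blast
  have all: "jac f c d p ** M = J d (f p) ** jac f c d p" if d: "d \<in> charts_at A (f p)" for d
  proof -
    have ch: "jac f c d p = jac id c' d (f p) ** jac f c c' p"
      using jac_chain[OF F(1,2) smooth_id, of c c' d p f] c d by (simp add: charts_at_iff)
    have "jac f c d p ** M = jac id c' d (f p) ** J c' (f p) ** jac f c c' p"
      unfolding ch by (simp add: matrix_mul_assoc[symmetric] M)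
    also have "\<dots> = J d (f p) ** jac f c d p"
      unfolding ch acs_props(4)[OF J c(2) d, symmetric] by (simp add: matrix_mul_assoc)
    finally show ?thesis .
  qed
  have "pullback_acs A f J c p = M"
    unfolding pullback_acs_def
  proof (simp add: c(1), rule the_equality)
    show "\<forall>c'\<in>charts_at A (f p). jac f c c' p ** M = J c' (f p) ** jac f c c' p" using all by blast
    fix M' assume "\<forall>c'\<in>charts_at A (f p). jac f c c' p ** M' = J c' (f p) ** jac f c c' p"
    then have eq: "jac f c c' p ** M' = jac f c c' p ** M" using c(2) M by simp
    obtain B where B: "B ** jac f c c' p = mat 1"
      using invertible_jac[OF F(3) c] by (auto simp: invertible_def)
    have "B ** (jac f c c' p ** M') = B ** (jac f c c' p ** M)" by (simp add: eq)
    then show "M' = M" by (simp add: matrix_mul_assoc B)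
  qed
  then show ?thesis using M by simp
qed

text \<open>M carries a basis adapted to J' to one adapted to J and multiplies its determinant by
  the positive number det M.\<close>

lemma pos_complex_structures_conj:
  assumes J: "J \<in> pos_complex_structures" and M: "det M > 0" "M ** J' = J ** M"
  shows "J' \<in> pos_complex_structures"
  unfolding pos_complex_structures_def mem_Collect_eq Let_def
proof (intro conjI allI impI)
  have "invertible M" using M(1) by (simp add: invertible_det_nz)
  then obtain B where B: "B ** M = mat 1" by (auto simp: invertible_def)
  have JJ: "J ** J = - mat 1" using J by (simp add: pos_complex_structures_def)
  have "M ** (J' ** J') = J ** J ** M" by (metis M(2) matrix_mul_assoc)
  also have "\<dots> = M ** (- mat 1)"
    unfolding JJ by (simp add: matrix_matrix_mult_def vec_eq_iff mat_def sum_negf if_distrib[of "\<lambda>x. x * _"]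
        if_distrib[of "\<lambda>x. _ * x"] if_distrib[of uminus] cong: if_cong)
  finally have "B ** M ** (J' ** J') = B ** M ** (- mat 1)" by (simp add: matrix_mul_assoc[symmetric])
  then show "J' ** J' = - mat 1" by (simp add: B)
  fix v1 v2 v3
  let ?R = "vector [v1, J' *v v1, v2, J' *v v2, v3, J' *v v3] :: real^6^6"
  let ?R' = "vector [M *v v1, J *v (M *v v1), M *v v2, J *v (M *v v2), M *v v3, J *v (M *v v3)] :: real^6^6"
  assume ne: "det ?R \<noteq> 0"
  have row: "(R ** transpose M) $ i = M *v (R $ i)" for R :: "real^6^6" and i
    by (simp add: matrix_matrix_mult_def transpose_def matrix_vector_mult_def vec_eq_iff mult.commute)
  have JM: "J *v (M *v v) = M *v (J' *v v)" for v
    by (simp add: matrix_vector_mul_assoc M(2))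
  have "?R' $ i = (?R ** transpose M) $ i" for i
    unfolding row JM using exhaust_6[of i] by (auto simp: vector_6)
  then have "?R' = ?R ** transpose M" by (simp add: vec_eq_iff)
  then have "det ?R' = det ?R * det M" by (simp add: det_mul)
  moreover have "det ?R' \<noteq> 0 \<longrightarrow> det ?R' > 0"
    using J unfolding pos_complex_structures_def Let_def by blast
  then have "det ?R' > 0" using ne M(1) \<open>det ?R' = det ?R * det M\<close> by simp
  ultimately show "det ?R > 0" using M(1) by (simp add: zero_less_mult_iff)
qed

text \<open>Cramer's rule writes each column of K as a rational expression in the entries of M and
  JM, so smoothness of K follows from that of M and J.\<close>

lemma smooth_on_conj:
  fixes M J K :: "real^6 \<Rightarrow> real^6^6"
  assumes S: "open S" and M: "\<And>v. smooth_on (\<lambda>x. M x *v v) S" and J: "smooth_on J S"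
    and eq: "\<And>x. x \<in> S \<Longrightarrow> M x ** K x = J x ** M x" and det: "\<And>x. x \<in> S \<Longrightarrow> det (M x) \<noteq> 0"
  shows "smooth_on K S"
proof -
  have Mij: "smooth_on (\<lambda>x. M x $ i $ j) S" for i j
  proof -
    have "M x $ i $ j = (M x *v axis j 1) $ i" for x
      by (simp add: matrix_vector_mult_basis column_def)
    then show ?thesis using smooth_on_vec_nth[OF S M] by simp
  qed
  have Ms: "smooth_on M S" by (rule smooth_on_matI[OF S Mij])
  have JM: "smooth_on (\<lambda>x. J x ** M x) S" by (intro smooth_on_matrix_matrix_mult S J Ms)
  have sm: "smooth_on (\<lambda>x. det (\<chi> r s. if s = i then (J x ** M x) $ r $ j else M x $ r $ s) * inverse (det (M x))) S" for i j
  proof (intro smooth_on_mult smooth_on_inverse smooth_on_det S Mij det)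
    show "smooth_on (\<lambda>x. (\<chi> r s. if s = i then (J x ** M x) $ r $ j else M x $ r $ s) $ r $ s) S" for r s
      by (cases "s = i") (simp_all add: Mij smooth_on_vec_nth S JM)
  qed auto
  have K: "det (\<chi> r s. if s = i then (J x ** M x) $ r $ j else M x $ r $ s) * inverse (det (M x)) = K x $ i $ j"
    if x: "x \<in> S" for x i j
  proof -
    have "M x *v (\<chi> s. K x $ s $ j) = (\<chi> r. (J x ** M x) $ r $ j)"
      using eq[OF x, symmetric] by (simp add: matrix_vector_mult_def matrix_matrix_mult_def vec_eq_iff)
    then have "(\<chi> s. K x $ s $ j) = (\<chi> k. det (\<chi> r s. if s = k then (\<chi> r. (J x ** M x) $ r $ j) $ r else M x $ r $ s) / det (M x))"
      using cramer[OF det[OF x]] by blast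
    then show ?thesis by (simp add: vec_eq_iff divide_inverse cong: if_cong)
  qed
  have "smooth_on (\<lambda>x. K x $ i $ j) S" for i j
    by (rule smooth_on_cong[OF sm S K])
  then show ?thesis by (rule smooth_on_matI[OF S])
qed

theorem pullback_acs_in:
  assumes f: "orientation_diffeo X A f" and J: "J \<in> acs_pos X A"
  shows "pullback_acs A f J \<in> acs_pos X A"
  unfolding acs_pos_def mem_Collect_eq
proof (intro conjI ballI allI impI)
  note F = orientation_diffeo_props[OF f]
  let ?K = "pullback_acs A f J"
  note eq = pullback_acs_eq[OF f J]
  show "?K c p \<in> pos_complex_structures" if "p \<in> topspace X" "c \<in> charts_at A p" for p c
  proof -
    obtain c' where c': "c' \<in> charts_at A (f p)" using charts_at_exists F(5) \<open>p \<in> topspace X\<close> by blast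
    show ?thesis
      using pos_complex_structures_conj[OF acs_props(2)[OF J c'] det_jac_pos[OF F(3) that(2) c'] eq[OF that(2) c']] .
  qed
  show "?K d p ** jac id c d p = jac id c d p ** ?K c p"
    if p: "p \<in> topspace X" and c: "c \<in> charts_at A p" and d: "d \<in> charts_at A p" for p c d
  proof -
    obtain c' where c': "c' \<in> charts_at A (f p)" using charts_at_exists F(5) p by blast
    have ch: "jac f c c' p = jac f d c' p ** jac id c d p"
      using jac_chain[OF smooth_id _ F(1), of c d c' p f] c d c' by (simp add: charts_at_iff)
    have "jac f d c' p ** (?K d p ** jac id c d p) = J c' (f p) ** (jac f d c' p ** jac id c d p)"
      unfolding matrix_mul_assoc eq[OF d c'] ..
    also have "\<dots> = jac f d c' p ** (jac id c d p ** ?K c p)"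
      unfolding ch[symmetric] eq[OF c c', symmetric] matrix_mul_assoc by (simp add: ch)
    finally have e: "jac f d c' p ** (?K d p ** jac id c d p) = jac f d c' p ** (jac id c d p ** ?K c p)" .
    obtain B where B: "B ** jac f d c' p = mat 1"
      using invertible_jac[OF F(3) d c'] by (auto simp: invertible_def)
    have "B ** (jac f d c' p ** (?K d p ** jac id c d p)) = B ** (jac f d c' p ** (jac id c d p ** ?K c p))"
      by (simp add: e)
    then show ?thesis by (simp add: matrix_mul_assoc B)
  qed
  show "?K c p = 0" if "c \<notin> charts_at A p" for c p
    using that by (simp add: pullback_acs_def)
  show "smooth_on (\<lambda>x. ?K c (chart_inv c x)) (snd c ` fst c)" if c: "c \<in> A" for c
  proof (rule smooth_on_local)
    fix x assume "x \<in> snd c ` fst c"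
    then obtain p where p: "p \<in> fst c" "x = snd c p" by blast
    then have "f p \<in> topspace X" using F(5) chart_props(3)[OF c] by blast
    then obtain c' where "c' \<in> charts_at A (f p)" using charts_at_exists by blast
    then have c': "c' \<in> A" "f p \<in> fst c'" by (auto simp: charts_at_iff)
    let ?S = "coord_dom f c c'"
    have S: "open ?S" by (rule open_coord_dom[OF c c'(1) F(2)])
    have y: "c \<in> charts_at A (chart_inv c y)" "c' \<in> charts_at A (f (chart_inv c y))" if "y \<in> ?S" for y
      using that c c'(1) by (auto simp: coord_dom_def charts_at_iff chart_inv_simps)
    have "smooth_on (\<lambda>y. ?K c (chart_inv c y)) ?S"
    proof (rule smooth_on_conj[OF S smooth_on_jac[OF F(1) c c'(1) F(2)]])
      have "smooth_on (\<lambda>y. J c' (chart_inv c' (coord_map f c c' y))) ?S"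
        by (rule smooth_on_compose[OF S chart_props(2)[OF c'(1)] acs_props(1)[OF J c'(1)]
              smooth_on_coord_map[OF F(1) c c'(1)]]) (rule coord_map_in[OF c])
      then show "smooth_on (\<lambda>y. J c' (f (chart_inv c y))) ?S"
        by (rule smooth_on_cong[OF _ S]) (use c c' in \<open>auto simp: coord_map_def coord_dom_def chart_inv_simps\<close>)
      show "jac f c c' (chart_inv c y) ** ?K c (chart_inv c y) = J c' (f (chart_inv c y)) ** jac f c c' (chart_inv c y)"
        if "y \<in> ?S" for y using eq[OF y[OF that]] .
      show "det (jac f c c' (chart_inv c y)) \<noteq> 0" if "y \<in> ?S" for y
        using det_jac_pos[OF F(3) y[OF that]] by simp
    qed
    moreover have "x \<in> ?S" using p c'(2) by (auto simp: coord_dom_def)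
    ultimately show "\<exists>U. open U \<and> x \<in> U \<and> smooth_on (\<lambda>x. ?K c (chart_inv c x)) U"
      using S by blast
  qed
qed

end

section \<open>Integration over the manifold\<close>

lemma absolutely_integrable_compact:
  fixes g :: "real^6 \<Rightarrow> real"
  assumes "compact Z" "continuous_on Z g"
  shows "g absolutely_integrable_on Z"
proof -
  have "integrable lborel (\<lambda>x. indicator Z x *\<^sub>R g x)"
    by (rule borel_integrable_compact[OF assms])
  then show ?thesis
    unfolding set_integrable_def by (subst integrable_completion) (auto dest: borel_measurable_integrable)
qed

lemma integral_support:
  fixes g :: "real^6 \<Rightarrow> real"
  assumes "S \<subseteq> T" "\<And>x. x \<in> T - S \<Longrightarrow> g x = 0"
  shows "g absolutely_integrable_on T \<longleftrightarrow> g absolutely_integrable_on S" "integral T g = integral S g"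
proof -
  have "(\<lambda>x. if x \<in> T then g x else 0) = (\<lambda>x. if x \<in> S then g x else 0)"
    using assms by (auto simp: fun_eq_iff)
  then show "g absolutely_integrable_on T \<longleftrightarrow> g absolutely_integrable_on S" "integral T g = integral S g"
    using absolutely_integrable_restrict_UNIV[of T g] absolutely_integrable_restrict_UNIV[of S g]
      integral_restrict_UNIV[of T g] integral_restrict_UNIV[of S g] by simp_all
qed

text \<open>Real values are treated as vectors in \<open>real^1\<close>, and the result is read off
  from their only component.\<close>

lemma change_of_variables_real:
  fixes F :: "real^6 \<Rightarrow> real" and g :: "real^6 \<Rightarrow> real^6"
  assumes S: "open S" and g: "\<And>x. x \<in> S \<Longrightarrow> (g has_derivative g' x) (at x)" and inj: "inj_on g S"
    and int: "(\<lambda>x. \<bar>det (matrix (g' x))\<bar> * F (g x)) absolutely_integrable_on S"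
  shows "F absolutely_integrable_on g ` S"
    "integral (g ` S) F = integral S (\<lambda>x. \<bar>det (matrix (g' x))\<bar> * F (g x))"
proof -
  let ?v = "\<lambda>r. vec r :: real^1"
  have v: "bounded_linear ?v" by (simp add: linear_conv_bounded_linear[symmetric] linear_vec)
  let ?h = "\<lambda>x. \<bar>det (matrix (g' x))\<bar> *\<^sub>R ?v (F (g x))"
  have h: "?h absolutely_integrable_on S"
    using absolutely_integrable_linear[OF int v] by (simp add: o_def vec_cmul scalar_mult_eq_scaleR)
  have 1: "(\<lambda>y. ?v (F y)) absolutely_integrable_on g ` S \<and> integral (g ` S) (\<lambda>y. ?v (F y)) = integral S ?h"
    using has_absolute_integral_change_of_variables[of S g g' "\<lambda>y. ?v (F y)" "integral S ?h"]
      h inj has_derivative_at_withinI[OF g] S by (auto simp: lmeasurable_iff_integrable_on)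
  from absolutely_integrable_linear[OF conjunct1[OF this] bounded_linear_vec_nth, of 1]
  show "F absolutely_integrable_on g ` S" by (simp add: o_def)
  have i1: "integral (g ` S) F = integral (g ` S) (\<lambda>y. ?v (F y)) $ 1"
    using integral_component_eq_cart[of "\<lambda>y. ?v (F y)" "g ` S" 1] 1
    by (simp add: absolutely_integrable_on_def)
  have "integral S (\<lambda>x. \<bar>det (matrix (g' x))\<bar> * F (g x)) = integral S ?h $ 1"
    using integral_component_eq_cart[of ?h S 1] h by (simp add: absolutely_integrable_on_def)
  then show "integral (g ` S) F = integral S (\<lambda>x. \<bar>det (matrix (g' x))\<bar> * F (g x))"
    using i1 1 by simp
qed

context oriented_manifold6
begin

lemma compact_Hausdorff: "compact_space X" "Hausdorff_space X" "normal_space X"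
  using manifold compact_Hausdorff_or_regular_imp_normal_space
  by (auto simp: compact_oriented_manifold6_def)

lemma continuous_on_chart_inv:
  assumes "c \<in> A" "continuous_map X euclideanreal h"
  shows "continuous_on (snd c ` fst c) (\<lambda>x. h (chart_inv c x))"
proof -
  have "open ((\<lambda>x. h (chart_inv c x)) -` B \<inter> snd c ` fst c)" if "open B" for B
  proof -
    have "openin X {p \<in> topspace X. h p \<in> B}"
      using assms(2) that by (auto intro: openin_continuous_map_preimage)
    from open_chart_image[OF assms(1) this]
    have "open (snd c ` (fst c \<inter> {p \<in> topspace X. h p \<in> B}))" .
    moreover have "snd c ` (fst c \<inter> {p \<in> topspace X. h p \<in> B}) = (\<lambda>x. h (chart_inv c x)) -` B \<inter> snd c ` fst c"
      using chart_props(3)[OF assms(1)] by (auto simp: chart_inv_simps[OF assms(1)])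
    ultimately show ?thesis by simp
  qed
  then show ?thesis
    using continuous_on_open_vimage[OF chart_props(2)[OF assms(1)]] by blast
qed

lemma compact_chart_image:
  assumes "c \<in> A" "compactin X Z" "Z \<subseteq> fst c"
  shows "compact (snd c ` Z)"
proof -
  have "compactin (subtopology X (fst c)) Z" using assms by (simp add: compactin_subtopology)
  then have "compactin (top_of_set (snd c ` fst c)) (snd c ` Z)"
    using homeomorphic_imp_continuous_map[OF chart_props(5)[OF assms(1)]] by (rule image_compactin)
  then show ?thesis by (simp add: compactin_subtopology)
qed

text \<open>The image of a chart is merely open and g may grow towards its boundary; integrability
  comes from the compact set outside of which g vanishes.\<close>

lemma absolutely_integrable_chart:
  fixes g :: "real^6 \<Rightarrow> real"
  assumes c: "c \<in> A" and g: "continuous_on (snd c ` fst c) g"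
    and Z: "closedin X Z" "Z \<subseteq> fst c" and 0: "\<And>p. p \<in> fst c - Z \<Longrightarrow> g (snd c p) = 0"
  shows "g absolutely_integrable_on snd c ` fst c"
proof -
  have "compact (snd c ` Z)"
    using compact_chart_image[OF c closedin_compact_space[OF compact_Hausdorff(1) Z(1)] Z(2)] .
  then have "g absolutely_integrable_on snd c ` Z"
    using g Z(2) by (intro absolutely_integrable_compact continuous_on_subset[OF g]) auto
  moreover have "g absolutely_integrable_on snd c ` fst c \<longleftrightarrow> g absolutely_integrable_on snd c ` Z"
    by (rule integral_support) (use Z 0 in auto)
  ultimately show ?thesis by simp
qed


subsection \<open>Partitions of unity\<close>

lemma bump_function:
  assumes "p \<in> topspace X"
  shows "\<exists>c V W g. c \<in> A \<and> openin X V \<and> p \<in> V \<and> closedin X W \<and> W \<subseteq> fst c \<and>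
    continuous_map X euclideanreal g \<and> (\<forall>q\<in>topspace X. 0 \<le> g q \<and> (q \<in> V \<longrightarrow> g q = (1::real)) \<and> (q \<notin> W \<longrightarrow> g q = 0))"
proof -
  obtain c where c: "c \<in> A" "p \<in> fst c" using charts_at_exists[OF assms] by (auto simp: charts_at_def)
  note N = compact_Hausdorff(3)[unfolded normal_space_alt, rule_format]
  have "closedin X {p}" using closedin_Hausdorff_sing_eq[OF compact_Hausdorff(2)] assms by blast
  then obtain V where V: "openin X V" "{p} \<subseteq> V" "X closure_of V \<subseteq> fst c"
    using N[of "{p}" "fst c"] chart_props(1)[OF c(1)] c(2) by auto
  \<comment> \<open>A second set between V and the chart: the Urysohn function is 1 on the closure
    of V and 0 off Q, so it vanishes outside the closure of Q, which still lies in the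
    chart.\<close>
  obtain Q where Q: "openin X Q" "X closure_of V \<subseteq> Q" "X closure_of Q \<subseteq> fst c"
    using N[of "X closure_of V" "fst c"] chart_props(1)[OF c(1)] V(3) by auto
  have "closedin X (topspace X - Q)" using Q(1) by blast
  moreover have "disjnt (topspace X - Q) (X closure_of V)" using Q(2) by (auto simp: disjnt_def)
  ultimately obtain g where g: "continuous_map X (top_of_set {0..1::real}) g"
    "g ` (topspace X - Q) \<subseteq> {0}" "g ` (X closure_of V) \<subseteq> {1}"
    using Urysohn_lemma[OF compact_Hausdorff(3), of "topspace X - Q" "X closure_of V" 0 "1::real"] by auto
  have gc: "continuous_map X euclideanreal g" and g01: "g ` topspace X \<subseteq> {0..1}"
    using g(1) by (auto simp: continuous_map_in_subtopology)
  have sub: "V \<subseteq> X closure_of V" "Q \<subseteq> X closure_of Q"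
    using V(1) Q(1) by (simp_all add: closure_of_subset openin_subset)
  have "0 \<le> g q \<and> (q \<in> V \<longrightarrow> g q = 1) \<and> (q \<notin> X closure_of Q \<longrightarrow> g q = 0)" if "q \<in> topspace X" for q
    using that g01 g(2,3) sub by (auto simp: image_subset_iff)
  then show ?thesis
    using c V(1,2) Q(3) gc
    by (intro exI[of _ c] exI[of _ V] exI[of _ "X closure_of Q"] exI[of _ g]) simp
qed

theorem partition_of_unity_exists: "\<exists>K \<rho>. K \<subseteq> A \<and> partition_of_unity X K \<rho>"
proof -
  obtain c V W g where b: "\<And>p. p \<in> topspace X \<Longrightarrow> c p \<in> A \<and> openin X (V p) \<and> p \<in> V p \<and>
    closedin X (W p) \<and> W p \<subseteq> fst (c p) \<and> continuous_map X euclideanreal (g p) \<and>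
    (\<forall>q\<in>topspace X. 0 \<le> g p q \<and> (q \<in> V p \<longrightarrow> g p q = (1::real)) \<and> (q \<notin> W p \<longrightarrow> g p q = 0))"
    using bump_function by metis
  have "\<exists>F. finite F \<and> F \<subseteq> V ` topspace X \<and> topspace X \<subseteq> \<Union>F"
  proof (rule compact_Hausdorff(1)[unfolded compact_space_alt, rule_format])
    show "(\<forall>U\<in>V ` topspace X. openin X U) \<and> topspace X \<subseteq> \<Union> (V ` topspace X)" using b by blast
  qed
  then obtain P where P: "finite P" "P \<subseteq> topspace X" "topspace X \<subseteq> \<Union> (V ` P)"
    by (metis finite_subset_image)
  define G where "G q = (\<Sum>p\<in>P. g p q)" for q
  have g0: "0 \<le> g p q" if "p \<in> P" "q \<in> topspace X" for p q using b P(2) that by blast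
  have G: "G q > 0" if q: "q \<in> topspace X" for q
  proof -
    obtain p where p: "p \<in> P" "q \<in> V p" using P(3) q by blast
    then have "g p q = 1" using b P(2) q by blast
    then show ?thesis unfolding G_def using p P(1) g0 q by (intro sum_pos2[of P p]) auto
  qed
  \<comment> \<open>Several bump functions may use the same chart, while a partition of unity is
    indexed by charts; hence they are grouped by chart before normalising.\<close>
  define \<rho> where "\<rho> d q = (\<Sum>p | p \<in> P \<and> c p = d. g p q) / G q" for d q
  have fin: "finite {p. p \<in> P \<and> c p = d}" for d using P(1) by simp
  have gc: "continuous_map X euclideanreal (g p)" if "p \<in> P" for p using b P(2) that by blast
  have "partition_of_unity X (c ` P) \<rho>"
    unfolding partition_of_unity_def
  proof (intro conjI ballI)
    show "finite (c ` P)" using P(1) by simp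
    fix d
    show "continuous_map X euclideanreal (\<rho> d)"
      unfolding \<rho>_def G_def
    proof (intro continuous_map_real_divide continuous_map_sum fin P(1))
      show "(\<Sum>p\<in>P. g p q) \<noteq> 0" if "q \<in> topspace X" for q using G[OF that] by (simp add: G_def)
    qed (use gc in auto)
    show "0 \<le> \<rho> d q" if "q \<in> topspace X" for q
      unfolding \<rho>_def using G[OF that] g0 that by (intro divide_nonneg_pos sum_nonneg) auto
    have "q \<in> \<Union> (W ` {p. p \<in> P \<and> c p = d})" if "q \<in> topspace X" "\<rho> d q \<noteq> 0" for q
    proof (rule ccontr)
      assume "\<not> ?thesis"
      then have "g p q = 0" if "p \<in> P \<and> c p = d" for p using b P(2) that \<open>q \<in> topspace X\<close> by blast
      then have "\<rho> d q = 0" by (simp add: \<rho>_def)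
      then show False using that by simp
    qed
    moreover have "closedin X (\<Union> (W ` {p. p \<in> P \<and> c p = d}))"
      using fin b P(2) by (intro closedin_Union) auto
    ultimately have "X closure_of {q \<in> topspace X. \<rho> d q \<noteq> 0} \<subseteq> \<Union> (W ` {p. p \<in> P \<and> c p = d})"
      by (intro closure_of_minimal) auto
    also have "\<dots> \<subseteq> fst d" using b P(2) by blast
    finally show "X closure_of {q \<in> topspace X. \<rho> d q \<noteq> 0} \<subseteq> fst d" .
  next
    fix q assume q: "q \<in> topspace X"
    have "(\<Sum>d\<in>c ` P. \<rho> d q) = (\<Sum>d\<in>c ` P. \<Sum>p | p \<in> P \<and> c p = d. g p q) / G q"
      by (simp add: \<rho>_def sum_divide_distrib)
    also have "(\<Sum>d\<in>c ` P. \<Sum>p | p \<in> P \<and> c p = d. g p q) = G q"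
      unfolding G_def using sum.image_gen[OF P(1), of "\<lambda>p. g p q" c] by simp
    finally show "(\<Sum>d\<in>c ` P. \<rho> d q) = 1" using G[OF q] by simp
  qed
  moreover have "c ` P \<subseteq> A" using b P(2) by blast
  ultimately show ?thesis by blast
qed


subsection \<open>Invariance of the integral\<close>

text \<open>Here D c p stands for the coefficient of a 6-form in the chart c; how it changes with
  the chart is a hypothesis of the lemmas that use it.\<close>

definition continuous_density :: "('a chart \<Rightarrow> 'a \<Rightarrow> real) \<Rightarrow> bool" where
  "continuous_density D \<longleftrightarrow> (\<forall>c\<in>A. continuous_on (snd c ` fst c) (\<lambda>x. D c (chart_inv c x)))"

definition supported_in :: "('a \<Rightarrow> real) \<Rightarrow> 'a chart \<Rightarrow> bool" where
  "supported_in h c \<longleftrightarrow> continuous_map X euclideanreal h \<and> X closure_of {p \<in> topspace X. h p \<noteq> 0} \<subseteq> fst c"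

lemma supported_in_zero:
  assumes "supported_in h c" "p \<in> topspace X" "p \<notin> fst c"
  shows "h p = 0"
  using assms closure_of_subset[of "{p \<in> topspace X. h p \<noteq> 0}" X]
  unfolding supported_in_def by blast

lemma absolutely_integrable_supported:
  assumes c: "c \<in> A" and h: "supported_in h c" and k: "continuous_map X euclideanreal k"
    and D: "continuous_density D"
  shows "(\<lambda>x. h (chart_inv c x) * k (chart_inv c x) * D c (chart_inv c x)) absolutely_integrable_on snd c ` fst c"
proof (rule absolutely_integrable_chart[OF c])
  show "continuous_on (snd c ` fst c) (\<lambda>x. h (chart_inv c x) * k (chart_inv c x) * D c (chart_inv c x))"
  proof (rule continuous_on_mult[OF continuous_on_mult])
    show "continuous_on (snd c ` fst c) (\<lambda>x. h (chart_inv c x))"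
      using h by (intro continuous_on_chart_inv[OF c]) (simp add: supported_in_def)
    show "continuous_on (snd c ` fst c) (\<lambda>x. k (chart_inv c x))"
      by (rule continuous_on_chart_inv[OF c k])
    show "continuous_on (snd c ` fst c) (\<lambda>x. D c (chart_inv c x))"
      using D c by (simp add: continuous_density_def)
  qed
  show "closedin X (X closure_of {p \<in> topspace X. h p \<noteq> 0})" by simp
  show "X closure_of {p \<in> topspace X. h p \<noteq> 0} \<subseteq> fst c" using h by (simp add: supported_in_def)
  show "h (chart_inv c (snd c p)) * k (chart_inv c (snd c p)) * D c (chart_inv c (snd c p)) = 0"
    if p: "p \<in> fst c - X closure_of {p \<in> topspace X. h p \<noteq> 0}" for p
  proof -
    have "h p = 0"
      using p chart_props(3)[OF c] closure_of_subset[of "{p \<in> topspace X. h p \<noteq> 0}" X] by blast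
    then show ?thesis using p by (simp add: chart_inv_simps[OF c])
  qed
qed

text \<open>On the part of chart c that f maps into c' this is the change of variables formula,
  where the absolute value disappears because f preserves orientation. Elsewhere in c the factor h'
  vanishes, and elsewhere in c' the factor h, by their supports.\<close>

lemma integral_transfer:
  assumes f: "smooth_map A f" "homeomorphic_maps X X f finv" "orientation_preserving A f"
    and D: "continuous_density D1"
    and eq: "\<And>c c' p. c \<in> charts_at A p \<Longrightarrow> c' \<in> charts_at A (f p) \<Longrightarrow> D1 c p = det (jac f c c' p) * D2 c' (f p)"
    and c: "c \<in> A" "c' \<in> A" and h: "supported_in h c" and h': "supported_in h' c'"
  shows "integral (snd c ` fst c) (\<lambda>x. h (chart_inv c x) * h' (f (chart_inv c x)) * D1 c (chart_inv c x)) =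
    integral (snd c' ` fst c') (\<lambda>y. h (finv (chart_inv c' y)) * h' (chart_inv c' y) * D2 c' (chart_inv c' y))"
proof -
  have cont: "continuous_map X X f" and finv: "\<And>p. p \<in> topspace X \<Longrightarrow> finv (f p) = p"
    "\<And>p. p \<in> topspace X \<Longrightarrow> f (finv p) = p" "\<And>p. p \<in> topspace X \<Longrightarrow> finv p \<in> topspace X"
    "\<And>p. p \<in> topspace X \<Longrightarrow> f p \<in> topspace X"
    using f(2) unfolding homeomorphic_maps_def continuous_map_def by auto
  let ?g = "\<lambda>x. h (chart_inv c x) * h' (f (chart_inv c x)) * D1 c (chart_inv c x)"
  let ?F = "\<lambda>y. h (finv (chart_inv c' y)) * h' (chart_inv c' y) * D2 c' (chart_inv c' y)"
  let ?S = "coord_dom f c c'" and ?\<phi> = "coord_map f c c'"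
  let ?\<phi>' = "\<lambda>x. (*v) (jac f c c' (chart_inv c x))"
  have "continuous_map X euclideanreal (\<lambda>p. h' (f p))"
    using continuous_map_compose[OF cont, of euclideanreal h'] h' by (simp add: supported_in_def o_def)
  from absolutely_integrable_supported[OF c(1) h this D]
  have int: "?g absolutely_integrable_on snd c ` fst c" .
  have Sc: "?S \<subseteq> snd c ` fst c" by (auto simp: coord_dom_def)
  have g0: "?g x = 0" if "x \<in> snd c ` fst c - ?S" for x
  proof -
    have "chart_inv c x \<in> fst c" "f (chart_inv c x) \<notin> fst c'"
      using that by (auto simp: coord_dom_def chart_inv_simps[OF c(1)])
    then have "h' (f (chart_inv c x)) = 0"
      using chart_props(3)[OF c(1)] finv(4) by (intro supported_in_zero[OF h']) auto
    then show ?thesis by simp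
  qed
  have x: "chart_inv c x \<in> fst c" "f (chart_inv c x) \<in> fst c'" "snd c (chart_inv c x) = x" if "x \<in> ?S" for x
    using that by (auto simp: coord_dom_def chart_inv_simps[OF c(1)])
  have gF: "?g x = \<bar>det (matrix (?\<phi>' x))\<bar> * ?F (?\<phi> x)" if "x \<in> ?S" for x
  proof -
    have ch: "c \<in> charts_at A (chart_inv c x)" "c' \<in> charts_at A (f (chart_inv c x))"
      using x[OF that] c by (simp_all add: charts_at_iff)
    have "chart_inv c' (?\<phi> x) = f (chart_inv c x)"
      unfolding coord_map_def using x[OF that] by (simp add: chart_inv_simps[OF c(2)])
    moreover have "finv (f (chart_inv c x)) = chart_inv c x"
      using x(1)[OF that] chart_props(3)[OF c(1)] by (intro finv) auto
    ultimately show ?thesis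
      using eq[OF ch] det_jac_pos[OF f(3) ch] by simp
  qed
  have "?g absolutely_integrable_on ?S" using int integral_support(1)[OF Sc g0] by simp
  then have intF: "(\<lambda>x. \<bar>det (matrix (?\<phi>' x))\<bar> * ?F (?\<phi> x)) absolutely_integrable_on ?S"
    by (rule set_integrable_cong[THEN iffD1, rotated 3]) (use gF in auto)
  have der: "(?\<phi> has_derivative ?\<phi>' x) (at x)" if "x \<in> ?S" for x
    using coord_map_has_derivative[OF f(1) c x(1,2)[OF that]] by (simp add: x(3)[OF that])
  have inj: "inj_on ?\<phi> ?S"
  proof (rule inj_onI)
    fix x y assume xy: "x \<in> ?S" "y \<in> ?S" "?\<phi> x = ?\<phi> y"
    then have "f (chart_inv c x) = f (chart_inv c y)"
      unfolding coord_map_def using x(2) inj_onD[OF chart_props(4)[OF c(2)]] by blast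
    then have "chart_inv c x = chart_inv c y"
      using x(1)[OF xy(1)] x(1)[OF xy(2)] chart_props(3)[OF c(1)] finv(1) by (metis subsetD)
    then show "x = y" using x(3) xy by metis
  qed
  have "integral (?\<phi> ` ?S) ?F = integral ?S (\<lambda>x. \<bar>det (matrix (?\<phi>' x))\<bar> * ?F (?\<phi> x))"
    by (rule change_of_variables_real(2)[OF open_coord_dom[OF c cont] der inj intF])
  also have "\<dots> = integral ?S ?g" by (rule integral_cong) (rule gF[symmetric])
  also have "\<dots> = integral (snd c ` fst c) ?g" using integral_support(2)[OF Sc g0] by simp
  finally have 1: "integral (?\<phi> ` ?S) ?F = integral (snd c ` fst c) ?g" .
  have "?\<phi> ` ?S \<subseteq> snd c' ` fst c'" using coord_map_in[OF c(1)] by blast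
  moreover have "?F y = 0" if y: "y \<in> snd c' ` fst c' - ?\<phi> ` ?S" for y
  proof -
    obtain q where q: "q \<in> fst c'" "y = snd c' q" using y by blast
    have top: "q \<in> topspace X" using q chart_props(3)[OF c(2)] by blast
    have "finv q \<notin> fst c"
    proof
      assume "finv q \<in> fst c"
      moreover have "f (finv q) = q" using finv(2)[OF top] .
      ultimately have "snd c (finv q) \<in> ?S" "?\<phi> (snd c (finv q)) = y"
        using q by (auto simp: coord_dom_def coord_map_def chart_inv_simps[OF c(1)])
      then show False using y by blast
    qed
    then have "h (finv q) = 0" using finv(3)[OF top] by (intro supported_in_zero[OF h])
    then show ?thesis using q by (simp add: chart_inv_simps[OF c(2)])
  qed
  ultimately have "integral (snd c' ` fst c') ?F = integral (?\<phi> ` ?S) ?F"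
    by (rule integral_support(2))
  then show ?thesis using 1 by simp
qed

definition pou_integral :: "'a chart set \<Rightarrow> ('a chart \<Rightarrow> 'a \<Rightarrow> real) \<Rightarrow> ('a chart \<Rightarrow> 'a \<Rightarrow> real) \<Rightarrow> real" where
  "pou_integral K \<rho> D = (\<Sum>c\<in>K. integral (snd c ` fst c) (\<lambda>x. \<rho> c (chart_inv c x) * D c (chart_inv c x)))"

lemma pou_supported: "partition_of_unity X K \<rho> \<Longrightarrow> c \<in> K \<Longrightarrow> supported_in (\<rho> c) c"
  by (simp add: partition_of_unity_def supported_in_def)

text \<open>Each integral is split by the other partition of unity, carried over by f or its
  inverse. The resulting double sums agree term by term, and summing out one partition in either
  order gives the two sides.\<close>

lemma pou_integral_transfer:
  assumes f: "smooth_map A f" "homeomorphic_map X X f" "orientation_preserving A f"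
    and D1: "continuous_density D1" and D2: "continuous_density D2"
    and eq: "\<And>c c' p. c \<in> charts_at A p \<Longrightarrow> c' \<in> charts_at A (f p) \<Longrightarrow> D1 c p = det (jac f c c' p) * D2 c' (f p)"
    and K: "K \<subseteq> A" "partition_of_unity X K \<rho>" and K': "K' \<subseteq> A" "partition_of_unity X K' \<rho>'"
  shows "pou_integral K \<rho> D1 = pou_integral K' \<rho>' D2"
proof -
  obtain finv where fi: "homeomorphic_maps X X f finv" using f(2) homeomorphic_map_maps by blast
  have cont: "continuous_map X X f" "continuous_map X X finv" and
    top: "\<And>p. p \<in> topspace X \<Longrightarrow> f p \<in> topspace X" "\<And>p. p \<in> topspace X \<Longrightarrow> finv p \<in> topspace X"
    using fi unfolding homeomorphic_maps_def continuous_map_def by auto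
  have fin: "finite K" "finite K'" using K K' by (auto simp: partition_of_unity_def)
  have one: "(\<Sum>c\<in>K. \<rho> c p) = 1" "(\<Sum>c\<in>K'. \<rho>' c p) = 1" if "p \<in> topspace X" for p
    using that K(2) K'(2) by (auto simp: partition_of_unity_def)
  have sup: "supported_in (\<rho> c) c" if "c \<in> K" for c using pou_supported[OF K(2) that] .
  have sup': "supported_in (\<rho>' c) c" if "c \<in> K'" for c using pou_supported[OF K'(2) that] .
  have ktop: "chart_inv c x \<in> topspace X" if "c \<in> A" "x \<in> snd c ` fst c" for c x
    using chart_inv_simps(3)[OF that] chart_props(3)[OF that(1)] by blast
  have "pou_integral K \<rho> D1 = (\<Sum>c\<in>K. integral (snd c ` fst c)
      (\<lambda>x. \<Sum>c'\<in>K'. \<rho> c (chart_inv c x) * \<rho>' c' (f (chart_inv c x)) * D1 c (chart_inv c x)))"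
    unfolding pou_integral_def
  proof (intro sum.cong refl integral_cong)
    fix c x assume "c \<in> K" "x \<in> snd c ` fst c"
    then have "chart_inv c x \<in> topspace X" using ktop K(1) by blast
    then have "(\<Sum>c'\<in>K'. \<rho>' c' (f (chart_inv c x))) = 1" using one(2) top(1) by blast
    then have "\<rho> c (chart_inv c x) * D1 c (chart_inv c x) =
       \<rho> c (chart_inv c x) * (\<Sum>c'\<in>K'. \<rho>' c' (f (chart_inv c x))) * D1 c (chart_inv c x)" by simp
    then show "\<rho> c (chart_inv c x) * D1 c (chart_inv c x) =
       (\<Sum>c'\<in>K'. \<rho> c (chart_inv c x) * \<rho>' c' (f (chart_inv c x)) * D1 c (chart_inv c x))"
      by (simp only: sum_distrib_left sum_distrib_right)
  qed
  also have "\<dots> = (\<Sum>c\<in>K. \<Sum>c'\<in>K'. integral (snd c ` fst c)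
      (\<lambda>x. \<rho> c (chart_inv c x) * \<rho>' c' (f (chart_inv c x)) * D1 c (chart_inv c x)))"
  proof (intro sum.cong refl Henstock_Kurzweil_Integration.integral_sum fin)
    fix c c' assume "c \<in> K" "c' \<in> K'"
    moreover from this have "continuous_map X euclideanreal (\<lambda>p. \<rho>' c' (f p))"
      using continuous_map_compose[OF cont(1), of euclideanreal "\<rho>' c'"] sup' by (simp add: supported_in_def o_def)
    ultimately show "(\<lambda>x. \<rho> c (chart_inv c x) * \<rho>' c' (f (chart_inv c x)) * D1 c (chart_inv c x)) integrable_on snd c ` fst c"
      using absolutely_integrable_supported[OF _ sup _ D1, of c "\<lambda>p. \<rho>' c' (f p)"] K(1)
      by (auto simp: absolutely_integrable_on_def)
  qed
  also have "\<dots> = (\<Sum>c\<in>K. \<Sum>c'\<in>K'. integral (snd c' ` fst c')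
      (\<lambda>y. \<rho> c (finv (chart_inv c' y)) * \<rho>' c' (chart_inv c' y) * D2 c' (chart_inv c' y)))"
  proof (intro sum.cong refl)
    fix c c' assume cc: "c \<in> K" "c' \<in> K'"
    then have "c \<in> A" "c' \<in> A" using K(1) K'(1) by auto
    from integral_transfer[OF f(1) fi f(3) D1 eq this sup[OF cc(1)] sup'[OF cc(2)]]
    show "integral (snd c ` fst c) (\<lambda>x. \<rho> c (chart_inv c x) * \<rho>' c' (f (chart_inv c x)) * D1 c (chart_inv c x)) =
      integral (snd c' ` fst c') (\<lambda>y. \<rho> c (finv (chart_inv c' y)) * \<rho>' c' (chart_inv c' y) * D2 c' (chart_inv c' y))" .
  qed
  also have "\<dots> = (\<Sum>c'\<in>K'. \<Sum>c\<in>K. integral (snd c' ` fst c')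
      (\<lambda>y. \<rho> c (finv (chart_inv c' y)) * \<rho>' c' (chart_inv c' y) * D2 c' (chart_inv c' y)))"
    by (rule sum.swap)
  also have "\<dots> = (\<Sum>c'\<in>K'. integral (snd c' ` fst c') (\<lambda>y. \<Sum>c\<in>K.
      \<rho> c (finv (chart_inv c' y)) * \<rho>' c' (chart_inv c' y) * D2 c' (chart_inv c' y)))"
  proof (intro sum.cong refl Henstock_Kurzweil_Integration.integral_sum[symmetric] fin)
    fix c c' assume "c' \<in> K'" "c \<in> K"
    moreover from this have "continuous_map X euclideanreal (\<lambda>p. \<rho> c (finv p))"
      using continuous_map_compose[OF cont(2), of euclideanreal "\<rho> c"] sup by (simp add: supported_in_def o_def)
    ultimately show "(\<lambda>y. \<rho> c (finv (chart_inv c' y)) * \<rho>' c' (chart_inv c' y) * D2 c' (chart_inv c' y)) integrable_on snd c' ` fst c'"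
      using absolutely_integrable_supported[OF _ sup' _ D2, of c' "\<lambda>p. \<rho> c (finv p)"] K'(1)
      by (auto simp: absolutely_integrable_on_def mult.commute mult.left_commute)
  qed
  also have "\<dots> = pou_integral K' \<rho>' D2"
    unfolding pou_integral_def
  proof (intro sum.cong refl integral_cong)
    fix c y assume "c \<in> K'" "y \<in> snd c ` fst c"
    then have "chart_inv c y \<in> topspace X" using ktop K'(1) by blast
    then have "(\<Sum>d\<in>K. \<rho> d (finv (chart_inv c y))) = 1" using one(1) top(2) by blast
    then have "\<rho>' c (chart_inv c y) * D2 c (chart_inv c y) =
       (\<Sum>d\<in>K. \<rho> d (finv (chart_inv c y))) * \<rho>' c (chart_inv c y) * D2 c (chart_inv c y)" by simp
    then show "(\<Sum>d\<in>K. \<rho> d (finv (chart_inv c y)) * \<rho>' c (chart_inv c y) * D2 c (chart_inv c y)) =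
       \<rho>' c (chart_inv c y) * D2 c (chart_inv c y)"
      by (simp only: sum_distrib_right)
  qed
  finally show ?thesis .
qed

text \<open>Uniqueness of integrals eliminates the chartwise values L, leaving the choice of charts
  and weights as the only freedom.\<close>

lemma has_form_integral_iff:
  assumes D: "continuous_density D" and w: "\<And>c p. c \<in> A \<Longrightarrow> p \<in> fst c \<Longrightarrow> density (w c p) = of_real (D c p)"
  shows "has_form_integral X A w I \<longleftrightarrow>
    (\<exists>K \<rho>. K \<subseteq> A \<and> partition_of_unity X K \<rho> \<and> I = of_real (pou_integral K \<rho> D))"
proof -
  have int: "((\<lambda>x. of_real (\<rho> c (chart_inv c x)) * density (w c (chart_inv c x))) has_integral
      of_real (integral (snd c ` fst c) (\<lambda>x. \<rho> c (chart_inv c x) * D c (chart_inv c x)))) (snd c ` fst c)"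
    if "K \<subseteq> A" "partition_of_unity X K \<rho>" "c \<in> K" for K \<rho> c
  proof -
    have c: "c \<in> A" using that by auto
    have "(\<lambda>x. \<rho> c (chart_inv c x) * 1 * D c (chart_inv c x)) absolutely_integrable_on snd c ` fst c"
      by (rule absolutely_integrable_supported[OF c pou_supported[OF that(2,3)] _ D]) simp
    then have "((\<lambda>x. \<rho> c (chart_inv c x) * D c (chart_inv c x)) has_integral
        integral (snd c ` fst c) (\<lambda>x. \<rho> c (chart_inv c x) * D c (chart_inv c x))) (snd c ` fst c)"
      by (simp add: absolutely_integrable_on_def integrable_integral)
    then have "((\<lambda>x. complex_of_real (\<rho> c (chart_inv c x) * D c (chart_inv c x))) has_integral
        of_real (integral (snd c ` fst c) (\<lambda>x. \<rho> c (chart_inv c x) * D c (chart_inv c x)))) (snd c ` fst c)"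
      by (rule has_integral_of_real)
    then show ?thesis
      by (rule has_integral_eq[rotated]) (use w[OF c] chart_inv_simps(3)[OF c] in auto)
  qed
  show ?thesis
  proof
    assume "has_form_integral X A w I"
    then obtain K \<rho> L where K: "K \<subseteq> A" "partition_of_unity X K \<rho>"
      and L: "\<forall>c\<in>K. ((\<lambda>x. of_real (\<rho> c (chart_inv c x)) * density (w c (chart_inv c x)))
                has_integral L c) (snd c ` fst c)" and I: "I = (\<Sum>c\<in>K. L c)"
      unfolding has_form_integral_def by blast
    have "L c = of_real (integral (snd c ` fst c) (\<lambda>x. \<rho> c (chart_inv c x) * D c (chart_inv c x)))" if "c \<in> K" for c
      using L that has_integral_unique int[OF K that] by blast
    then have "I = of_real (pou_integral K \<rho> D)" by (simp add: I pou_integral_def)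
    then show "\<exists>K \<rho>. K \<subseteq> A \<and> partition_of_unity X K \<rho> \<and> I = of_real (pou_integral K \<rho> D)"
      using K by blast
  next
    assume "\<exists>K \<rho>. K \<subseteq> A \<and> partition_of_unity X K \<rho> \<and> I = of_real (pou_integral K \<rho> D)"
    then obtain K \<rho> where K: "K \<subseteq> A" "partition_of_unity X K \<rho>" and I: "I = of_real (pou_integral K \<rho> D)"
      by blast
    show "has_form_integral X A w I"
      unfolding has_form_integral_def
      by (intro exI[of _ K] exI[of _ \<rho>]
          exI[of _ "\<lambda>c. of_real (integral (snd c ` fst c) (\<lambda>x. \<rho> c (chart_inv c x) * D c (chart_inv c x)))"])
        (use K int[OF K] in \<open>simp add: I pou_integral_def\<close>)
  qed
qed


subsection \<open>The functional\<close>

definition acs_density :: "real \<Rightarrow> real \<Rightarrow> 'a endo_field \<Rightarrow> 'a chart \<Rightarrow> 'a \<Rightarrow> real" where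
  "acs_density c1 c2 J c p = Re (density (integrand X A c1 c2 J c p))"

lemma acs_density:
  assumes J: "J \<in> acs_pos X A"
  shows "c \<in> A \<Longrightarrow> p \<in> fst c \<Longrightarrow> density (integrand X A c1 c2 J c p) = of_real (acs_density c1 c2 J c p)"
    "continuous_density (acs_density c1 c2 J)"
proof -
  show "c \<in> A \<Longrightarrow> p \<in> fst c \<Longrightarrow> density (integrand X A c1 c2 J c p) = of_real (acs_density c1 c2 J c p)"
    using density_integrand[OF J, of c p] by (simp add: acs_density_def charts_at_iff)
  show "continuous_density (acs_density c1 c2 J)"
    unfolding continuous_density_def acs_density_def
    by (intro ballI smooth_on_continuous_on smooth_on_Re chart_props smooth_on_density_integrand J)
qed

text \<open>With f the identity and equal structures this is independence of the charts and weights;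
  with the first structure the pullback of the second it is diffeomorphism invariance.\<close>

lemma pou_integral_functional:
  assumes J: "J1 \<in> acs_pos X A" "J2 \<in> acs_pos X A"
    and f: "smooth_map A f" "homeomorphic_map X X f" "orientation_preserving A f"
    and eq: "\<And>c c' p. c \<in> charts_at A p \<Longrightarrow> c' \<in> charts_at A (f p) \<Longrightarrow>
      J2 c' (f p) ** jac f c c' p = jac f c c' p ** J1 c p"
    and K: "K \<subseteq> A" "partition_of_unity X K \<rho>" and K': "K' \<subseteq> A" "partition_of_unity X K' \<rho>'"
  shows "pou_integral K \<rho> (acs_density c1 c2 J1) = pou_integral K' \<rho>' (acs_density c1 c2 J2)"
proof (rule pou_integral_transfer[OF f acs_density(2)[OF J(1)] acs_density(2)[OF J(2)] _ K K'])
  fix c c' p assume c: "c \<in> charts_at A p" "c' \<in> charts_at A (f p)"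
  have "density (integrand X A c1 c2 J1 c p) = of_real (det (jac f c c' p)) * density (integrand X A c1 c2 J2 c' (f p))"
    using density_integrand_transfer[OF J f(1) homeomorphic_imp_continuous_map[OF f(2)] f(3) c] eq c
    by (simp add: charts_at_iff)
  then show "acs_density c1 c2 J1 c p = det (jac f c c' p) * acs_density c1 c2 J2 c' (f p)"
    by (simp add: acs_density_def)
qed

theorem integral_unique:
  assumes J: "J \<in> acs_pos X A" and K: "K \<subseteq> A" "partition_of_unity X K \<rho>"
  shows "has_form_integral X A (integrand X A c1 c2 J) I \<longleftrightarrow> I = of_real (pou_integral K \<rho> (acs_density c1 c2 J))"
proof -
  have *: "pou_integral K' \<rho>' (acs_density c1 c2 J) = pou_integral K \<rho> (acs_density c1 c2 J)"
    if "K' \<subseteq> A" "partition_of_unity X K' \<rho>'" for K' \<rho>'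
    using pou_integral_functional[OF J J smooth_id _ orientation_id _ that K] acs_props(4)[OF J] by simp
  have "has_form_integral X A (integrand X A c1 c2 J) I \<longleftrightarrow>
      (\<exists>K \<rho>. K \<subseteq> A \<and> partition_of_unity X K \<rho> \<and> I = of_real (pou_integral K \<rho> (acs_density c1 c2 J)))"
    by (rule has_form_integral_iff[OF acs_density(2)[OF J] acs_density(1)[OF J]])
  moreover have "\<dots> \<longleftrightarrow> I = of_real (pou_integral K \<rho> (acs_density c1 c2 J))"
  proof
    assume "\<exists>K \<rho>. K \<subseteq> A \<and> partition_of_unity X K \<rho> \<and> I = of_real (pou_integral K \<rho> (acs_density c1 c2 J))"
    then obtain K' \<rho>' where "K' \<subseteq> A" "partition_of_unity X K' \<rho>'" "I = of_real (pou_integral K' \<rho>' (acs_density c1 c2 J))"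
      by blast
    then show "I = of_real (pou_integral K \<rho> (acs_density c1 c2 J))" using * by simp
  qed (use K in blast)
  ultimately show ?thesis by simp
qed

lemma functional_eq:
  assumes J: "J \<in> acs_pos X A" and K: "K \<subseteq> A" "partition_of_unity X K \<rho>"
  shows "functional X A c1 c2 J = of_real (pou_integral K \<rho> (acs_density c1 c2 J))"
  unfolding functional_def form_integral_def integral_unique[OF assms] by simp

theorem functional_pullback:
  assumes J: "J \<in> acs_pos X A" and f: "orientation_diffeo X A f"
  shows "functional X A c1 c2 (pullback_acs A f J) = functional X A c1 c2 J"
proof -
  obtain K \<rho> where K: "K \<subseteq> A" "partition_of_unity X K \<rho>" using partition_of_unity_exists by blast
  note F = orientation_diffeo_props[OF f] and P = pullback_acs_in[OF f J]
  show ?thesis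
    unfolding functional_eq[OF P K] functional_eq[OF J K]
    using pou_integral_functional[OF P J F(1,4,3) _ K K] pullback_acs_eq[OF f J] by simp
qed

end

theorem theorem1:
  fixes X :: "'a topology" and A :: "'a chart set" and c1 c2 :: real
  assumes "compact_oriented_manifold6 X A"
  shows
    "(\<forall>J\<in>acs_pos X A.
        (\<forall>p\<in>topspace X. \<exists>U \<alpha>. coframing X A J U \<alpha> \<and> p \<in> U) \<and>
        (\<forall>U \<alpha>. coframing X A J U \<alpha> \<longrightarrow> (\<forall>p\<in>U. \<forall>c\<in>charts_at A p.
           Phi X A J c p = Phi_frame A J \<alpha> c p \<and> psi X A J c p = psi_frame A J \<alpha> c p)) \<and>
        smooth_form A (topspace X) 6 (Phi X A J) \<and>
        smooth_form A (topspace X) 3 (psi X A J) \<and>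
        (\<exists>!I. has_form_integral X A (integrand X A c1 c2 J) I) \<and>
        functional X A c1 c2 J \<in> \<real>) \<and>
     (\<forall>J\<in>acs_pos X A. \<forall>f. orientation_diffeo X A f \<longrightarrow>
        pullback_acs A f J \<in> acs_pos X A \<and>
        functional X A c1 c2 (pullback_acs A f J) = functional X A c1 c2 J) \<and>
     first_order X A (integrand X A c1 c2) \<and>
     class_L61 X A (integrand X A c1 c2)"
proof -
  interpret oriented_manifold6 X A by unfold_locales (rule assms)
  obtain K \<rho> where K: "K \<subseteq> A" "partition_of_unity X K \<rho>" using partition_of_unity_exists by blast
  have "\<exists>!I. has_form_integral X A (integrand X A c1 c2 J) I" "functional X A c1 c2 J \<in> \<real>"
    if "J \<in> acs_pos X A" for J
    using integral_unique[OF that K] functional_eq[OF that K] by simp_all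
  then show ?thesis
    by (intro conjI ballI allI impI coframing_exists Phi_psi_eq_frame smooth_form_Phi smooth_form_psi
        pullback_acs_in functional_pullback first_order_integrand class_L61_integrand) assumption+
qed

end
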